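(* Let $\mathcal{P}=\mathcal{T}(V)/(R_{\mathcal{P}})$ and $\mathcal{Q}=\mathcal{T}(W)/(R_{\mathcal{Q}})$ be operads and let $\eta:\mathcal{P}\to\mathcal{Q}$ be an operad morphism. Then $\eta$ induces an operad morphism $\mathcal{A}\mathrm{Sp}(\eta):\mathcal{A}\mathrm{Sp}(\mathcal{P})\to\mathcal{A}\mathrm{Sp}(\mathcal{Q})$ between the arity-splittings such that $$\mathcal{A}\mathrm{Sp}(\eta)\circ\alpha_{\mathcal{P}}=\alpha_{\mathcal{Q}}\circ\eta ,$$ where $\alpha_{\mathcal{P}}:\mathcal{P}\to\mathcal{A}\mathrm{Sp}(\mathcal{P})$ and $\alpha_{\mathcal{Q}}:\mathcal{Q}\to\mathcal{A}\mathrm{Sp}(\mathcal{Q})$ are the canonical morphisms sending (the class of) a generator $\omega$ of arity $n$ to (the class of) $\sum_{i=1}^n\binom{\omega}{e_i}$.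
   Context: $\mathbf{k}$ is the base field. Trees are planar rooted reduced trees (every vertex has at least one input), including the trivial tree $|$ (one leaf, no vertex); a labeled tree $\tau$ over a graded set $\mathcal{V}=\coprod_n\mathcal{V}(n)$ has each vertex with $\ell$ inputs decorated by an element of $\mathcal{V}(\ell)$ and the leaves decorated by distinct positive integers; $\mathrm{Lin}(\tau)$ is the set of leaf labels. A nontrivial $\tau$ is uniquely a grafting $\tau=\omega(\tau_1\vee\cdots\vee\tau_\ell)$ with root vertex $\omega$. Presentations. An operad is presented as $\mathcal{P}=\mathcal{T}(V)/(R)$, where $V=\bigoplus_{n\ge1}V(n)$ is an $\mathbb{S}$-module with a basis $\mathcal{V}=\coprod_n\mathcal{V}(n)$, $\mathcal{V}(n)$ invariant under $\mathbb{S}_n$; $\mathcal{T}(V)$ is the free operad, $\mathcal{T}(V)\cong\bigoplus_{t\in\mathfrak{R}}t[V]$ with $\mathfrak{R}$ a set of planar representatives of isomorphism classes of reduced leaf-labeled trees and $t[V]$ the tensor product of $V(|\mathrm{in}(v)|)$ over the vertices $v$ of $t$; and $(R)$ is the operadic ideal generated by locally homogeneous elements $r_s=\sum_ic_{s,i}\tau_{s,i}$ ($\tau_{s,i}$ labeled trees over $\mathcal{V}$ with the set $\mathrm{Lin}(\tau_{s,i})$ independent of $i$). Arity-splitting. Put $\mathcal{A}\mathrm{Sp}(V)(n)=V(n)\otimes\bigoplus_{i=1}^n\mathbf{k}e_i$ (with $e_i=e_{\{i\}}$), write $\binom{\omega}{e_i}=\omega\otimes e_i$, $\binom{\omega}{*}=\sum_{i=1}^n\binom{\omega}{e_i}$,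 with action $\binom{\omega}{e_i}^\sigma=\binom{\omega^\sigma}{e_{\sigma(i)}}$. For a labeled tree $\tau$, $\mathcal{A}\mathrm{Sp}(\tau)$ is obtained by replacing each vertex $\omega$ by $\binom{\omega}{*}$ (expanded multilinearly), and for $x\in\mathrm{Lin}(\tau)$ define recursively $\mathcal{A}\mathrm{Sp}_x(|)=|$ and, for $\tau=\omega(\tau_1\vee\cdots\vee\tau_\ell)$ with $x\in\mathrm{Lin}(\tau_i)$, $\mathcal{A}\mathrm{Sp}_x(\tau)=\binom{\omega}{e_i}(\mathcal{A}\mathrm{Sp}(\tau_1)\vee\cdots\vee\mathcal{A}\mathrm{Sp}_x(\tau_i)\vee\cdots\vee\mathcal{A}\mathrm{Sp}(\tau_\ell))$. Then $\mathcal{A}\mathrm{Sp}(\mathcal{P})=\mathcal{T}(\mathcal{A}\mathrm{Sp}(V))/(\mathcal{A}\mathrm{Sp}(R))$ with $\mathcal{A}\mathrm{Sp}(R)=\{\sum_ic_{s,i}\mathcal{A}\mathrm{Sp}_x(\tau_{s,i}): s,\ x\in\mathrm{Lin}(r_s)\}$. The map $\omega\mapsto\binom{\omega}{*}$ on generators extends to a unique operad morphism $\alpha_{\mathcal{P}}:\mathcal{P}\to\mathcal{A}\mathrm{Sp}(\mathcal{P})$. *)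

theory Defs
  imports
    "HOL-Library.Poly_Mapping"
    "HOL-Library.FuncSet"
    "HOL-Combinatorics.Permutations"
begin

section \<open>Vectors as finite formal sums\<close>

text \<open>
  The vector space with basis \<open>B\<close> over the field \<open>'k\<close> is the space of finitely supported functions
  with support in \<open>B\<close>.
\<close>

definition pscale :: "'k::field \<Rightarrow> ('b \<Rightarrow>\<^sub>0 'k) \<Rightarrow> ('b \<Rightarrow>\<^sub>0 'k)" where
  "pscale c f = Poly_Mapping.map (\<lambda>a. c * a) f"

definition linext :: "('b \<Rightarrow> ('c \<Rightarrow>\<^sub>0 'k)) \<Rightarrow> ('b \<Rightarrow>\<^sub>0 'k::field) \<Rightarrow> ('c \<Rightarrow>\<^sub>0 'k)" where
  "linext g f = (\<Sum>b\<in>Poly_Mapping.keys f. pscale (Poly_Mapping.lookup f b) (g b))"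


section \<open>Symmetric operads over a field\<close>

text \<open>
  Data of a symmetric operad: in each arity \<open>n\<close> a vector space with an action of the permutations of
  \<open>{1..n}\<close>, the partial compositions \<open>\<circ>\<^sub>i\<close>, and the unit in arity 1.  \<open>pcomp O m i n x y\<close> is
  \<open>x \<circ>\<^sub>i y\<close> for \<open>x\<close> of arity \<open>m\<close> and \<open>y\<close> of arity \<open>n\<close>.  The operad laws are not imposed here:
  below this record is only instantiated with free operads and their quotients by operadic ideals.

  Convention for the action: \<open>x\<^sup>\<sigma>\<close> is the operation with \<open>x\<^sup>\<sigma>(a\<^sub>1,\<dots>,a\<^sub>n) = x(a\<^bsub>\<sigma>(1)\<^esub>,\<dots>,a\<^bsub>\<sigma>(n)\<^esub>)\<close>, i.e.
  input \<open>i\<close> of \<open>x\<close> becomes input \<open>\<sigma>(i)\<close> of \<open>x\<^sup>\<sigma>\<close>.  Hence acting by \<open>\<sigma>\<close> and then by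
  \<open>\<tau>\<close> is acting by \<open>\<tau> \<circ> \<sigma>\<close>: a right action if permutations are multiplied from left to right.  It is the convention that makes
  \<open>(\<omega>, e\<^sub>i)\<^sup>\<sigma> = (\<omega>\<^sup>\<sigma>, e\<^bsub>\<sigma>(i)\<^esub>)\<close> an action that follows the marked input.
\<close>

record ('a, 'k) operad =
  comps :: "nat \<Rightarrow> 'a set"
  padd :: "nat \<Rightarrow> 'a \<Rightarrow> 'a \<Rightarrow> 'a"
  psmul :: "nat \<Rightarrow> 'k \<Rightarrow> 'a \<Rightarrow> 'a"
  pzero :: "nat \<Rightarrow> 'a"
  pact :: "nat \<Rightarrow> (nat \<Rightarrow> nat) \<Rightarrow> 'a \<Rightarrow> 'a"
  pcomp :: "nat \<Rightarrow> nat \<Rightarrow> nat \<Rightarrow> 'a \<Rightarrow> 'a \<Rightarrow> 'a"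
  punit :: 'a

definition operad_morphism ::
  "('a, 'k::field) operad \<Rightarrow> ('b, 'k) operad \<Rightarrow> (nat \<Rightarrow> 'a \<Rightarrow> 'b) \<Rightarrow> bool" where
  "operad_morphism P Q f \<longleftrightarrow>
     (\<forall>n. f n \<in> comps P n \<rightarrow> comps Q n) \<and>
     (\<forall>n. \<forall>x\<in>comps P n. \<forall>y\<in>comps P n. f n (padd P n x y) = padd Q n (f n x) (f n y)) \<and>
     (\<forall>n c. \<forall>x\<in>comps P n. f n (psmul P n c x) = psmul Q n c (f n x)) \<and>
     (\<forall>n \<sigma>. \<sigma> permutes {1..n} \<longrightarrow>
        (\<forall>x\<in>comps P n. f n (pact P n \<sigma> x) = pact Q n \<sigma> (f n x))) \<and>
     (\<forall>m n. \<forall>i\<in>{1..m}. \<forall>x\<in>comps P m. \<forall>y\<in>comps P n.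
        f (m + n - 1) (pcomp P m i n x y) = pcomp Q m i n (f m x) (f n y)) \<and>
     f 1 (punit P) = punit Q"

inductive_set operadic_ideal ::
  "('a, 'k::field) operad \<Rightarrow> (nat \<Rightarrow> 'a set) \<Rightarrow> (nat \<times> 'a) set"
  for P :: "('a, 'k) operad" and G :: "nat \<Rightarrow> 'a set" where
  gen: "r \<in> G n \<Longrightarrow> (n, r) \<in> operadic_ideal P G"
| zero: "(n, pzero P n) \<in> operadic_ideal P G"
| add: "(n, x) \<in> operadic_ideal P G \<Longrightarrow> (n, y) \<in> operadic_ideal P G
    \<Longrightarrow> (n, padd P n x y) \<in> operadic_ideal P G"
| smul: "(n, x) \<in> operadic_ideal P G \<Longrightarrow> (n, psmul P n c x) \<in> operadic_ideal P G"
| act: "(n, x) \<in> operadic_ideal P G \<Longrightarrow> \<sigma> permutes {1..n}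
    \<Longrightarrow> (n, pact P n \<sigma> x) \<in> operadic_ideal P G"
| comp_left: "(m, x) \<in> operadic_ideal P G \<Longrightarrow> y \<in> comps P n \<Longrightarrow> i \<in> {1..m}
    \<Longrightarrow> (m + n - 1, pcomp P m i n x y) \<in> operadic_ideal P G"
| comp_right: "x \<in> comps P m \<Longrightarrow> (n, y) \<in> operadic_ideal P G \<Longrightarrow> i \<in> {1..m}
    \<Longrightarrow> (m + n - 1, pcomp P m i n x y) \<in> operadic_ideal P G"

definition coset :: "('a, 'k) operad \<Rightarrow> (nat \<times> 'a) set \<Rightarrow> nat \<Rightarrow> 'a \<Rightarrow> 'a set" where
  "coset P I n x = {padd P n x j |j. (n, j) \<in> I}"

text \<open>
  Each operation on cosets is the union of the cosets of the results over all representatives;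
  for an operadic ideal \<open>I\<close> all these cosets coincide.
\<close>

definition quotient_operad ::
  "('a, 'k) operad \<Rightarrow> (nat \<times> 'a) set \<Rightarrow> ('a set, 'k) operad" where
  "quotient_operad P I =
    \<lparr> comps = (\<lambda>n. coset P I n ` comps P n),
      padd = (\<lambda>n A B. \<Union>a\<in>A. \<Union>b\<in>B. coset P I n (padd P n a b)),
      psmul = (\<lambda>n c A. \<Union>a\<in>A. coset P I n (psmul P n c a)),
      pzero = (\<lambda>n. coset P I n (pzero P n)),
      pact = (\<lambda>n \<sigma> A. \<Union>a\<in>A. coset P I n (pact P n \<sigma> a)),
      pcomp = (\<lambda>m i n A B. \<Union>a\<in>A. \<Union>b\<in>B. coset P I (m + n - 1) (pcomp P m i n a b)),
      punit = coset P I 1 (punit P) \<rparr>"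


section \<open>Labeled trees\<close>

text \<open>
  An \<open>\<S>\<close>-module \<open>V\<close> with an invariant basis \<open>\<V>\<close> is given by the graded set \<open>\<V>\<close> (\<open>gens V n\<close> is
  \<open>\<V>(n)\<close>) together with the action of the permutations of \<open>{1..n}\<close> on \<open>\<V>(n)\<close>; \<open>V(n)\<close> is spanned by
  \<open>\<V>(n)\<close>.  The sets \<open>\<V>(n)\<close> need not be disjoint: the number of inputs of a vertex tells in which
  arity its decoration is read.
\<close>

record 'v smodule =
  gens :: "nat \<Rightarrow> 'v set"
  gact :: "nat \<Rightarrow> (nat \<Rightarrow> nat) \<Rightarrow> 'v \<Rightarrow> 'v"

definition is_smodule :: "'v smodule \<Rightarrow> bool" where
  "is_smodule V \<longleftrightarrow>
     gens V 0 = {} \<and>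
     (\<forall>n \<sigma>. \<sigma> permutes {1..n} \<longrightarrow> gact V n \<sigma> \<in> gens V n \<rightarrow> gens V n) \<and>
     (\<forall>n. \<forall>\<omega>\<in>gens V n. gact V n id \<omega> = \<omega>) \<and>
     (\<forall>n \<sigma> \<tau>. \<sigma> permutes {1..n} \<longrightarrow> \<tau> permutes {1..n} \<longrightarrow>
        (\<forall>\<omega>\<in>gens V n. gact V n \<tau> (gact V n \<sigma> \<omega>) = gact V n (\<tau> \<circ> \<sigma>) \<omega>))"

text \<open>\<open>Leaf a\<close> is the trivial tree whose only leaf is labeled \<open>a\<close>.\<close>

datatype 'v tree = Leaf nat | Node 'v "'v tree list"

primrec leaves :: "'v tree \<Rightarrow> nat list" where
  "leaves (Leaf a) = [a]"
| "leaves (Node \<omega> ts) = concat (map leaves ts)"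

primrec decorated :: "'v smodule \<Rightarrow> 'v tree \<Rightarrow> bool" where
  "decorated V (Leaf a) \<longleftrightarrow> True"
| "decorated V (Node \<omega> ts) \<longleftrightarrow>
     ts \<noteq> [] \<and> \<omega> \<in> gens V (length ts) \<and> list_all (\<lambda>b. b) (map (decorated V) ts)"

definition Lin :: "'v tree \<Rightarrow> nat set" where
  "Lin t = set (leaves t)"

definition labeled_trees :: "'v smodule \<Rightarrow> nat set \<Rightarrow> 'v tree set" where
  "labeled_trees V X = {t. decorated V t \<and> distinct (leaves t) \<and> Lin t = X \<and> 0 \<notin> X}"

primrec subst :: "(nat \<Rightarrow> 'v tree) \<Rightarrow> 'v tree \<Rightarrow> 'v tree" where
  "subst f (Leaf a) = f a"
| "subst f (Node \<omega> ts) = Node \<omega> (map (subst f) ts)"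

definition relabel :: "(nat \<Rightarrow> nat) \<Rightarrow> 'v tree \<Rightarrow> 'v tree" where
  "relabel \<rho> = subst (\<lambda>a. Leaf (\<rho> a))"

text \<open>\<open>t \<circ>\<^sub>i s\<close>, with the leaves renumbered in the usual way.\<close>

definition tree_comp :: "nat \<Rightarrow> 'v tree \<Rightarrow> 'v tree \<Rightarrow> 'v tree" where
  "tree_comp i t s = subst (\<lambda>j.
     if j < i then Leaf j
     else if j = i then relabel (\<lambda>k. k + i - 1) s
     else Leaf (j + length (leaves s) - 1)) t"

text \<open>
  Isomorphism of decorated, leaf-labeled trees: planar trees that differ by reordering the inputs of
  vertices, the decorations being acted upon accordingly
  (\<open>\<omega>\<^sup>\<sigma>(t\<^sub>1,\<dots>,t\<^sub>n) = \<omega>(t\<^bsub>\<sigma>(1)\<^esub>,\<dots>,t\<^bsub>\<sigma>(n)\<^esub>)\<close>), represent the same tree monomial.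
\<close>

inductive tree_iso :: "'v smodule \<Rightarrow> 'v tree \<Rightarrow> 'v tree \<Rightarrow> bool" for V :: "'v smodule" where
  refl: "tree_iso V t t"
| sym: "tree_iso V t u \<Longrightarrow> tree_iso V u t"
| trans: "tree_iso V t u \<Longrightarrow> tree_iso V u v \<Longrightarrow> tree_iso V t v"
| cong: "list_all2 (tree_iso V) ts us \<Longrightarrow> tree_iso V (Node \<omega> ts) (Node \<omega> us)"
| reorder: "n = length ts \<Longrightarrow> \<omega> \<in> gens V n \<Longrightarrow> \<sigma> permutes {1..n} \<Longrightarrow>
    tree_iso V (Node (gact V n \<sigma> \<omega>) ts) (Node \<omega> (map (\<lambda>i. ts ! (\<sigma> i - 1)) [1..<Suc n]))"

definition iso_class :: "'v smodule \<Rightarrow> 'v tree \<Rightarrow> 'v tree set" where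
  "iso_class V t = {u. tree_iso V t u}"


section \<open>The free operad and presentations\<close>

text \<open>
  \<open>\<T>(V)(n)\<close> has as basis the isomorphism classes of trees decorated over \<open>\<V>\<close> with leaves labeled by
  \<open>1, \<dots>, n\<close>.  Since the leaves carry distinct labels and every vertex has an input, leaf-labeled trees
  have no nontrivial automorphisms, and choosing a planar representative of each underlying
  leaf-labeled tree identifies this space with the direct sum of the \<open>t[V]\<close>.
\<close>

definition free_operad :: "'v smodule \<Rightarrow> ('v tree set \<Rightarrow>\<^sub>0 'k::field, 'k) operad" where
  "free_operad V =
    \<lparr> comps = (\<lambda>n. {f. Poly_Mapping.keys f \<subseteq> iso_class V ` labeled_trees V {1..n}}),
      padd = (\<lambda>n f g. f + g),
      psmul = (\<lambda>n. pscale),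
      pzero = (\<lambda>n. 0),
      pact = (\<lambda>n \<sigma>. linext (\<lambda>A. Poly_Mapping.single (\<Union>t\<in>A. iso_class V (relabel \<sigma> t)) 1)),
      pcomp = (\<lambda>m i n f g.
         linext (\<lambda>A. linext (\<lambda>B.
           Poly_Mapping.single (\<Union>t\<in>A. \<Union>s\<in>B. iso_class V (tree_comp i t s)) 1) g) f),
      punit = Poly_Mapping.single (iso_class V (Leaf 1)) 1 \<rparr>"

text \<open>
  Relations are formal linear combinations of planar labeled trees that are locally homogeneous, i.e.
  all trees that occur have the same set of leaf labels.
\<close>

definition locally_homogeneous :: "'v smodule \<Rightarrow> ('v tree \<Rightarrow>\<^sub>0 'k::field) \<Rightarrow> bool" where
  "locally_homogeneous V r \<longleftrightarrow> (\<exists>X. Poly_Mapping.keys r \<subseteq> labeled_trees V X)"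

definition rel_Lin :: "('v tree \<Rightarrow>\<^sub>0 'k::field) \<Rightarrow> nat set" where
  "rel_Lin r = (\<Union>t\<in>Poly_Mapping.keys r. Lin t)"

text \<open>
  The label set of a relation may be any finite set \<open>X\<close> of positive integers; to view the relation in
  \<open>\<T>(V)(n)\<close>, \<open>n = |X|\<close>, its leaves are renumbered along the increasing bijection \<open>X \<rightarrow> {1..n}\<close>.  (Any
  other bijection yields the same ideal; for \<open>X = {1..n}\<close> nothing is changed.)
\<close>

definition standardize :: "'v tree \<Rightarrow> 'v tree" where
  "standardize t = relabel (\<lambda>a. card {b \<in> Lin t. b \<le> a}) t"

definition to_free :: "'v smodule \<Rightarrow> ('v tree \<Rightarrow>\<^sub>0 'k::field) \<Rightarrow> ('v tree set \<Rightarrow>\<^sub>0 'k)" where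
  "to_free V = linext (\<lambda>t. Poly_Mapping.single (iso_class V (standardize t)) 1)"

definition relation_ideal ::
  "'v smodule \<Rightarrow> ('v tree \<Rightarrow>\<^sub>0 'k::field) set \<Rightarrow> (nat \<times> ('v tree set \<Rightarrow>\<^sub>0 'k)) set" where
  "relation_ideal V R =
     operadic_ideal (free_operad V) (\<lambda>n. to_free V ` {r \<in> R. card (rel_Lin r) = n})"

text \<open>The operad \<open>\<T>(V)/(R)\<close> and the quotient map onto it.\<close>

definition presented_operad ::
  "'v smodule \<Rightarrow> ('v tree \<Rightarrow>\<^sub>0 'k::field) set \<Rightarrow> (('v tree set \<Rightarrow>\<^sub>0 'k) set, 'k) operad" where
  "presented_operad V R = quotient_operad (free_operad V) (relation_ideal V R)"

definition class_of ::
  "'v smodule \<Rightarrow> ('v tree \<Rightarrow>\<^sub>0 'k::field) set \<Rightarrow> nat \<Rightarrow> ('v tree set \<Rightarrow>\<^sub>0 'k) \<Rightarrow> ('v tree set \<Rightarrow>\<^sub>0 'k) set"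
  where
  "class_of V R n = coset (free_operad V) (relation_ideal V R) n"

text \<open>A generator of arity \<open>n\<close> as an element of \<open>\<T>(V)(n)\<close>: the corolla with leaves \<open>1, \<dots>, n\<close>.\<close>

definition generator :: "'v smodule \<Rightarrow> nat \<Rightarrow> 'v \<Rightarrow> ('v tree set \<Rightarrow>\<^sub>0 'k::field)" where
  "generator V n \<omega> = Poly_Mapping.single (iso_class V (Node \<omega> (map Leaf [1..<Suc n]))) 1"


section \<open>Arity-splitting\<close>

text \<open>The basis vector \<open>\<omega> \<otimes> e\<^sub>i\<close> of \<open>\<A>Sp(V)(n)\<close> is encoded as the pair \<open>(\<omega>, i)\<close>.\<close>

definition ASp_smodule :: "'v smodule \<Rightarrow> ('v \<times> nat) smodule" where
  "ASp_smodule V =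
    \<lparr> gens = (\<lambda>n. gens V n \<times> {1..n}),
      gact = (\<lambda>n \<sigma> (\<omega>, i). (gact V n \<sigma> \<omega>, \<sigma> i)) \<rparr>"

lemma is_smodule_ASp: "is_smodule V \<Longrightarrow> is_smodule (ASp_smodule V)"
  unfolding is_smodule_def ASp_smodule_def
  by (auto simp: Pi_iff simp del: atLeastAtMost_iff dest: permutes_in_image)

text \<open>Grafting \<open>\<omega>(f\<^sub>1 \<or> \<dots> \<or> f\<^sub>l)\<close>, extended multilinearly to formal sums of trees.\<close>

definition graft :: "'v \<Rightarrow> ('v tree \<Rightarrow>\<^sub>0 'k::field) list \<Rightarrow> ('v tree \<Rightarrow>\<^sub>0 'k)" where
  "graft \<omega> fs = (\<Sum>ts\<in>listset (map Poly_Mapping.keys fs).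
     Poly_Mapping.single (Node \<omega> ts) (\<Prod>j<length fs. Poly_Mapping.lookup (fs ! j) (ts ! j)))"

primrec ASp_tree :: "'v tree \<Rightarrow> (('v \<times> nat) tree \<Rightarrow>\<^sub>0 'k::field)" where
  "ASp_tree (Leaf a) = Poly_Mapping.single (Leaf a) 1"
| "ASp_tree (Node \<omega> ts) = (\<Sum>i=1..length ts. graft (\<omega>, i) (map ASp_tree ts))"

text \<open>
  In the second equation the sum has exactly one term if the leaf labels are distinct and \<open>x\<close> is one
  of them; list positions start at \<open>0\<close>, inputs at \<open>1\<close>.
\<close>

primrec ASp_tree_at :: "nat \<Rightarrow> 'v tree \<Rightarrow> (('v \<times> nat) tree \<Rightarrow>\<^sub>0 'k::field)" where
  "ASp_tree_at x (Leaf a) = Poly_Mapping.single (Leaf a) 1"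
| "ASp_tree_at x (Node \<omega> ts) =
     (\<Sum>i\<in>{i \<in> {1..length ts}. x \<in> Lin (ts ! (i - 1))}.
        graft (\<omega>, i) ((map ASp_tree ts)[i - 1 := map (ASp_tree_at x) ts ! (i - 1)]))"

definition ASp_relations ::
  "('v tree \<Rightarrow>\<^sub>0 'k::field) set \<Rightarrow> (('v \<times> nat) tree \<Rightarrow>\<^sub>0 'k) set" where
  "ASp_relations R = {linext (ASp_tree_at x) r |r x. r \<in> R \<and> x \<in> rel_Lin r}"

text \<open>\<open>\<A>Sp(\<P>)\<close> for \<open>\<P> = \<T>(V)/(R)\<close>.\<close>

definition ASp_operad ::
  "'v smodule \<Rightarrow> ('v tree \<Rightarrow>\<^sub>0 'k::field) set \<Rightarrow> ((('v \<times> nat) tree set \<Rightarrow>\<^sub>0 'k) set, 'k) operad"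
  where
  "ASp_operad V R = presented_operad (ASp_smodule V) (ASp_relations R)"

text \<open>
  \<open>\<alpha>\<^sub>\<P>\<close> is the unique operad morphism \<open>\<P> \<rightarrow> \<A>Sp(\<P>)\<close> that sends the class of each generator \<open>\<omega>\<close> of
  arity \<open>n\<close> to the class of \<open>\<Sum>\<^sub>i (\<omega>, e\<^sub>i)\<close>.  Extensionality fixes the values of the HOL function outside
  the operad.
\<close>

definition alpha ::
  "'v smodule \<Rightarrow> ('v tree \<Rightarrow>\<^sub>0 'k::field) set \<Rightarrow>
     nat \<Rightarrow> ('v tree set \<Rightarrow>\<^sub>0 'k) set \<Rightarrow> (('v \<times> nat) tree set \<Rightarrow>\<^sub>0 'k) set" where
  "alpha V R = (THE \<alpha>.
     operad_morphism (presented_operad V R) (ASp_operad V R) \<alpha> \<and>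
     (\<forall>n. \<alpha> n \<in> extensional (comps (presented_operad V R) n)) \<and>
     (\<forall>n. \<forall>\<omega>\<in>gens V n.
        \<alpha> n (class_of V R n (generator V n \<omega>)) =
        class_of (ASp_smodule V) (ASp_relations R) n
          (\<Sum>i=1..n. generator (ASp_smodule V) n (\<omega>, i))))"

end

theory Submission
  imports Defs "HOL-Library.Disjoint_Sets"
begin

text \<open>
  Choose for every generator \<open>\<omega>\<close> of \<open>\<P>\<close> a formal sum of planar trees \<open>H(\<omega>)\<close> that represents \<open>\<eta>(\<omega>)\<close>, and
  send \<open>(\<omega>, e\<^sub>i)\<close> to \<open>ASp\<^sub>i(H(\<omega>))\<close>.  On trees with arbitrary leaf labels, arity-splitting is substitution of
  \<open>(\<omega>, *)\<close> for every vertex \<open>\<omega>\<close>, and \<open>ASp\<^sub>x\<close> is the part of \<open>ASp\<close> in which the path that follows the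
  marked inputs from the root ends in \<open>x\<close>.  As the relations of an arity-splitting are
  homogeneous for this end point, \<open>ASp\<^sub>x\<close> descends to \<open>\<Q>\<close>, and the assignment above extends to trees so
  that it commutes with \<open>ASp\<^sub>x\<close>; in particular it respects the relations.  The lift \<open>H\<close> is equivariant only modulo
  the relations, which is why all maps are first defined on planar trees.
\<close>

section \<open>Linear extension and multilinear substitution\<close>

text \<open>Summing ASp_i(H(omega)) over the marks i gives ASp(H(omega)), which is what the square
  demands on the generator omega; moreover every term of ASp_i(H(omega)) has end point i, so marks
  and end points correspond under substitution. As H(omega) is a formal sum of trees of arbitrary
  shape (in arity 1 possibly the trivial tree), substitution for a vertex has to be multilinear in
  the subtrees. The obstacle is that elements of a presented operad are cosets of sums of
  isomorphism classes, and that every composition renumbers leaves. The congruence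
  \<open>null\<close> removes both layers: \<open>null_iff\<close> translates it into membership in
  the operadic ideal, and \<open>standardize_graft_leaf\<close> absorbs the renumbering into a
  permutation. Morphisms out of a presentation are needed with existence and with uniqueness:
  \<alpha> is a definite description, and \<eta> is given abstractly, so that only uniqueness shows
  that H computes it on all classes.\<close>

abbreviation basis :: "'b \<Rightarrow> ('b \<Rightarrow>\<^sub>0 'k::field)" where
  "basis b \<equiv> Poly_Mapping.single b 1"

lemma lookup_pscale [simp]:
  "Poly_Mapping.lookup (pscale c f) x = c * Poly_Mapping.lookup f x"
  unfolding pscale_def by (simp add: Poly_Mapping.map.rep_eq when_def)

lemma pscale_add: "pscale c (f + g) = pscale c f + pscale c g"
  by (rule poly_mapping_eqI) (simp add: lookup_add algebra_simps)

lemma pscale_zero [simp]: "pscale c 0 = 0"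
  by (rule poly_mapping_eqI) simp

lemma zero_pscale [simp]: "pscale 0 f = 0"
  by (rule poly_mapping_eqI) simp

lemma one_pscale [simp]: "pscale 1 f = f"
  by (rule poly_mapping_eqI) simp

lemma pscale_pscale [simp]: "pscale a (pscale b f) = pscale (a * b) f"
  by (rule poly_mapping_eqI) simp

lemma add_pscale: "pscale (a + b) f = pscale a f + pscale b f"
  by (rule poly_mapping_eqI) (simp add: lookup_add algebra_simps)

lemma pscale_minus_one: "pscale (- 1) f = - f"
  by (rule poly_mapping_eqI) simp

lemma pscale_sum: "pscale c (\<Sum>a\<in>A. f a) = (\<Sum>a\<in>A. pscale c (f a))"
  by (induction A rule: infinite_finite_induct) (simp_all add: pscale_add)

lemma pscale_single [simp]: "pscale c (Poly_Mapping.single b d) = Poly_Mapping.single b (c * d)"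
  by (rule poly_mapping_eqI) (simp add: lookup_single when_def)

text \<open>Additivity of \<open>linext\<close> needs one common index set for the supports of
  \<open>f\<close>, \<open>f'\<close> and \<open>f + f'\<close>; the additional coefficients are
  zero.\<close>

lemma linext_superset:
  assumes "finite A" "Poly_Mapping.keys f \<subseteq> A"
  shows "linext g f = (\<Sum>b\<in>A. pscale (Poly_Mapping.lookup f b) (g b))"
  unfolding linext_def by (rule sum.mono_neutral_left) (use assms in \<open>auto simp: in_keys_iff\<close>)

lemma linext_zero [simp]: "linext g 0 = 0"
  unfolding linext_def by simp

lemma linext_add: "linext g (f + f') = linext g f + linext g f'"
proof -
  let ?A = "Poly_Mapping.keys f \<union> Poly_Mapping.keys f'"
  have "linext g (f + f') = (\<Sum>b\<in>?A. pscale (Poly_Mapping.lookup (f + f') b) (g b))"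
    by (rule linext_superset) (auto simp: Poly_Mapping.keys_add)
  moreover have "linext g f = (\<Sum>b\<in>?A. pscale (Poly_Mapping.lookup f b) (g b))"
    "linext g f' = (\<Sum>b\<in>?A. pscale (Poly_Mapping.lookup f' b) (g b))"
    by (rule linext_superset; auto)+
  ultimately show ?thesis
    by (simp add: lookup_add add_pscale sum.distrib)
qed

lemma keys_pscale: "Poly_Mapping.keys (pscale c f) \<subseteq> Poly_Mapping.keys f"
  by (auto simp: in_keys_iff)

lemma linext_pscale: "linext g (pscale c f) = pscale c (linext g f)"
proof -
  have "linext g (pscale c f) =
    (\<Sum>b\<in>Poly_Mapping.keys f. pscale (Poly_Mapping.lookup (pscale c f) b) (g b))"
    by (rule linext_superset) (simp_all add: keys_pscale)
  then show ?thesis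
    by (simp add: linext_def pscale_sum)
qed

lemma linext_single [simp]: "linext g (Poly_Mapping.single b c) = pscale c (g b)"
proof -
  have "linext g (Poly_Mapping.single b c) =
    (\<Sum>b'\<in>{b}. pscale (Poly_Mapping.lookup (Poly_Mapping.single b c) b') (g b'))"
    by (rule linext_superset) auto
  then show ?thesis by simp
qed

lemma linext_minus: "linext g (- f) = - linext g f"
  using linext_pscale[of g "- 1" f] by (simp add: pscale_minus_one)

lemma linext_diff: "linext g (f - f') = linext g f - linext g f'"
  using linext_add[of g f "- f'"] by (simp add: linext_minus)

lemma linext_sum: "linext g (\<Sum>a\<in>A. f a) = (\<Sum>a\<in>A. linext g (f a))"
  by (induction A rule: infinite_finite_induct) (simp_all add: linext_add)

lemma linext_cong: "(\<And>b. b \<in> Poly_Mapping.keys f \<Longrightarrow> g b = h b) \<Longrightarrow> linext g f = linext h f"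
  unfolding linext_def by (rule sum.cong) auto

lemma linext_linext: "linext g (linext h f) = linext (\<lambda>b. linext g (h b)) f"
  unfolding linext_def[of h] linext_def[of "\<lambda>b. linext g (h b)"]
  by (simp add: linext_sum linext_pscale)

lemma linext_fun_zero [simp]: "linext (\<lambda>b. 0) f = 0"
  unfolding linext_def by simp

lemma linext_fun_add: "linext (\<lambda>b. g b + h b) f = linext g f + linext h f"
  unfolding linext_def by (simp add: pscale_add sum.distrib)

lemma linext_fun_pscale: "linext (\<lambda>b. pscale c (g b)) f = pscale c (linext g f)"
  unfolding linext_def by (simp add: pscale_sum mult.commute)

lemma linext_fun_diff: "linext (\<lambda>b. g b - h b) f = linext g f - linext h f"
  using linext_fun_add[of g "\<lambda>b. pscale (-1) (h b)" f] linext_fun_pscale[of "-1" h f]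
  by (simp add: pscale_minus_one)

lemma linext_fun_sum: "linext (\<lambda>b. \<Sum>a\<in>A. g a b) f = (\<Sum>a\<in>A. linext (g a) f)"
  by (induction A rule: infinite_finite_induct) (simp_all add: linext_fun_add)

text \<open>Interchange of two finite sums; a bilinear expression may be expanded in either argument
  first.\<close>

lemma linext_swap:
  "linext (\<lambda>a. linext (\<lambda>b. h a b) g) f = linext (\<lambda>b. linext (\<lambda>a. h a b) f) g"
  unfolding linext_def[of _ g]
  by (subst linext_fun_sum) (simp add: linext_fun_pscale)

lemma linext_basis [simp]: "linext basis f = f"
  by (rule poly_mapping_eqI)
    (simp add: linext_def lookup_sum lookup_single when_def in_keys_iff if_distrib cong: if_cong)

text \<open>Linear subspaces of a space of formal sums. Spans of sets of trees, the congruence below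
  and the zero space are all handled through this one notion.\<close>

definition lin_closed :: "('b \<Rightarrow>\<^sub>0 'k::field) set \<Rightarrow> bool" where
  "lin_closed S \<longleftrightarrow> 0 \<in> S \<and> (\<forall>f\<in>S. \<forall>g\<in>S. f + g \<in> S) \<and> (\<forall>c. \<forall>f\<in>S. pscale c f \<in> S)"

lemma lin_closed_sum:
  "lin_closed S \<Longrightarrow> (\<And>a. a \<in> A \<Longrightarrow> f a \<in> S) \<Longrightarrow> (\<Sum>a\<in>A. f a) \<in> S"
  by (induction A rule: infinite_finite_induct) (auto simp: lin_closed_def)

lemma lin_closed_linext:
  "lin_closed S \<Longrightarrow> (\<And>b. b \<in> Poly_Mapping.keys f \<Longrightarrow> g b \<in> S) \<Longrightarrow> linext g f \<in> S"
  unfolding linext_def by (rule lin_closed_sum) (auto simp: lin_closed_def)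

lemma lin_closed_diff: "lin_closed S \<Longrightarrow> f \<in> S \<Longrightarrow> g \<in> S \<Longrightarrow> f - g \<in> S"
proof -
  assume S: "lin_closed S" "f \<in> S" "g \<in> S"
  then have "f + pscale (- 1) g \<in> S" unfolding lin_closed_def by blast
  then show ?thesis by (simp add: pscale_minus_one)
qed

lemma lin_closed_span: "lin_closed {f. Poly_Mapping.keys f \<subseteq> B}"
  unfolding lin_closed_def
  by (auto dest!: subsetD[OF Poly_Mapping.keys_add] subsetD[OF keys_pscale])

lemma keys_linext: "Poly_Mapping.keys (linext g f) \<subseteq> (\<Union>b\<in>Poly_Mapping.keys f. Poly_Mapping.keys (g b))"
  using lin_closed_linext[OF lin_closed_span, of f g "\<Union>b\<in>Poly_Mapping.keys f. Poly_Mapping.keys (g b)"]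
  by auto

section \<open>Tensor products of formal sums and grafting\<close>

primrec tensor :: "('b \<Rightarrow>\<^sub>0 'k::field) list \<Rightarrow> ('b list \<Rightarrow>\<^sub>0 'k)" where
  "tensor [] = basis []"
| "tensor (f # fs) = linext (\<lambda>b. linext (\<lambda>bs. basis (b # bs)) (tensor fs)) f"

text \<open>Expanding the product: a choice of one term in each factor is a head chosen from
  \<open>f\<close> and a list chosen from \<open>fs\<close>. This identifies the recursion, suited
  to induction over the factors, with the closed formula in \<open>graft\<close>.\<close>

lemma tensor_eq_sum:
  "tensor fs = (\<Sum>ts\<in>listset (map Poly_Mapping.keys fs).
     Poly_Mapping.single ts (\<Prod>j<length fs. Poly_Mapping.lookup (fs ! j) (ts ! j)))"
proof (induction fs)
  case Nil
  then show ?case by simp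
next
  case (Cons f fs)
  let ?c = "\<lambda>ts. \<Prod>j<length fs. Poly_Mapping.lookup (fs ! j) (ts ! j)"
  have set_Cons: "listset (map Poly_Mapping.keys (f # fs)) =
      (\<lambda>(t, ts). t # ts) ` (Poly_Mapping.keys f \<times> listset (map Poly_Mapping.keys fs))"
    by (auto simp: set_Cons_def)
  have "tensor (f # fs) = (\<Sum>t\<in>Poly_Mapping.keys f. \<Sum>ts\<in>listset (map Poly_Mapping.keys fs).
      Poly_Mapping.single (t # ts) (Poly_Mapping.lookup f t * ?c ts))"
    by (simp add: Cons.IH linext_sum linext_def[of _ f] pscale_sum)
  also have "\<dots> = (\<Sum>ts\<in>listset (map Poly_Mapping.keys (f # fs)).
     Poly_Mapping.single ts (\<Prod>j<length (f # fs). Poly_Mapping.lookup ((f # fs) ! j) (ts ! j)))"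
    unfolding set_Cons
    by (subst sum.reindex)
      (auto simp: inj_on_def sum.cartesian_product case_prod_unfold prod.lessThan_Suc_shift
        simp del: prod.lessThan_Suc intro!: sum.cong)
  finally show ?case .
qed

lemma graft_eq_tensor: "graft \<omega> fs = linext (\<lambda>ts. basis (Node \<omega> ts)) (tensor fs)"
  unfolding graft_def tensor_eq_sum by (simp add: linext_sum)

lemma tensor_basis [simp]: "tensor (map (\<lambda>t. basis (h t)) ts) = basis (map h ts)"
  by (induction ts) simp_all

lemma graft_basis: "graft \<omega> (map (\<lambda>t. basis (h t)) ts) = basis (Node \<omega> (map h ts))"
  by (simp add: graft_eq_tensor)

lemma tensor_update:
  "j < length fs \<Longrightarrow> tensor (fs[j := u]) = linext (\<lambda>b. tensor (fs[j := basis b])) u"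
proof (induction fs arbitrary: j)
  case (Cons f fs)
  show ?case
  proof (cases j)
    case (Suc i)
    then have "tensor ((f # fs)[j := u]) =
      linext (\<lambda>b. linext (\<lambda>bs. basis (b # bs)) (linext (\<lambda>c. tensor (fs[i := basis c])) u)) f"
      using Cons by simp
    also have "\<dots> = linext (\<lambda>b. linext (\<lambda>c. linext (\<lambda>bs. basis (b # bs)) (tensor (fs[i := basis c]))) u) f"
      by (simp add: linext_linext)
    finally show ?thesis using Suc by (simp add: linext_swap[of _ u f])
  qed simp
qed simp

text \<open>Functoriality of the tensor product. The expansions of the first factor and of the
  remaining ones are independent, so \<open>linext_swap\<close> brings the sums into the order of
  the recursion.\<close>

lemma tensor_map_linext: "linext (\<lambda>ts. tensor (map h ts)) (tensor fs) = tensor (map (linext h) fs)"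
proof (induction fs)
  case (Cons f fs)
  have "linext (\<lambda>ts. tensor (map h ts)) (tensor (f # fs)) =
    linext (\<lambda>b. linext (\<lambda>bs. linext (\<lambda>c. linext (\<lambda>cs. basis (c # cs)) (tensor (map h bs))) (h b)) (tensor fs)) f"
    by (simp add: linext_linext)
  also have "\<dots> = linext (\<lambda>b. linext (\<lambda>c. linext (\<lambda>bs. linext (\<lambda>cs. basis (c # cs)) (tensor (map h bs))) (tensor fs)) (h b)) f"
    by (subst linext_swap) simp
  also have "\<dots> = linext (\<lambda>b. linext (\<lambda>c. linext (\<lambda>cs. basis (c # cs)) (tensor (map (linext h) fs))) (h b)) f"
    by (simp only: Cons.IH[symmetric] linext_linext)
  finally show ?case by (simp add: linext_linext)
qed simp

lemma graft_update:
  "j < length fs \<Longrightarrow> graft \<omega> (fs[j := u]) = linext (\<lambda>b. graft \<omega> (fs[j := basis b])) u"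
  by (simp add: graft_eq_tensor tensor_update[of j fs u] linext_linext)

section \<open>Simultaneous substitution of formal sums for leaves\<close>

primrec msubst_tree :: "(nat \<Rightarrow> ('v tree \<Rightarrow>\<^sub>0 'k::field)) \<Rightarrow> 'v tree \<Rightarrow> ('v tree \<Rightarrow>\<^sub>0 'k)" where
  "msubst_tree g (Leaf a) = g a"
| "msubst_tree g (Node \<omega> ts) = graft \<omega> (map (msubst_tree g) ts)"

definition msubst :: "(nat \<Rightarrow> ('v tree \<Rightarrow>\<^sub>0 'k::field)) \<Rightarrow> ('v tree \<Rightarrow>\<^sub>0 'k) \<Rightarrow> ('v tree \<Rightarrow>\<^sub>0 'k)" where
  "msubst g = linext (msubst_tree g)"

lemma msubst_graft: "msubst g (graft \<omega> fs) = graft \<omega> (map (msubst g) fs)"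
proof -
  have "msubst g (graft \<omega> fs) =
      linext (\<lambda>ts. linext (\<lambda>us. basis (Node \<omega> us)) (tensor (map (msubst_tree g) ts))) (tensor fs)"
    by (simp add: graft_eq_tensor msubst_def linext_linext)
  also have "\<dots> = linext (\<lambda>us. basis (Node \<omega> us)) (linext (\<lambda>ts. tensor (map (msubst_tree g) ts)) (tensor fs))"
    by (simp add: linext_linext)
  also have "\<dots> = graft \<omega> (map (msubst g) fs)"
    by (simp add: tensor_map_linext graft_eq_tensor msubst_def[abs_def])
  finally show ?thesis .
qed

lemma msubst_msubst_tree: "msubst g (msubst_tree h t) = msubst_tree (\<lambda>a. msubst g (h a)) t"
  by (induction t) (simp_all add: msubst_graft cong: map_cong)

lemma msubst_msubst: "msubst g (msubst h f) = msubst (\<lambda>a. msubst g (h a)) f"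
proof -
  have "msubst g (msubst h f) = linext (\<lambda>t. msubst g (msubst_tree h t)) f"
    by (simp add: msubst_def linext_linext)
  then show ?thesis
    by (simp only: msubst_msubst_tree) (simp add: msubst_def)
qed

lemma msubst_tree_basis: "msubst_tree (\<lambda>a. basis (h a)) t = basis (subst h t)"
proof (induction t)
  case (Node \<omega> ts)
  then show ?case by (simp add: graft_basis cong: map_cong)
qed simp

lemma msubst_basis: "msubst (\<lambda>a. basis (h a)) f = linext (\<lambda>t. basis (subst h t)) f"
  unfolding msubst_def by (intro linext_cong msubst_tree_basis)

lemma Lin_simps [simp]: "Lin (Leaf a) = {a}" "Lin (Node \<omega> ts) = (\<Union>t\<in>set ts. Lin t)"
  unfolding Lin_def by auto

lemma msubst_tree_cong: "(\<And>a. a \<in> Lin t \<Longrightarrow> g a = h a) \<Longrightarrow> msubst_tree g t = msubst_tree h t"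
proof (induction t)
  case (Node \<omega> ts)
  then have "map (msubst_tree g) ts = map (msubst_tree h) ts" by auto
  then show ?case by (simp only: msubst_tree.simps)
qed simp

lemma msubst_cong:
  "(\<And>a t. t \<in> Poly_Mapping.keys f \<Longrightarrow> a \<in> Lin t \<Longrightarrow> g a = h a) \<Longrightarrow> msubst g f = msubst h f"
  unfolding msubst_def by (intro linext_cong msubst_tree_cong) blast

lemma distinct_concat_map_disjoint:
  "distinct (concat (map f xs)) \<Longrightarrow> i < length xs \<Longrightarrow> j < length xs \<Longrightarrow> i \<noteq> j \<Longrightarrow>
    set (f (xs ! i)) \<inter> set (f (xs ! j)) = {}"
proof (induction xs arbitrary: i j)
  case (Cons x xs)
  have *: "set (f x) \<inter> set (f (xs ! k)) = {}" if "k < length xs" for k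
    using Cons.prems(1) nth_mem[OF that] by (auto simp: disjoint_iff)
  show ?case
  proof (cases "i = 0 \<or> j = 0")
    case True
    then show ?thesis
      using *[of "i - 1"] *[of "j - 1"] Cons.prems by (cases i; cases j) (simp_all add: Int_commute)
  next
    case False
    then show ?thesis
      using Cons.IH[of "i - 1" "j - 1"] Cons.prems by (cases i; cases j) simp_all
  qed
qed simp

text \<open>Distinct leaves put \<open>a\<close> under exactly one child, so linearity in the value
  at \<open>a\<close> is linearity of \<open>graft\<close> in that slot. A repeated leaf would make
  the substitution of higher degree in this value.\<close>

lemma msubst_tree_update:
  assumes "distinct (leaves t)" "a \<in> Lin t"
  shows "msubst_tree (g(a := u)) t = linext (\<lambda>s. msubst_tree (g(a := basis s)) t) u"
  using assms
proof (induction t)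
  case (Node \<omega> ts)
  then obtain j where j: "j < length ts" "a \<in> Lin (ts ! j)"
    by (auto simp: in_set_conv_nth)
  have notin: "a \<notin> Lin (ts ! i)" if "i < length ts" "i \<noteq> j" for i
    using distinct_concat_map_disjoint[of leaves ts i j] Node.prems(1) j that
    by (auto simp: Lin_def)
  have dist: "distinct (leaves (ts ! j))"
    using Node.prems(1) j(1) by (auto simp: distinct_concat_iff)
  \<comment> \<open>Changing the value at \<open>a\<close> changes factor \<open>j\<close>
    only.\<close>
  have upd: "map (msubst_tree (g(a := v))) ts =
      (map (msubst_tree g) ts)[j := msubst_tree (g(a := v)) (ts ! j)]" for v
  proof (rule nth_equalityI)
    fix i assume "i < length (map (msubst_tree (g(a := v))) ts)"
    then show "map (msubst_tree (g(a := v))) ts ! i =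
        (map (msubst_tree g) ts)[j := msubst_tree (g(a := v)) (ts ! j)] ! i"
      using notin by (cases "i = j") (auto intro!: msubst_tree_cong)
  qed simp
  have IH: "msubst_tree (g(a := u)) (ts ! j) = linext (\<lambda>s. msubst_tree (g(a := basis s)) (ts ! j)) u"
    by (rule Node.IH[OF nth_mem[OF j(1)] dist j(2)])
  have "msubst_tree (g(a := u)) (Node \<omega> ts) =
      linext (\<lambda>b. graft \<omega> ((map (msubst_tree g) ts)[j := basis b]))
        (linext (\<lambda>s. msubst_tree (g(a := basis s)) (ts ! j)) u)"
    using j by (simp add: upd IH graft_update[of _ _ _ "linext _ _"])
  also have "\<dots> = linext (\<lambda>s. msubst_tree (g(a := basis s)) (Node \<omega> ts)) u"
    using j by (simp add: linext_linext upd graft_update[of _ _ _ "msubst_tree _ _"])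
  finally show ?case .
qed simp

section \<open>Formal sums of labeled trees and the relations among them\<close>

lemma subst_cong: "(\<And>a. a \<in> Lin t \<Longrightarrow> f a = g a) \<Longrightarrow> subst f t = subst g t"
  by (induction t) auto

lemma subst_subst: "subst f (subst g t) = subst (\<lambda>a. subst f (g a)) t"
  by (induction t) auto

lemma subst_Leaf [simp]: "subst Leaf t = t"
  by (induction t) (auto intro: map_idI)

lemma leaves_subst: "leaves (subst h t) = concat (map (\<lambda>a. leaves (h a)) (leaves t))"
proof (induction t)
  case (Node \<omega> ts)
  then show ?case by (induction ts) simp_all
qed simp

lemma Lin_subst: "Lin (subst h t) = (\<Union>a\<in>Lin t. Lin (h a))"
  by (auto simp: Lin_def leaves_subst)

lemma finite_Lin [simp]: "finite (Lin t)"
  by (simp add: Lin_def)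

lemma decorated_subst:
  "decorated V t \<Longrightarrow> (\<And>a. a \<in> Lin t \<Longrightarrow> decorated V (h a)) \<Longrightarrow> decorated V (subst h t)"
  by (induction t) (auto simp: list_all_iff)

lemma distinct_concat_mapI:
  assumes "distinct xs" "\<And>x. x \<in> set xs \<Longrightarrow> distinct (f x)"
    and "disjoint_family_on (\<lambda>x. set (f x)) (set xs)"
  shows "distinct (concat (map f xs))"
  using assms
proof (induction xs)
  case (Cons x xs)
  then have "distinct (concat (map f xs))"
    by (auto simp: disjoint_family_on_def)
  with Cons.prems show ?case
    by (auto simp: disjoint_family_on_def disjoint_iff)
qed simp

lemma leaves_nonempty: "decorated V t \<Longrightarrow> leaves t \<noteq> []"
  by (induction t) (auto simp: list_all_iff neq_Nil_conv)

lemma labeled_trees_empty [simp]: "labeled_trees V {} = {}"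
  using leaves_nonempty by (fastforce simp: labeled_trees_def Lin_def)

lemma labeled_treesD:
  assumes "t \<in> labeled_trees V X"
  shows "decorated V t" "distinct (leaves t)" "Lin t = X" "0 \<notin> X" "finite X"
  using assms finite_Lin[of t] by (auto simp: labeled_trees_def)

text \<open>Disjointness of the sets \<open>Y a\<close> keeps the leaf labels distinct; trees with
  arbitrary label sets can thus be composed without renumbering.\<close>

lemma labeled_trees_subst:
  assumes t: "t \<in> labeled_trees V X" and h: "\<And>a. a \<in> X \<Longrightarrow> h a \<in> labeled_trees V (Y a)"
    and disj: "disjoint_family_on Y X"
  shows "subst h t \<in> labeled_trees V (\<Union>a\<in>X. Y a)"
proof -
  note t = labeled_treesD[OF t] and h = labeled_treesD[OF h]
  have "distinct (leaves (subst h t))"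
    unfolding leaves_subst
  proof (rule distinct_concat_mapI)
    show "disjoint_family_on (\<lambda>a. set (leaves (h a))) (set (leaves t))"
      using disj h(3) t(3) by (simp add: disjoint_family_on_def Lin_def)
  qed (use t h in \<open>auto simp: Lin_def\<close>)
  moreover have "decorated V (subst h t)"
    using t h by (auto intro: decorated_subst)
  ultimately show ?thesis
    using t h by (auto simp: labeled_trees_def Lin_subst)
qed

definition tree_space :: "'v smodule \<Rightarrow> nat set \<Rightarrow> ('v tree \<Rightarrow>\<^sub>0 'k::field) set" where
  "tree_space V X = {f. Poly_Mapping.keys f \<subseteq> labeled_trees V X}"

lemma lin_closed_tree_space: "lin_closed (tree_space V X)"
  unfolding tree_space_def by (rule lin_closed_span)

lemma basis_in_tree_space [simp]: "basis t \<in> tree_space V X \<longleftrightarrow> t \<in> labeled_trees V X"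
  by (simp add: tree_space_def)

lemma tree_space_zero: "0 \<in> tree_space V X"
  and tree_space_add: "f \<in> tree_space V X \<Longrightarrow> g \<in> tree_space V X \<Longrightarrow> f + g \<in> tree_space V X"
  and tree_space_pscale: "f \<in> tree_space V X \<Longrightarrow> pscale c f \<in> tree_space V X"
  using lin_closed_tree_space[of V X] unfolding lin_closed_def by blast+

lemma tree_space_diff: "f \<in> tree_space V X \<Longrightarrow> g \<in> tree_space V X \<Longrightarrow> f - g \<in> tree_space V X"
  by (rule lin_closed_diff[OF lin_closed_tree_space])

lemma tree_space_linext:
  "(\<And>b. b \<in> Poly_Mapping.keys f \<Longrightarrow> g b \<in> tree_space V X) \<Longrightarrow> linext g f \<in> tree_space V X"
  by (rule lin_closed_linext[OF lin_closed_tree_space])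

lemma tree_spaceD: "f \<in> tree_space V X \<Longrightarrow> t \<in> Poly_Mapping.keys f \<Longrightarrow> t \<in> labeled_trees V X"
  by (auto simp: tree_space_def)

text \<open>Trees have finitely many leaves. This disposes of infinite label sets, so that
  finiteness need not be assumed wherever a label set occurs.\<close>

lemma tree_space_infinite: "f \<in> tree_space V X \<Longrightarrow> infinite X \<Longrightarrow> f = 0"
  unfolding tree_space_def using labeled_treesD(5) by (metis (mono_tags, lifting) equals0I keys_eq_empty mem_Collect_eq subset_iff)

text \<open>Expansion of a multilinear map in one coordinate of \<open>D\<close> after the other.
  Claims about families of formal sums are thereby reduced to families of single trees.\<close>

lemma multilinear_in:
  assumes "finite D" and S: "lin_closed S"
    and "\<And>g a u. a \<in> D \<Longrightarrow> \<Psi> (g(a := u)) = linext (\<lambda>s. \<Psi> (g(a := basis s))) u"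
    and "\<And>h. (\<And>a. a \<in> D \<Longrightarrow> h a \<in> T a) \<Longrightarrow> \<Psi> (\<lambda>a. if a \<in> D then basis (h a) else g a) \<in> S"
    and "\<And>a. a \<in> D \<Longrightarrow> Poly_Mapping.keys (g a) \<subseteq> T a"
  shows "\<Psi> g \<in> S"
  using assms(1,3-)
proof (induction D arbitrary: g)
  case (insert a D)
  have "\<Psi> (g(a := basis s)) \<in> S" if s: "s \<in> Poly_Mapping.keys (g a)" for s
  proof (rule insert.IH)
    fix h assume h: "\<And>b. b \<in> D \<Longrightarrow> h b \<in> T b"
    \<comment> \<open>Once the coordinate at \<open>a\<close> is fixed to a term \<open>s\<close> of
      \<open>g a\<close>, a choice of terms on \<open>D\<close> is a choice on
      \<open>insert a D\<close>.\<close>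
    have "(\<lambda>b. if b \<in> D then basis (h b) else (g(a := basis s)) b) =
      (\<lambda>b. if b \<in> insert a D then basis ((h(a := s)) b) else g b)"
      using insert.hyps by auto
    moreover have "(h(a := s)) b \<in> T b" if "b \<in> insert a D" for b
      using that h s insert.prems(3)[of a] by auto
    ultimately show "\<Psi> (\<lambda>b. if b \<in> D then basis (h b) else (g(a := basis s)) b) \<in> S"
      using insert.prems(2)[of "h(a := s)"] by simp
  next
    fix b assume "b \<in> D"
    then show "Poly_Mapping.keys ((g(a := basis s)) b) \<subseteq> T b"
      using insert.hyps(2) insert.prems(3)[of b] by auto
  qed (rule insert.prems(1), simp)
  moreover have "\<Psi> g = linext (\<lambda>s. \<Psi> (g(a := basis s))) (g a)"
    using insert.prems(1)[of a g "g a"] unfolding fun_upd_triv by blast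
  ultimately show ?case
    using lin_closed_linext[OF S, of "g a" "\<lambda>s. \<Psi> (g(a := basis s))"] by metis
qed simp

lemma msubst_linext: "msubst g (linext h f) = linext (\<lambda>b. msubst g (h b)) f"
  by (simp add: msubst_def linext_linext)

lemma msubst_single [simp]: "msubst g (basis t) = msubst_tree g t"
  by (simp add: msubst_def)

lemma msubst_tree_update':
  "t \<in> labeled_trees V X \<Longrightarrow> a \<in> X \<Longrightarrow>
    msubst_tree (g(a := u)) t = linext (\<lambda>s. msubst_tree (g(a := basis s)) t) u"
  by (rule msubst_tree_update) (auto dest: labeled_treesD)

lemma msubst_update:
  assumes "f \<in> tree_space V X" "a \<in> X"
  shows "msubst (g(a := u)) f = linext (\<lambda>s. msubst (g(a := basis s)) f) u"
proof -
  have "msubst (g(a := u)) f = linext (\<lambda>t. linext (\<lambda>s. msubst_tree (g(a := basis s)) t) u) f"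
    unfolding msubst_def
    by (intro linext_cong msubst_tree_update'[OF tree_spaceD[OF assms(1)] assms(2)])
  then show ?thesis
    by (simp add: linext_swap[of _ u f] msubst_def)
qed

lemma msubst_update_diff:
  assumes "f \<in> tree_space V X" "a \<in> X"
  shows "msubst (g(a := u)) f - msubst (g(a := v)) f = msubst (g(a := u - v)) f"
  using msubst_update[OF assms, of g u] msubst_update[OF assms, of g v]
    msubst_update[OF assms, of g "u - v"]
  by (simp only: linext_diff)

lemma msubst_in_tree_space:
  assumes f: "f \<in> tree_space V X" and g: "\<And>a. a \<in> X \<Longrightarrow> g a \<in> tree_space V (Y a)"
    and disj: "disjoint_family_on Y X"
  shows "msubst g f \<in> tree_space V (\<Union>a\<in>X. Y a)"
proof (cases "finite X")
  case True
  show ?thesis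
  proof (rule multilinear_in[OF True lin_closed_tree_space msubst_update[OF f],
        where T = "\<lambda>a. labeled_trees V (Y a)"])
    fix h assume h: "\<And>a. a \<in> X \<Longrightarrow> h a \<in> labeled_trees V (Y a)"
    have "msubst (\<lambda>a. if a \<in> X then basis (h a) else g a) f = msubst (\<lambda>a. basis (h a)) f"
      using tree_spaceD[OF f] by (intro msubst_cong) (auto dest: labeled_treesD)
    then show "msubst (\<lambda>a. if a \<in> X then basis (h a) else g a) f \<in> tree_space V (\<Union>a\<in>X. Y a)"
      using labeled_trees_subst[OF tree_spaceD[OF f] h disj]
      by (auto simp: msubst_basis intro!: tree_space_linext)
  qed (use g in \<open>auto simp: tree_space_def\<close>)
next
  case False
  then show ?thesis
    using tree_space_infinite[OF f] by (simp add: msubst_def tree_space_def)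
qed

lemma labeled_trees_Leaf: "Leaf a \<in> labeled_trees V {a} \<longleftrightarrow> a \<noteq> 0"
  by (auto simp: labeled_trees_def)

lemma labeled_trees_relabel:
  assumes "t \<in> labeled_trees V X" "inj_on \<rho> X" "0 \<notin> \<rho> ` X"
  shows "relabel \<rho> t \<in> labeled_trees V (\<rho> ` X)"
proof -
  have "relabel \<rho> t \<in> labeled_trees V (\<Union>a\<in>X. {\<rho> a})"
    unfolding relabel_def
    by (rule labeled_trees_subst[OF assms(1)])
      (use assms in \<open>auto simp: labeled_trees_Leaf image_iff disjoint_family_on_def inj_on_def\<close>)
  then show ?thesis by (simp add: UNION_singleton_eq_range)
qed

lemma labeled_trees_graft_leaf:
  assumes "t \<in> labeled_trees V X" "s \<in> labeled_trees V Y" "a \<in> X" "Y \<inter> (X - {a}) = {}"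
  shows "subst (Leaf(a := s)) t \<in> labeled_trees V (X - {a} \<union> Y)"
proof -
  have "subst (Leaf(a := s)) t \<in> labeled_trees V (\<Union>b\<in>X. ((\<lambda>b. {b})(a := Y)) b)"
    by (rule labeled_trees_subst[OF assms(1)])
      (use assms in \<open>auto simp: labeled_trees_Leaf disjoint_family_on_def dest: labeled_treesD\<close>)
  moreover have "(\<Union>b\<in>X. ((\<lambda>b. {b})(a := Y)) b) = X - {a} \<union> Y"
    using assms(3) by auto
  ultimately show ?thesis by simp
qed

text \<open>
  The formal sums of planar trees with leaf set \<open>X\<close> that vanish in \<open>\<T>(V)/(R)\<close>.  Arbitrary leaf sets
  make it possible to compose trees without renumbering.
\<close>

inductive null :: "'v smodule \<Rightarrow> ('v tree \<Rightarrow>\<^sub>0 'k::field) set \<Rightarrow> nat set \<Rightarrow> ('v tree \<Rightarrow>\<^sub>0 'k) \<Rightarrow> bool"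
  for V :: "'v smodule" and R :: "('v tree \<Rightarrow>\<^sub>0 'k::field) set" where
  zero: "null V R X 0"
| add: "null V R X f \<Longrightarrow> null V R X g \<Longrightarrow> null V R X (f + g)"
| scale: "null V R X f \<Longrightarrow> null V R X (pscale c f)"
| iso: "t \<in> labeled_trees V X \<Longrightarrow> u \<in> labeled_trees V X \<Longrightarrow> tree_iso V t u
    \<Longrightarrow> null V R X (basis t - basis u)"
| rel: "r \<in> R \<Longrightarrow> r \<in> tree_space V X \<Longrightarrow> null V R X r"
| relabel: "null V R X f \<Longrightarrow> inj_on \<rho> X \<Longrightarrow> 0 \<notin> \<rho> ` X
    \<Longrightarrow> null V R (\<rho> ` X) (linext (\<lambda>t. basis (relabel \<rho> t)) f)"
| comp_left: "null V R X f \<Longrightarrow> s \<in> labeled_trees V Y \<Longrightarrow> a \<in> X \<Longrightarrow> Y \<inter> (X - {a}) = {}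
    \<Longrightarrow> null V R (X - {a} \<union> Y) (linext (\<lambda>t. basis (subst (Leaf(a := s)) t)) f)"
| comp_right: "t \<in> labeled_trees V X \<Longrightarrow> null V R Y f \<Longrightarrow> a \<in> X \<Longrightarrow> Y \<inter> (X - {a}) = {}
    \<Longrightarrow> null V R (X - {a} \<union> Y) (linext (\<lambda>s. basis (subst (Leaf(a := s)) t)) f)"

section \<open>Closure of the congruence under substitution\<close>

lemma null_in_tree_space: "null V R X f \<Longrightarrow> f \<in> tree_space V X"
proof (induction rule: null.induct)
  case (iso t X u)
  then show ?case by (auto intro: tree_space_diff)
next
  case (relabel X f \<rho>)
  then show ?case by (auto intro!: tree_space_linext labeled_trees_relabel dest: tree_spaceD)
next
  case (comp_left X f s Y a)
  then show ?case by (auto intro!: tree_space_linext labeled_trees_graft_leaf dest: tree_spaceD)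
next
  case (comp_right t X Y f a)
  then show ?case by (auto intro!: tree_space_linext labeled_trees_graft_leaf dest: tree_spaceD)
next
  case (rel r X)
  then show ?case by simp
qed (simp_all add: tree_space_zero tree_space_add tree_space_pscale)

lemma lin_closed_null: "lin_closed {f. null V R X f}"
  by (simp add: lin_closed_def null.zero null.add null.scale)

lemma null_linext: "(\<And>b. b \<in> Poly_Mapping.keys f \<Longrightarrow> null V R X (g b)) \<Longrightarrow> null V R X (linext g f)"
  using lin_closed_linext[OF lin_closed_null, of f g] by auto

lemma null_sum: "(\<And>a. a \<in> A \<Longrightarrow> null V R X (f a)) \<Longrightarrow> null V R X (\<Sum>a\<in>A. f a)"
  using lin_closed_sum[OF lin_closed_null, of A f] by auto

text \<open>The rule \<open>comp_left\<close> grafts one tree at a time. The labels of the inserted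
  trees avoid \<open>X\<close>, so a later graft neither clashes with nor alters what has been
  inserted before.\<close>

lemma null_subst_disjoint:
  assumes f: "null V R X f" and D: "finite D" "D \<subseteq> X"
    and h: "\<And>a. a \<in> D \<Longrightarrow> h a \<in> labeled_trees V (Y a)"
    and disj: "disjoint_family_on Y D" and YX: "\<And>a. a \<in> D \<Longrightarrow> Y a \<inter> X = {}"
  shows "null V R (X - D \<union> (\<Union>a\<in>D. Y a))
    (linext (\<lambda>t. basis (subst (\<lambda>a. if a \<in> D then h a else Leaf a) t)) f)"
  using D h disj YX
proof (induction D rule: finite_induct)
  case empty
  then show ?case using f by simp
next
  case (insert a D)
  let ?Z = "X - D \<union> (\<Union>a\<in>D. Y a)"
  let ?h = "\<lambda>a. if a \<in> D then h a else Leaf a"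
  have IH: "null V R ?Z (linext (\<lambda>t. basis (subst ?h t)) f)"
    using insert by (auto simp: disjoint_family_on_def)
  have a: "a \<in> X" "a \<notin> D" "\<And>b. b \<in> D \<Longrightarrow> a \<notin> Y b" "\<And>b. b \<in> D \<Longrightarrow> Y a \<inter> Y b = {}"
    "Y a \<inter> X = {}" "h a \<in> labeled_trees V (Y a)"
    using insert by (auto simp: disjoint_family_on_def)
  have "null V R (?Z - {a} \<union> Y a)
      (linext (\<lambda>t. basis (subst (Leaf(a := h a)) t)) (linext (\<lambda>t. basis (subst ?h t)) f))"
    by (rule null.comp_left[OF IH a(6)]) (use a in auto)
  moreover have "?Z - {a} \<union> Y a = X - insert a D \<union> (\<Union>a\<in>insert a D. Y a)"
    using a by auto
  moreover have "subst (Leaf(a := h a)) (subst ?h t) =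
      subst (\<lambda>b. if b \<in> insert a D then h b else Leaf b) t" for t
    unfolding subst_subst
  proof (rule subst_cong)
    fix b
    show "subst (Leaf(a := h a)) (if b \<in> D then h b else Leaf b) =
        (if b \<in> insert a D then h b else Leaf b)"
    proof (cases "b \<in> D")
      case True
      then have "a \<notin> Lin (h b)"
        using a(3) insert.prems(2)[of b] by (auto dest: labeled_treesD)
      then have "subst (Leaf(a := h a)) (h b) = subst Leaf (h b)"
        by (intro subst_cong) auto
      then show ?thesis using True by simp
    qed (use a in auto)
  qed
  ultimately show ?case by (simp add: linext_linext)
qed

text \<open>Here \<open>Y a\<close> may meet \<open>X\<close>. All leaves are first shifted beyond
  every label in sight, after which the grafts can be carried out one at a time.\<close>

lemma null_subst:
  assumes f: "null V R X f" and h: "\<And>a. a \<in> X \<Longrightarrow> h a \<in> labeled_trees V (Y a)"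
    and disj: "disjoint_family_on Y X"
  shows "null V R (\<Union>a\<in>X. Y a) (linext (\<lambda>t. basis (subst h t)) f)"
proof (cases "finite X")
  case True
  have "finite (\<Union>a\<in>X. Y a)"
    using True h by (auto dest: labeled_treesD)
  then obtain N where N: "\<And>x. x \<in> X \<union> (\<Union>a\<in>X. Y a) \<Longrightarrow> x < N"
    using True finite_nat_set_iff_bounded[of "X \<union> (\<Union>a\<in>X. Y a)"] by blast
  show ?thesis
  proof (cases "X = {}")
    case True
    then have "f = 0"
      using null_in_tree_space[OF f] by (simp add: tree_space_def)
    then show ?thesis by (simp add: null.zero)
  next
    case False
    then have N0: "N > 0" using N by fastforce
    let ?\<rho> = "\<lambda>a. a + N" and ?h = "\<lambda>a. h (a - N)" and ?Y = "\<lambda>a. Y (a - N)"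
    have 1: "null V R (?\<rho> ` X) (linext (\<lambda>t. basis (relabel ?\<rho> t)) f)"
      by (rule null.relabel[OF f]) (use N0 in auto)
    have "null V R (?\<rho> ` X - ?\<rho> ` X \<union> (\<Union>a\<in>?\<rho> ` X. ?Y a))
      (linext (\<lambda>t. basis (subst (\<lambda>a. if a \<in> ?\<rho> ` X then ?h a else Leaf a) t))
        (linext (\<lambda>t. basis (relabel ?\<rho> t)) f))"
    proof (rule null_subst_disjoint[OF 1])
      show "disjoint_family_on ?Y (?\<rho> ` X)"
        using disj by (auto simp: disjoint_family_on_def)
      show "?Y a \<inter> ?\<rho> ` X = {}" if "a \<in> ?\<rho> ` X" for a
      proof -
        have "x < N" if "x \<in> ?Y a" for x
          using that \<open>a \<in> ?\<rho> ` X\<close> by (intro N) auto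
        then show ?thesis by fastforce
      qed
    qed (use \<open>finite X\<close> h in auto)
    moreover have "subst (\<lambda>a. if a \<in> ?\<rho> ` X then ?h a else Leaf a) (relabel ?\<rho> t) = subst h t"
      if "t \<in> Poly_Mapping.keys f" for t
      unfolding relabel_def subst_subst
      using tree_spaceD[OF null_in_tree_space[OF f] that]
      by (intro subst_cong) (auto dest: labeled_treesD)
    ultimately show ?thesis
      by (simp add: linext_linext cong: linext_cong)
  qed
next
  case False
  then show ?thesis
    using tree_space_infinite[OF null_in_tree_space[OF f]] by (simp add: null.zero)
qed

lemma null_msubst_left:
  assumes f: "null V R X f" and g: "\<And>a. a \<in> X \<Longrightarrow> g a \<in> tree_space V (Y a)"
    and disj: "disjoint_family_on Y X"
  shows "null V R (\<Union>a\<in>X. Y a) (msubst g f)"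
proof (cases "finite X")
  case True
  note f' = null_in_tree_space[OF f]
  have "msubst g f \<in> {f. null V R (\<Union>a\<in>X. Y a) f}"
  proof (rule multilinear_in[OF True lin_closed_null msubst_update[OF f'],
        where T = "\<lambda>a. labeled_trees V (Y a)"])
    fix h assume h: "\<And>a. a \<in> X \<Longrightarrow> h a \<in> labeled_trees V (Y a)"
    have "msubst (\<lambda>a. if a \<in> X then basis (h a) else g a) f = msubst (\<lambda>a. basis (h a)) f"
      using tree_spaceD[OF f'] by (intro msubst_cong) (auto dest: labeled_treesD)
    then show "msubst (\<lambda>a. if a \<in> X then basis (h a) else g a) f \<in> {f. null V R (\<Union>a\<in>X. Y a) f}"
      using null_subst[OF f h disj] by (simp add: msubst_basis)
  qed (use g in \<open>auto simp: tree_space_def\<close>)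
  then show ?thesis by simp
next
  case False
  then show ?thesis
    using tree_space_infinite[OF null_in_tree_space[OF f]] by (simp add: null.zero msubst_def)
qed

text \<open>The rule \<open>comp_right\<close> inserts a null sum at one leaf of one tree. That tree
  is \<open>t\<close> with all other substitutions done and a fresh leaf in place of
  \<open>b\<close>.\<close>

lemma null_subst_tree_right:
  assumes t: "t \<in> labeled_trees V X" and b: "b \<in> X" "null V R (Y b) u"
    and h: "\<And>a. a \<in> X - {b} \<Longrightarrow> h a \<in> labeled_trees V (Y a)"
    and disj: "disjoint_family_on Y X" and fin: "finite (Y b)"
  shows "null V R (\<Union>a\<in>X. Y a) (linext (\<lambda>s. basis (subst (h(b := s)) t)) u)"
proof -
  have "finite (\<Union>a\<in>X. Y a)"
    using labeled_treesD(5)[OF t] labeled_treesD(5)[OF h] fin by (metis Diff_iff finite_UN singletonD)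
  then obtain N where N: "\<And>x. x \<in> (\<Union>a\<in>X. Y a) \<Longrightarrow> x < N"
    using finite_nat_set_iff_bounded[of "\<Union>a\<in>X. Y a"] by blast
  \<comment> \<open>Above every label of the inserted trees, hence fresh; it marks the place where
    \<open>u\<close> goes afterwards.\<close>
  let ?c = "Suc N" and ?Y = "Y(b := {Suc N})"
  have cY: "?c \<notin> Y a" if "a \<in> X" for a using N[of ?c] that by auto
  have 1: "subst (h(b := Leaf ?c)) t \<in> labeled_trees V (\<Union>a\<in>X. ?Y a)"
  proof (rule labeled_trees_subst[OF t])
    show "disjoint_family_on ?Y X"
      using disj cY by (auto simp: disjoint_family_on_def)
  qed (use h in \<open>auto simp: labeled_trees_Leaf\<close>)
  have "null V R ((\<Union>a\<in>X. ?Y a) - {?c} \<union> Y b)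
     (linext (\<lambda>s. basis (subst (Leaf(?c := s)) (subst (h(b := Leaf ?c)) t))) u)"
    by (rule null.comp_right[OF 1 b(2)])
      (use b(1) disj in \<open>auto simp: disjoint_family_on_def split: if_splits\<close>)
  moreover have "(\<Union>a\<in>X. ?Y a) - {?c} \<union> Y b = (\<Union>a\<in>X. Y a)"
    using b(1) cY by (auto split: if_splits)
  moreover have "subst (Leaf(?c := s)) (subst (h(b := Leaf ?c)) t) = subst (h(b := s)) t" for s
    unfolding subst_subst
  proof (rule subst_cong)
    fix a assume a: "a \<in> Lin t"
    show "subst (Leaf(?c := s)) ((h(b := Leaf ?c)) a) = (h(b := s)) a"
    proof (cases "a = b")
      case False
      then have "a \<in> X" "?c \<notin> Lin (h a)"
        using a h[of a] cY[of a] labeled_treesD(3)[OF t] by (auto dest: labeled_treesD)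
      then have "subst (Leaf(?c := s)) (h a) = subst Leaf (h a)"
        by (intro subst_cong) auto
      then show ?thesis using False by simp
    qed simp
  qed
  ultimately show ?thesis by simp
qed

lemma null_msubst_right:
  assumes f: "f \<in> tree_space V X" and g: "\<And>a. a \<in> X \<Longrightarrow> g a \<in> tree_space V (Y a)"
    and disj: "disjoint_family_on Y X" and b: "b \<in> X" "null V R (Y b) (g b)"
  shows "null V R (\<Union>a\<in>X. Y a) (msubst g f)"
proof (cases "finite (Y b)")
  case True
  show ?thesis
    unfolding msubst_def
  proof (rule null_linext)
    fix t assume "t \<in> Poly_Mapping.keys f"
    then have t: "t \<in> labeled_trees V X" using tree_spaceD[OF f] by blast
    \<comment> \<open>The expansion concerns the leaves other than \<open>b\<close>; the value at
      \<open>b\<close> stays the whole null sum, since its single terms need not be null.\<close>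
    have "msubst_tree (g(b := g b)) t \<in> {f. null V R (\<Union>a\<in>X. Y a) f}"
    proof (rule multilinear_in[where D = "X - {b}" and T = "\<lambda>a. labeled_trees V (Y a)" and g = g
          and \<Psi> = "\<lambda>g'. msubst_tree (g'(b := g b)) t", OF _ lin_closed_null])
      fix g' a u assume "a \<in> X - {b}"
      then show "msubst_tree (g'(a := u, b := g b)) t = linext (\<lambda>s. msubst_tree (g'(a := basis s, b := g b)) t) u"
        using msubst_tree_update'[OF t, of a "g'(b := g b)" u] by (simp add: fun_upd_twist)
    next
      fix h assume h: "\<And>a. a \<in> X - {b} \<Longrightarrow> h a \<in> labeled_trees V (Y a)"
      let ?g = "\<lambda>a. if a \<in> X - {b} then basis (h a) else g a"
      have "msubst_tree (?g(b := g b)) t = msubst_tree ((\<lambda>a. basis (h a))(b := g b)) t"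
        by (rule msubst_tree_cong) (use labeled_treesD[OF t] in auto)
      also have "\<dots> = linext (\<lambda>s. msubst_tree ((\<lambda>a. basis (h a))(b := basis s)) t) (g b)"
        by (rule msubst_tree_update'[OF t b(1)])
      also have "\<dots> = linext (\<lambda>s. basis (subst (h(b := s)) t)) (g b)"
      proof (rule linext_cong)
        fix s
        show "msubst_tree ((\<lambda>a. basis (h a))(b := basis s)) t = basis (subst (h(b := s)) t)"
          unfolding msubst_tree_basis[symmetric] by (rule msubst_tree_cong) simp
      qed
      finally show "msubst_tree (?g(b := g b)) t \<in> {f. null V R (\<Union>a\<in>X. Y a) f}"
        using null_subst_tree_right[OF t b h disj True] by simp
    qed (use g labeled_treesD[OF t] in \<open>auto simp: tree_space_def\<close>)
    then show "null V R (\<Union>a\<in>X. Y a) (msubst_tree g t)" by simp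
  qed
next
  case False
  then have "g b = 0" using tree_space_infinite g b(1) by blast
  then have "msubst g f = 0"
    using msubst_update[OF f b(1), of g "g b"] unfolding fun_upd_triv by simp
  then show ?thesis by (simp add: null.zero)
qed

text \<open>Telescoping: \<open>g\<close> is replaced by \<open>g'\<close> at one leaf at a time,
  and each difference is the substitution of a null sum at that leaf.\<close>

lemma null_msubst_cong:
  assumes f: "f \<in> tree_space V X" and g: "\<And>a. a \<in> X \<Longrightarrow> g a \<in> tree_space V (Y a)"
    and g': "\<And>a. a \<in> X \<Longrightarrow> g' a \<in> tree_space V (Y a)"
    and disj: "disjoint_family_on Y X" and null: "\<And>a. a \<in> X \<Longrightarrow> null V R (Y a) (g a - g' a)"
  shows "null V R (\<Union>a\<in>X. Y a) (msubst g f - msubst g' f)"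
proof (cases "finite X")
  case True
  have "null V R (\<Union>a\<in>X. Y a) (msubst g f - msubst (\<lambda>a. if a \<in> D then g' a else g a) f)"
    if "finite D" "D \<subseteq> X" for D
    using that
  proof (induction D rule: finite_induct)
    case empty
    then show ?case by (simp add: null.zero)
  next
    case (insert b D)
    let ?h = "\<lambda>a. if a \<in> D then g' a else g a"
    have b: "b \<in> X" using insert by auto
    have h': "(\<lambda>a. if a \<in> insert b D then g' a else g a) = ?h(b := g' b)" by auto
    have h: "?h = ?h(b := g b)" using insert by auto
    have "msubst ?h f - msubst (?h(b := g' b)) f = msubst (?h(b := g b - g' b)) f"
      using msubst_update_diff[OF f b, of ?h "g b" "g' b"] unfolding h[symmetric] .
    moreover have "null V R (\<Union>a\<in>X. Y a) (msubst (?h(b := g b - g' b)) f)"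
      by (rule null_msubst_right[OF f _ disj b]) (use g g' null b in \<open>auto intro: tree_space_diff\<close>)
    ultimately have "null V R (\<Union>a\<in>X. Y a) (msubst g f - msubst ?h f +
        (msubst ?h f - msubst (?h(b := g' b)) f))"
      using insert by (auto intro!: null.add)
    then show ?case unfolding h' by simp
  qed
  from this[of X] have "null V R (\<Union>a\<in>X. Y a) (msubst g f - msubst (\<lambda>a. if a \<in> X then g' a else g a) f)"
    using True by simp
  moreover have "msubst (\<lambda>a. if a \<in> X then g' a else g a) f = msubst g' f"
    using tree_spaceD[OF f] by (intro msubst_cong) (auto dest: labeled_treesD)
  ultimately show ?thesis by simp
next
  case False
  then show ?thesis
    using tree_space_infinite[OF f] by (simp add: null.zero msubst_def)
qed

section \<open>Extending maps from generators to trees\<close>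

lemma map_nth_upt: "map (\<lambda>i. ts ! (i - 1)) [1..<Suc (length ts)] = ts"
  by (rule nth_equalityI) (simp_all del: upt_Suc)

lemma mset_map_permuted:
  assumes "\<sigma> permutes {1..length ts}"
  shows "mset (map (\<lambda>i. ts ! (\<sigma> i - 1)) [1..<Suc (length ts)]) = mset ts"
proof -
  let ?n = "length ts"
  have upt: "mset [1..<Suc ?n] = mset_set {1..?n}"
    by (metis atLeastLessThanSuc_atLeastAtMost mset_upt)
  have "mset (map (\<lambda>i. ts ! (\<sigma> i - 1)) [1..<Suc ?n]) =
      image_mset (\<lambda>i. ts ! (i - 1)) (image_mset \<sigma> (mset_set {1..?n}))"
    by (simp only: mset_map upt multiset.map_comp comp_def)
  also have "image_mset \<sigma> (mset_set {1..?n}) = mset_set {1..?n}"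
    using permutes_inj_on[OF assms] permutes_image[OF assms] by (simp add: image_mset_mset_set)
  also have "image_mset (\<lambda>i. ts ! (i - 1)) (mset_set {1..?n}) =
      mset (map (\<lambda>i. ts ! (i - 1)) [1..<Suc ?n])"
    by (simp only: mset_map upt)
  finally show ?thesis by (simp only: map_nth_upt)
qed

lemma mset_leaves_Node: "mset (leaves (Node \<omega> ts)) = sum_list (map (\<lambda>t. mset (leaves t)) ts)"
  by (simp add: mset_concat comp_def)

text \<open>Reordering inputs permutes the list of leaves, so only its multiset survives.
  Decorations stay admissible because the generators are closed under the action.\<close>

lemma tree_iso_invariants:
  assumes "is_smodule V" "tree_iso V t u"
  shows "decorated V t = decorated V u \<and> mset (leaves t) = mset (leaves u)"
  using assms(2)
proof (induction rule: tree_iso.induct)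
  case (cong ts us \<omega>)
  then have "length ts = length us" "\<And>i. i < length us \<Longrightarrow> decorated V (ts ! i) = decorated V (us ! i)"
    "map (\<lambda>t. mset (leaves t)) ts = map (\<lambda>t. mset (leaves t)) us"
    by (auto simp: list_all2_conv_all_nth intro!: nth_equalityI)
  then show ?case
    by (auto simp: mset_leaves_Node list_all_length simp del: leaves.simps)
next
  case (reorder n ts \<omega> \<sigma>)
  let ?us = "map (\<lambda>i. ts ! (\<sigma> i - 1)) [1..<Suc n]"
  have m: "mset ?us = mset ts"
    using mset_map_permuted reorder by blast
  have "gact V n \<sigma> \<omega> \<in> gens V n"
    using assms(1) reorder unfolding is_smodule_def by blast
  moreover have "sum_list (map (\<lambda>t. mset (leaves t)) ?us) = sum_list (map (\<lambda>t. mset (leaves t)) ts)"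
  proof -
    have "sum_list (map (\<lambda>t. mset (leaves t)) xs) = \<Sum>\<^sub># (image_mset (\<lambda>t. mset (leaves t)) (mset xs))"
      for xs :: "'a tree list"
      by (simp only: sum_mset_sum_list[symmetric] mset_map)
    then show ?thesis by (simp only: m)
  qed
  moreover have "set ?us = set ts" "length ?us = length ts" "?us = [] \<longleftrightarrow> ts = []"
    using mset_eq_setD[OF m] mset_eq_length[OF m] by (simp_all only: set_empty[symmetric])
  ultimately show ?case
    using reorder.hyps
    by (simp only: mset_leaves_Node decorated.simps list_all_iff set_map ball_simps)
qed auto

lemma labeled_trees_iso:
  assumes "is_smodule V" "tree_iso V t u"
  shows "t \<in> labeled_trees V X \<longleftrightarrow> u \<in> labeled_trees V X"
  using tree_iso_invariants[OF assms] mset_eq_setD[of "leaves t" "leaves u"]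
    mset_eq_imp_distinct_iff[of "leaves t" "leaves u"]
  by (auto simp: labeled_trees_def Lin_def)

lemma labeled_trees_NodeD:
  assumes "Node \<omega> ts \<in> labeled_trees V X"
  shows "\<omega> \<in> gens V (length ts)"
    and "\<And>j. j < length ts \<Longrightarrow> ts ! j \<in> labeled_trees V (Lin (ts ! j))"
    and "disjoint_family_on (\<lambda>j. Lin (ts ! (j - 1))) {1..length ts}"
    and "(\<Union>j\<in>{1..length ts}. Lin (ts ! (j - 1))) = X"
proof -
  note t = labeled_treesD[OF assms]
  show "\<omega> \<in> gens V (length ts)" using t by simp
  show X: "(\<Union>j\<in>{1..length ts}. Lin (ts ! (j - 1))) = X"
  proof -
    have "ts = map (\<lambda>i. ts ! (i - 1)) [1..<Suc (length ts)]" by (simp only: map_nth_upt)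
    then have "set ts = (\<lambda>i. ts ! (i - 1)) ` {1..length ts}"
      by (metis atLeastLessThanSuc_atLeastAtMost set_map set_upt)
    then show ?thesis using t(3) by auto
  qed
  show "ts ! j \<in> labeled_trees V (Lin (ts ! j))" if j: "j < length ts" for j
  proof -
    have "0 \<notin> Lin (ts ! j)" using t(3,4) nth_mem[OF j] by auto
    then show ?thesis
      using t(1,2) j by (auto simp: labeled_trees_def list_all_length distinct_concat_iff)
  qed
  show "disjoint_family_on (\<lambda>j. Lin (ts ! (j - 1))) {1..length ts}"
    unfolding disjoint_family_on_def
  proof (intro ballI impI)
    fix i j assume "i \<in> {1..length ts}" "j \<in> {1..length ts}" "i \<noteq> j"
    then have "i - 1 < length ts" "j - 1 < length ts" "i - 1 \<noteq> j - 1" by auto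
    then show "Lin (ts ! (i - 1)) \<inter> Lin (ts ! (j - 1)) = {}"
      using distinct_concat_map_disjoint[of leaves ts "i - 1" "j - 1"] t(2)
      by (simp add: Lin_def)
  qed
qed

text \<open>The leaf \<open>j\<close> of \<open>L n \<omega>\<close> stands for input \<open>j\<close> of \<open>\<omega>\<close>; list positions start at \<open>0\<close>.\<close>

primrec extend_tree :: "(nat \<Rightarrow> 'v \<Rightarrow> ('w tree \<Rightarrow>\<^sub>0 'k::field)) \<Rightarrow> 'v tree \<Rightarrow> ('w tree \<Rightarrow>\<^sub>0 'k)" where
  "extend_tree L (Leaf a) = basis (Leaf a)"
| "extend_tree L (Node \<omega> ts) = msubst (\<lambda>j. map (extend_tree L) ts ! (j - 1)) (L (length ts) \<omega>)"

definition extend :: "(nat \<Rightarrow> 'v \<Rightarrow> ('w tree \<Rightarrow>\<^sub>0 'k::field)) \<Rightarrow> ('v tree \<Rightarrow>\<^sub>0 'k) \<Rightarrow> ('w tree \<Rightarrow>\<^sub>0 'k)" where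
  "extend L = linext (extend_tree L)"

text \<open>Only arities and leaf sets are prescribed. Equivariance is left out because it will hold
  only modulo relations; it enters \<open>null_extend\<close> as a hypothesis up to
  \<open>null\<close>.\<close>

definition gen_map :: "'v smodule \<Rightarrow> 'w smodule \<Rightarrow> (nat \<Rightarrow> 'v \<Rightarrow> ('w tree \<Rightarrow>\<^sub>0 'k::field)) \<Rightarrow> bool" where
  "gen_map V W L \<longleftrightarrow> (\<forall>n. \<forall>\<omega>\<in>gens V n. L n \<omega> \<in> tree_space W {1..n})"

lemma gen_mapD: "gen_map V W L \<Longrightarrow> \<omega> \<in> gens V n \<Longrightarrow> L n \<omega> \<in> tree_space W {1..n}"
  by (simp add: gen_map_def)

lemma extend_basis [simp]: "extend L (basis t) = extend_tree L t"
  by (simp add: extend_def)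

lemma extend_linext: "extend L (linext g f) = linext (\<lambda>b. extend L (g b)) f"
  by (simp add: extend_def linext_linext)

lemma extend_tree_in_tree_space:
  assumes L: "gen_map V W L"
  shows "t \<in> labeled_trees V X \<Longrightarrow> extend_tree L t \<in> tree_space W X"
proof (induction t arbitrary: X)
  case (Leaf a)
  then show ?case by (auto simp: labeled_trees_def)
next
  case (Node \<omega> ts)
  note ts = labeled_trees_NodeD[OF Node.prems]
  have "extend_tree L (Node \<omega> ts) \<in> tree_space W (\<Union>j\<in>{1..length ts}. Lin (ts ! (j - 1)))"
    unfolding extend_tree.simps
    by (rule msubst_in_tree_space[OF gen_mapD[OF L ts(1)] _ ts(3)]) (use ts(2) Node.IH in auto)
  then show ?case using ts(4) by simp
qed

lemma extend_in_tree_space: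
  "gen_map V W L \<Longrightarrow> f \<in> tree_space V X \<Longrightarrow> extend L f \<in> tree_space W X"
  unfolding extend_def
  by (intro tree_space_linext extend_tree_in_tree_space) (auto dest: tree_spaceD)

lemma msubst_cong_space:
  assumes "f \<in> tree_space V X" "\<And>a. a \<in> X \<Longrightarrow> g a = h a"
  shows "msubst g f = msubst h f"
  by (rule msubst_cong) (use assms in \<open>auto dest: tree_spaceD labeled_treesD\<close>)

text \<open>Both sides insert images of children into the image of the root; associativity of
  substitution (\<open>msubst_msubst\<close>) moves the outer substitution into the
  children.\<close>

lemma extend_tree_subst:
  assumes L: "gen_map V W L"
  shows "decorated V t \<Longrightarrow>
    extend_tree L (subst g t) = msubst (\<lambda>a. extend_tree L (g a)) (extend_tree L t)"
proof (induction t)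
  case (Node \<omega> ts)
  have "extend_tree L (subst g (ts ! (j - 1))) =
      msubst (\<lambda>a. extend_tree L (g a)) (extend_tree L (ts ! (j - 1)))" if "j \<in> {1..length ts}" for j
    using that Node by (intro Node.IH) (auto simp: list_all_length)
  then show ?case
    using Node.prems gen_mapD[OF L, of \<omega> "length ts"]
    by (auto simp: msubst_msubst intro!: msubst_cong_space)
qed simp

lemma extend_msubst_tree:
  assumes L: "gen_map V W L" and t: "t \<in> labeled_trees V X"
  shows "extend L (msubst_tree g t) = msubst (\<lambda>a. extend L (g a)) (extend_tree L t)"
proof -
  note F = extend_tree_in_tree_space[OF L t]
  \<comment> \<open>Equality is phrased as membership of the difference in the zero space, so that
    \<open>multilinear_in\<close> reduces it to families of single trees.\<close>
  have "extend L (msubst_tree g t) - msubst (\<lambda>a. extend L (g a)) (extend_tree L t) \<in> {0}"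
  proof (rule multilinear_in[where D = X and T = "\<lambda>a. UNIV" and g = g
        and \<Psi> = "\<lambda>g. extend L (msubst_tree g t) - msubst (\<lambda>a. extend L (g a)) (extend_tree L t)"])
    show "finite X" using labeled_treesD[OF t] by simp
    show "lin_closed {0}" by (simp add: lin_closed_def)
    fix g :: "nat \<Rightarrow> _" and a u assume a: "a \<in> X"
    let ?g = "\<lambda>b. extend L (g b)"
    have upd: "(\<lambda>b. extend L ((g(a := v)) b)) = ?g(a := extend L v)" for v by auto
    have "msubst (?g(a := extend L u)) (extend_tree L t) =
        linext (\<lambda>s. linext (\<lambda>s'. msubst (?g(a := basis s')) (extend_tree L t)) (extend_tree L s)) u"
      unfolding msubst_update[OF F a, of _ "extend L u"] by (simp add: extend_def linext_linext)
    also have "\<dots> = linext (\<lambda>s. msubst (?g(a := extend L (basis s))) (extend_tree L t)) u"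
      by (simp only: msubst_update[OF F a, of _ "extend_tree L _"] extend_basis)
    finally show "extend L (msubst_tree (g(a := u)) t) -
        msubst (\<lambda>b. extend L ((g(a := u)) b)) (extend_tree L t) =
        linext (\<lambda>s. extend L (msubst_tree (g(a := basis s)) t) -
          msubst (\<lambda>b. extend L ((g(a := basis s)) b)) (extend_tree L t)) u"
      unfolding upd msubst_tree_update'[OF t a, of g u]
      by (simp only: linext_fun_diff extend_linext)
  next
    fix h
    have "msubst_tree (\<lambda>a. if a \<in> X then basis (h a) else g a) t = basis (subst h t)"
      unfolding msubst_tree_basis[symmetric]
      by (rule msubst_tree_cong) (use labeled_treesD[OF t] in auto)
    moreover have "msubst (\<lambda>a. extend L (if a \<in> X then basis (h a) else g a)) (extend_tree L t) =
        msubst (\<lambda>a. extend_tree L (h a)) (extend_tree L t)"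
      by (rule msubst_cong_space[OF F]) simp
    ultimately show "extend L (msubst_tree (\<lambda>a. if a \<in> X then basis (h a) else g a) t) -
      msubst (\<lambda>a. extend L (if a \<in> X then basis (h a) else g a)) (extend_tree L t) \<in> {0}"
      using extend_tree_subst[OF L] labeled_treesD[OF t] by simp
  qed simp
  then show ?thesis by simp
qed

lemma extend_msubst:
  assumes L: "gen_map V W L" and f: "f \<in> tree_space V X"
  shows "extend L (msubst g f) = msubst (\<lambda>a. extend L (g a)) (extend L f)"
proof -
  have "extend L (msubst g f) = linext (\<lambda>t. msubst (\<lambda>a. extend L (g a)) (extend_tree L t)) f"
    unfolding msubst_def[of g] extend_linext
    by (intro linext_cong extend_msubst_tree[OF L tree_spaceD[OF f]])
  then show ?thesis by (simp add: extend_def msubst_linext)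
qed

lemma extend_relabel:
  assumes L: "gen_map V W L" and f: "f \<in> tree_space V X"
  shows "extend L (linext (\<lambda>t. basis (relabel \<rho> t)) f) = linext (\<lambda>t. basis (relabel \<rho> t)) (extend L f)"
  using extend_msubst[OF L f, of "\<lambda>a. basis (Leaf (\<rho> a))"]
  by (simp add: msubst_basis relabel_def)

text \<open>Assignments on generators compose. With \<open>extend_cong\<close>, two composites of
  extensions can then be compared on generators alone.\<close>

lemma extend_extend_tree:
  assumes A: "gen_map U V A" and L: "gen_map V W L"
  shows "decorated U t \<Longrightarrow> extend L (extend_tree A t) = extend_tree (\<lambda>n \<omega>. extend L (A n \<omega>)) t"
proof (induction t)
  case (Node \<omega> ts)
  then have \<omega>: "A (length ts) \<omega> \<in> tree_space V {1..length ts}"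
    using gen_mapD[OF A] by simp
  have "extend L (extend_tree A (ts ! (j - 1))) =
      extend_tree (\<lambda>n \<omega>. extend L (A n \<omega>)) (ts ! (j - 1))" if "j \<in> {1..length ts}" for j
    using that Node by (intro Node.IH) (auto simp: list_all_length)
  then show ?case
    unfolding extend_tree.simps extend_msubst[OF L \<omega>]
    by (intro msubst_cong_space[OF extend_in_tree_space[OF L \<omega>]]) auto
qed simp

lemma extend_extend:
  assumes "gen_map U V A" "gen_map V W L" "f \<in> tree_space U X"
  shows "extend L (extend A f) = extend (\<lambda>n \<omega>. extend L (A n \<omega>)) f"
  unfolding extend_def[of A] extend_linext extend_def[of "\<lambda>n \<omega>. extend L (A n \<omega>)"]
  by (intro linext_cong extend_extend_tree[OF assms(1,2)])
    (use assms(3) in \<open>auto dest: tree_spaceD labeled_treesD\<close>)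

lemma extend_tree_cong:
  assumes "\<And>n \<omega>. \<omega> \<in> gens V n \<Longrightarrow> L n \<omega> = L' n \<omega>"
  shows "decorated V t \<Longrightarrow> extend_tree L t = extend_tree L' t"
proof (induction t)
  case (Node \<omega> ts)
  then have "map (extend_tree L) ts = map (extend_tree L') ts"
    by (auto simp: list_all_iff)
  then show ?case using Node.prems assms by (simp only: extend_tree.simps decorated.simps)
qed simp

lemma extend_cong:
  assumes "\<And>n \<omega>. \<omega> \<in> gens V n \<Longrightarrow> L n \<omega> = L' n \<omega>" "f \<in> tree_space V X"
  shows "extend L f = extend L' f"
  unfolding extend_def
  by (intro linext_cong extend_tree_cong[of V, OF assms(1)])
    (use assms(2) in \<open>auto dest: tree_spaceD labeled_treesD\<close>)

text \<open>Congruence replaces children by congruent ones. For a reordering, \<open>equiv\<close>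
  trades the image of the transformed root for the image of the root with leaves relabeled by the
  permutation, and substituting into relabeled leaves is substituting the permuted children.\<close>

lemma null_extend_iso:
  assumes V: "is_smodule V" and L: "gen_map V W L"
    and equiv: "\<And>n \<sigma> \<omega>. \<omega> \<in> gens V n \<Longrightarrow> \<sigma> permutes {1..n} \<Longrightarrow>
      null W R' {1..n} (L n (gact V n \<sigma> \<omega>) - linext (\<lambda>t. basis (relabel \<sigma> t)) (L n \<omega>))"
    and "tree_iso V t u" "t \<in> labeled_trees V X"
  shows "null W R' X (extend_tree L t - extend_tree L u)"
  using assms(4,5)
proof (induction arbitrary: X rule: tree_iso.induct)
  case (refl t)
  then show ?case by (simp add: null.zero)
next
  case (sym t u)
  then have "null W R' X (extend_tree L t - extend_tree L u)"
    using labeled_trees_iso[OF V] by blast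
  from null.scale[OF this, of "- 1"] show ?case by (simp add: pscale_minus_one)
next
  case (trans t u v)
  then have "null W R' X (extend_tree L t - extend_tree L u)"
    "null W R' X (extend_tree L u - extend_tree L v)"
    using labeled_trees_iso[OF V] by blast+
  from null.add[OF this] show ?case by simp
next
  case (cong ts us \<omega>)
  note ts = labeled_trees_NodeD[OF cong.prems]
  have len: "length us = length ts" using cong.IH by (auto dest: list_all2_lengthD)
  have iso: "tree_iso V (ts ! j) (us ! j)" if "j < length ts" for j
    using cong.IH that by (auto simp: list_all2_conv_all_nth)
  have us: "us ! j \<in> labeled_trees V (Lin (ts ! j))" if "j < length ts" for j
    using ts(2) iso labeled_trees_iso[OF V] that by blast
  have "null W R' (\<Union>j\<in>{1..length ts}. Lin (ts ! (j - 1)))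
    (msubst (\<lambda>j. map (extend_tree L) ts ! (j - 1)) (L (length ts) \<omega>) -
     msubst (\<lambda>j. map (extend_tree L) us ! (j - 1)) (L (length ts) \<omega>))"
  proof (rule null_msubst_cong[OF gen_mapD[OF L ts(1)] _ _ ts(3)])
    fix j assume "j \<in> {1..length ts}"
    then have j: "j - 1 < length ts" by auto
    show "map (extend_tree L) ts ! (j - 1) \<in> tree_space W (Lin (ts ! (j - 1)))"
      using extend_tree_in_tree_space[OF L ts(2)[OF j]] j by simp
    show "map (extend_tree L) us ! (j - 1) \<in> tree_space W (Lin (ts ! (j - 1)))"
      using extend_tree_in_tree_space[OF L us[OF j]] j len by simp
    show "null W R' (Lin (ts ! (j - 1)))
      (map (extend_tree L) ts ! (j - 1) - map (extend_tree L) us ! (j - 1))"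
      using cong.IH j len ts(2)[OF j] by (simp add: list_all2_conv_all_nth)
  qed
  then show ?case using ts(4) len by simp
next
  case (reorder n ts \<omega> \<sigma>)
  note ts = labeled_trees_NodeD[OF reorder.prems]
  let ?g = "\<lambda>j. map (extend_tree L) ts ! (j - 1)"
  let ?us = "map (\<lambda>i. ts ! (\<sigma> i - 1)) [1..<Suc n]"
  note \<omega> = gen_mapD[OF L reorder.hyps(2)]
  have n: "n = length ts" by (rule reorder.hyps(1))
  have "null W R' (\<Union>j\<in>{1..n}. Lin (ts ! (j - 1)))
     (msubst ?g (L n (gact V n \<sigma> \<omega>) - linext (\<lambda>t. basis (relabel \<sigma> t)) (L n \<omega>)))"
  proof (rule null_msubst_left[OF equiv])
    fix j assume "j \<in> {1..n}"
    then have j: "j - 1 < length ts" using n by auto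
    show "?g j \<in> tree_space W (Lin (ts ! (j - 1)))"
      using extend_tree_in_tree_space[OF L ts(2)[OF j]] j by simp
  qed (use reorder ts(3) in auto)
  moreover have "msubst ?g (linext (\<lambda>t. basis (relabel \<sigma> t)) (L n \<omega>)) =
      msubst (\<lambda>j. map (extend_tree L) ?us ! (j - 1)) (L n \<omega>)"
  proof -
    have "msubst ?g (linext (\<lambda>t. basis (relabel \<sigma> t)) (L n \<omega>)) = msubst (\<lambda>j. ?g (\<sigma> j)) (L n \<omega>)"
      using msubst_msubst[of ?g "\<lambda>a. basis (Leaf (\<sigma> a))" "L n \<omega>"]
      by (simp add: msubst_basis relabel_def)
    also have "\<dots> = msubst (\<lambda>j. map (extend_tree L) ?us ! (j - 1)) (L n \<omega>)"
    proof (rule msubst_cong_space[OF \<omega>])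
      fix j assume j: "j \<in> {1..n}"
      then have "\<sigma> j \<in> {1..n}" using permutes_in_image[OF reorder.hyps(3)] by blast
      then have "\<sigma> j - 1 < length ts" "j - 1 < length [1..<Suc n]" "[1..<Suc n] ! (j - 1) = j"
        using j n by (auto simp del: upt_Suc)
      then show "?g (\<sigma> j) = map (extend_tree L) ?us ! (j - 1)"
        by (simp only: nth_map length_map)
    qed
    finally show ?thesis .
  qed
  ultimately show ?case
    using ts(4) n by (simp add: msubst_def linext_diff del: upt_Suc)
qed

text \<open>Relabeling and grafting are instances of substitution, which \<open>extend\<close>
  respects; only the rules for isomorphisms and for relations draw on the hypotheses.\<close>

lemma null_extend:
  assumes V: "is_smodule V" and L: "gen_map V W L"
    and equiv: "\<And>n \<sigma> \<omega>. \<omega> \<in> gens V n \<Longrightarrow> \<sigma> permutes {1..n} \<Longrightarrow>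
      null W R' {1..n} (L n (gact V n \<sigma> \<omega>) - linext (\<lambda>t. basis (relabel \<sigma> t)) (L n \<omega>))"
    and rels: "\<And>r X. r \<in> R \<Longrightarrow> r \<in> tree_space V X \<Longrightarrow> null W R' X (extend L r)"
    and "null V R X f"
  shows "null W R' X (extend L f)"
  using assms(5)
proof (induction rule: null.induct)
  case (zero X)
  then show ?case by (simp add: extend_def null.zero)
next
  case (add X f g)
  then show ?case by (simp add: extend_def linext_add null.add)
next
  case (scale X f c)
  then show ?case by (simp add: extend_def linext_pscale null.scale)
next
  case (iso t X u)
  then show ?case
    using null_extend_iso[OF V L equiv] by (simp add: extend_def linext_diff)
next
  case (rel r X)
  then show ?case by (rule rels)
next
  case (relabel X f \<rho>)
  then show ?case
    by (simp add: extend_relabel[OF L null_in_tree_space] null.relabel)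
next
  case (comp_left X f s Y a)
  show ?case
  proof (cases "f = 0")
    case True
    then show ?thesis by (simp add: extend_def null.zero)
  next
    case False
    \<comment> \<open>A nonzero \<open>f\<close> contains a tree, and labels of trees are positive;
      hence the identity values \<open>basis (Leaf b)\<close> are admissible for \<open>b\<close> in
      \<open>X\<close>.\<close>
    then have X0: "0 \<notin> X"
      using null_in_tree_space[OF comp_left.hyps(1)] labeled_treesD(4)
      by (metis keys_eq_empty ex_in_conv tree_spaceD)
    have eq: "linext (\<lambda>t. basis (subst (Leaf(a := s)) t)) f = msubst (\<lambda>b. basis ((Leaf(a := s)) b)) f"
      by (simp add: msubst_basis del: fun_upd_apply)
    have "null W R' (\<Union>b\<in>X. ((\<lambda>b. {b})(a := Y)) b)
       (msubst (\<lambda>b. extend L (basis ((Leaf(a := s)) b))) (extend L f))"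
      by (rule null_msubst_left[OF comp_left.IH])
        (use comp_left.hyps extend_tree_in_tree_space[OF L comp_left.hyps(2)]
            X0
          in \<open>auto simp: disjoint_family_on_def labeled_trees_Leaf\<close>)
    moreover have "(\<Union>b\<in>X. ((\<lambda>b. {b})(a := Y)) b) = X - {a} \<union> Y"
      using comp_left.hyps by auto
    ultimately show ?thesis
      unfolding eq extend_msubst[OF L null_in_tree_space[OF comp_left.hyps(1)]] by simp
  qed
next
  case (comp_right t X Y f a)
  let ?g = "(\<lambda>b. basis (Leaf b))(a := f)"
  have eq: "linext (\<lambda>s. basis (subst (Leaf(a := s)) t)) f = msubst_tree ?g t"
    unfolding msubst_tree_update'[OF comp_right.hyps(1,3), of "\<lambda>b. basis (Leaf b)" f]
      msubst_tree_basis[symmetric]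
    by (intro linext_cong msubst_tree_cong) simp
  have "null W R' (\<Union>b\<in>X. ((\<lambda>b. {b})(a := Y)) b)
     (msubst (\<lambda>b. extend L (?g b)) (extend_tree L t))"
    by (rule null_msubst_right[OF extend_tree_in_tree_space[OF L comp_right.hyps(1)] _ _ comp_right.hyps(3)])
      (use comp_right.hyps comp_right.IH null_in_tree_space[OF comp_right.IH]
          labeled_treesD(4)[OF comp_right.hyps(1)]
        in \<open>auto simp: disjoint_family_on_def labeled_trees_Leaf\<close>)
  moreover have "(\<Union>b\<in>X. ((\<lambda>b. {b})(a := Y)) b) = X - {a} \<union> Y"
    using comp_right.hyps by auto
  ultimately show ?case
    unfolding eq extend_msubst_tree[OF L comp_right.hyps(1)] by simp
qed

section \<open>From planar trees to presented operads\<close>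

lemma relabel_relabel: "relabel \<rho> (relabel \<rho>' t) = relabel (\<lambda>a. \<rho> (\<rho>' a)) t"
  by (simp add: relabel_def subst_subst)

lemma relabel_subst: "relabel \<rho> (subst h t) = subst (\<lambda>a. relabel \<rho> (h a)) t"
  by (simp add: relabel_def subst_subst)

lemma relabel_Leaf [simp]: "relabel \<rho> (Leaf a) = Leaf (\<rho> a)"
  by (simp add: relabel_def)

lemma relabel_cong: "(\<And>a. a \<in> Lin t \<Longrightarrow> \<rho> a = \<rho>' a) \<Longrightarrow> relabel \<rho> t = relabel \<rho>' t"
  unfolding relabel_def by (rule subst_cong) simp

lemma relabel_idI: "(\<And>a. a \<in> Lin t \<Longrightarrow> \<rho> a = a) \<Longrightarrow> relabel \<rho> t = t"
  using subst_cong[of t "\<lambda>a. Leaf (\<rho> a)" Leaf] by (simp add: relabel_def)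

section \<open>Isomorphism classes of planar trees\<close>

lemma iso_class_eq_iff: "iso_class V t = iso_class V u \<longleftrightarrow> tree_iso V t u"
  unfolding iso_class_def by (auto intro: tree_iso.intros)

lemma mem_iso_class: "u \<in> iso_class V t \<longleftrightarrow> tree_iso V t u"
  by (simp add: iso_class_def)

lemma iso_class_nonempty [simp]: "iso_class V t \<noteq> {}"
  using tree_iso.refl[of V t] by (auto simp: iso_class_def)

lemma tree_iso_subst: "tree_iso V t u \<Longrightarrow> tree_iso V (subst f t) (subst f u)"
proof (induction rule: tree_iso.induct)
  case (cong ts us \<omega>)
  then show ?case by (auto intro!: tree_iso.cong simp: list_all2_conv_all_nth)
next
  case (reorder n ts \<omega> \<sigma>)
  have "map (subst f) (map (\<lambda>i. ts ! (\<sigma> i - 1)) [1..<Suc n]) =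
      map (\<lambda>i. map (subst f) ts ! (\<sigma> i - 1)) [1..<Suc n]"
  proof (rule nth_equalityI)
    fix i assume "i < length (map (subst f) (map (\<lambda>i. ts ! (\<sigma> i - 1)) [1..<Suc n]))"
    then have i: "i < n" "[1..<Suc n] ! i = Suc i" by (auto simp del: upt_Suc)
    then have "\<sigma> (Suc i) \<in> {1..n}" using permutes_in_image[OF reorder(3)] by auto
    then have "\<sigma> (Suc i) - 1 < length ts" using reorder(1) by auto
    then show "map (subst f) (map (\<lambda>i. ts ! (\<sigma> i - 1)) [1..<Suc n]) ! i =
        map (\<lambda>i. map (subst f) ts ! (\<sigma> i - 1)) [1..<Suc n] ! i"
      using i by (simp del: upt_Suc)
  qed simp
  then show ?case
    using tree_iso.reorder[of n "map (subst f) ts" \<omega> V \<sigma>] reorder by (simp del: upt_Suc map_map)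
qed (auto intro: tree_iso.intros)

lemma tree_iso_subst_env: "(\<And>a. tree_iso V (f a) (g a)) \<Longrightarrow> tree_iso V (subst f t) (subst g t)"
  by (induction t) (auto intro!: tree_iso.cong simp: list_all2_conv_all_nth)

lemma tree_iso_tree_comp:
  assumes V: "is_smodule V" and t: "tree_iso V t t'" and s: "tree_iso V s s'"
  shows "tree_iso V (tree_comp i t s) (tree_comp i t' s')"
proof -
  \<comment> \<open>The number of leaves of \<open>s\<close> enters the renumbering of the leaves
    after the \<open>i\<close>-th one, so it must be an invariant of isomorphism.\<close>
  have "length (leaves s) = length (leaves s')"
    using tree_iso_invariants[OF V s] by (auto dest: mset_eq_length)
  then have "tree_iso V (tree_comp i t s) (tree_comp i t s')"
    unfolding tree_comp_def using tree_iso_subst[OF s]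
    by (intro tree_iso_subst_env) (auto intro: tree_iso.refl simp: relabel_def)
  moreover have "tree_iso V (tree_comp i t s') (tree_comp i t' s')"
    unfolding tree_comp_def by (rule tree_iso_subst[OF t])
  ultimately show ?thesis by (rule tree_iso.trans)
qed

lemma Union_constant: "A \<noteq> {} \<Longrightarrow> (\<And>a. a \<in> A \<Longrightarrow> F a = C) \<Longrightarrow> (\<Union>a\<in>A. F a) = C"
  by blast

text \<open>The map from planar sums onto the free operad; its kernel is treated in
  \<open>iso_sum_eq_zero_null\<close>.\<close>

definition iso_sum :: "'v smodule \<Rightarrow> ('v tree \<Rightarrow>\<^sub>0 'k::field) \<Rightarrow> ('v tree set \<Rightarrow>\<^sub>0 'k)" where
  "iso_sum V = linext (\<lambda>t. basis (iso_class V t))"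

definition comp_sum :: "nat \<Rightarrow> ('v tree \<Rightarrow>\<^sub>0 'k::field) \<Rightarrow> ('v tree \<Rightarrow>\<^sub>0 'k) \<Rightarrow> ('v tree \<Rightarrow>\<^sub>0 'k)" where
  "comp_sum i f g = linext (\<lambda>t. linext (\<lambda>s. basis (tree_comp i t s)) g) f"

text \<open>Relabeling respects isomorphism, so the union over representatives in
  \<open>pact\<close> is a union of copies of one class.\<close>

lemma pact_iso_sum:
  "pact (free_operad V) n \<sigma> (iso_sum V f) = iso_sum V (linext (\<lambda>t. basis (relabel \<sigma> t)) f)"
proof -
  have "(\<Union>u\<in>iso_class V t. iso_class V (relabel \<sigma> u)) = iso_class V (relabel \<sigma> t)" for t
    by (rule Union_constant)
      (simp_all add: iso_class_eq_iff mem_iso_class relabel_def tree_iso_subst tree_iso.sym)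
  then show ?thesis by (simp add: free_operad_def iso_sum_def linext_linext)
qed

lemma pcomp_iso_sum:
  assumes V: "is_smodule V"
  shows "pcomp (free_operad V) m i n (iso_sum V f) (iso_sum V g) = iso_sum V (comp_sum i f g)"
proof -
  have "(\<Union>u\<in>iso_class V t. \<Union>v\<in>iso_class V s. iso_class V (tree_comp i u v)) =
      iso_class V (tree_comp i t s)" for t s
    by (intro Union_constant)
      (simp_all add: iso_class_eq_iff mem_iso_class tree_iso_tree_comp[OF V] tree_iso.sym)
  then show ?thesis by (simp add: free_operad_def iso_sum_def comp_sum_def linext_linext)
qed

lemma iso_sum_in_comps:
  assumes "f \<in> tree_space V {1..n}"
  shows "iso_sum V f \<in> comps (free_operad V) n"
proof -
  have "iso_sum V f \<in> {x. Poly_Mapping.keys x \<subseteq> iso_class V ` labeled_trees V {1..n}}"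
    unfolding iso_sum_def
    by (rule lin_closed_linext[OF lin_closed_span]) (use tree_spaceD[OF assms] in auto)
  then show ?thesis by (simp add: free_operad_def)
qed

lemma iso_sum_section:
  assumes "Poly_Mapping.keys x \<subseteq> iso_class V ` labeled_trees V X"
  obtains f where "f \<in> tree_space V X" "iso_sum V f = x"
proof
  let ?s = "inv_into (labeled_trees V X) (iso_class V)"
  show "linext (\<lambda>A. basis (?s A)) x \<in> tree_space V X"
    using assms inv_into_into[of _ "iso_class V" "labeled_trees V X"] by (intro tree_space_linext) auto
  have "iso_sum V (linext (\<lambda>A. basis (?s A)) x) = linext basis x"
    unfolding iso_sum_def linext_linext
    using assms f_inv_into_f[of _ "iso_class V" "labeled_trees V X"]
    by (intro linext_cong) auto
  then show "iso_sum V (linext (\<lambda>A. basis (?s A)) x) = x" by simp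
qed

lemma comps_free_operad: "comps (free_operad V) n = iso_sum V ` tree_space V {1..n}"
proof
  show "comps (free_operad V) n \<subseteq> iso_sum V ` tree_space V {1..n}"
    using iso_sum_section[of _ V "{1..n}"] by (fastforce simp: free_operad_def)
qed (auto intro: iso_sum_in_comps)

text \<open>The kernel of \<open>iso_sum\<close> is spanned by differences of isomorphic trees:
  replacing every tree by a chosen representative of its class gives a sum that depends on
  \<open>iso_sum V f\<close> only and hence vanishes.\<close>

lemma iso_sum_eq_zero_null:
  assumes V: "is_smodule V" and f: "f \<in> tree_space V X" and "iso_sum V f = 0"
  shows "null V R X f"
proof -
  let ?r = "\<lambda>A. SOME t. t \<in> A"
  have r: "tree_iso V t (?r (iso_class V t))" for t
  proof -
    have "t \<in> iso_class V t" by (simp add: iso_class_def tree_iso.refl)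
    then have "?r (iso_class V t) \<in> iso_class V t" by (rule someI)
    then show ?thesis by (simp add: iso_class_def)
  qed
  have "linext (\<lambda>t. basis (?r (iso_class V t))) f = linext (\<lambda>A. basis (?r A)) (iso_sum V f)"
    by (simp add: iso_sum_def linext_linext)
  then have "f = linext (\<lambda>t. basis t - basis (?r (iso_class V t))) f"
    by (simp add: linext_fun_diff assms(3))
  moreover have "null V R X \<dots>"
  proof (rule null_linext)
    fix t assume "t \<in> Poly_Mapping.keys f"
    then have "t \<in> labeled_trees V X" using f tree_spaceD by blast
    then show "null V R X (basis t - basis (?r (iso_class V t)))"
      using r labeled_trees_iso[OF V r] by (intro null.iso) auto
  qed
  ultimately show ?thesis by simp
qed

section \<open>Increasing renumbering of leaf sets\<close>

definition rank :: "nat set \<Rightarrow> nat \<Rightarrow> nat" where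
  "rank X a = card {b \<in> X. b \<le> a}"

lemma bij_betw_rank:
  assumes "finite X"
  shows "bij_betw (rank X) X {1..card X}"
proof -
  have less: "rank X a < rank X b" if "a \<in> X" "b \<in> X" "a < b" for a b
  proof -
    have "{c \<in> X. c \<le> a} \<subseteq> {c \<in> X. c \<le> b}" "b \<in> {c \<in> X. c \<le> b}" "b \<notin> {c \<in> X. c \<le> a}"
      using that by auto
    then have "{c \<in> X. c \<le> a} \<subset> {c \<in> X. c \<le> b}" by blast
    then show ?thesis using assms by (simp add: rank_def psubset_card_mono)
  qed
  then have inj: "inj_on (rank X) X"
    by (metis inj_onI less_irrefl linorder_neqE_nat)
  have "rank X a \<in> {1..card X}" if "a \<in> X" for a
  proof -
    have "{b \<in> X. b \<le> a} \<noteq> {}" using that by auto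
    then have "rank X a \<noteq> 0" using assms by (simp add: rank_def)
    then have "1 \<le> rank X a" by simp
    moreover have "rank X a \<le> card X" using assms by (auto simp: rank_def intro: card_mono)
    ultimately show ?thesis by simp
  qed
  then have "rank X ` X = {1..card X}"
    using inj assms by (intro card_subset_eq) (auto simp: card_image)
  then show ?thesis using inj by (simp add: bij_betw_def)
qed

lemma rank_atLeastAtMost: "a \<in> {1..n} \<Longrightarrow> rank {1..n} a = a"
proof -
  assume "a \<in> {1..n}"
  then have "{b \<in> {1..n}. b \<le> a} = {1..a}" by auto
  then show ?thesis by (simp add: rank_def)
qed

lemma rank_pos: "finite X \<Longrightarrow> 0 \<notin> rank X ` X"
  using bij_betw_rank[of X] by (auto simp: bij_betw_def)

lemma standardize_eq: "t \<in> labeled_trees V X \<Longrightarrow> standardize t = relabel (rank X) t"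
  unfolding standardize_def rank_def[abs_def] by (auto dest: labeled_treesD)

lemma to_free_eq:
  assumes "f \<in> tree_space V X"
  shows "to_free V f = iso_sum V (linext (\<lambda>t. basis (relabel (rank X) t)) f)"
  unfolding to_free_def iso_sum_def linext_linext
  by (intro linext_cong) (simp add: standardize_eq[OF tree_spaceD[OF assms]])

lemma labeled_trees_rank:
  "t \<in> labeled_trees V X \<Longrightarrow> relabel (rank X) t \<in> labeled_trees V {1..card X}"
  using labeled_trees_relabel[of t V X "rank X"] bij_betw_rank[of X] rank_pos[of X]
  by (auto dest: labeled_treesD simp: bij_betw_def)

lemma labeled_trees_rank_id: "t \<in> labeled_trees V {1..n} \<Longrightarrow> relabel (rank {1..n}) t = t"
  by (rule relabel_idI) (simp only: labeled_treesD(3) rank_atLeastAtMost)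

lemma relabel_sum_in_tree_space:
  "f \<in> tree_space V X \<Longrightarrow> inj_on \<rho> X \<Longrightarrow> 0 \<notin> \<rho> ` X \<Longrightarrow>
    linext (\<lambda>t. basis (relabel \<rho> t)) f \<in> tree_space V (\<rho> ` X)"
  by (intro tree_space_linext) (auto intro: labeled_trees_relabel dest: tree_spaceD)

lemma to_free_atLeastAtMost:
  assumes "f \<in> tree_space V {1..n}"
  shows "to_free V f = iso_sum V f"
proof -
  have "linext (\<lambda>t. basis (relabel (rank {1..n}) t)) f = linext basis f"
    by (intro linext_cong) (simp only: labeled_trees_rank_id[OF tree_spaceD[OF assms]])
  then show ?thesis by (simp add: to_free_eq[OF assms])
qed

text \<open>Turns a change of leaf labels into a symmetric group action: \<open>\<sigma>\<close>
  sends the number given by \<open>q\<close> to the one given by \<open>p\<close>.\<close>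

lemma ex_permutation_between:
  assumes "bij_betw p Z {1..n::nat}" "bij_betw q Z {1..n}"
  obtains \<sigma> where "\<sigma> permutes {1..n}" "\<And>z. z \<in> Z \<Longrightarrow> \<sigma> (q z) = p z"
proof
  let ?\<sigma> = "\<lambda>k. if k \<in> {1..n} then p (inv_into Z q k) else k"
  show "?\<sigma> permutes {1..n}"
  proof (rule bij_imp_permutes)
    have "bij_betw (p \<circ> inv_into Z q) {1..n} {1..n}"
      by (rule bij_betw_trans[OF bij_betw_inv_into[OF assms(2)] assms(1)])
    then show "bij_betw ?\<sigma> {1..n} {1..n}"
      by (rule bij_betw_cong[THEN iffD1, rotated]) simp
  qed auto
  show "?\<sigma> (q z) = p z" if "z \<in> Z" for z
    using that assms(2) by (auto simp: bij_betw_def)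
qed

lemma length_leaves: "s \<in> labeled_trees V X \<Longrightarrow> length (leaves s) = card X"
  by (metis Lin_def distinct_card labeled_treesD(2,3))

text \<open>Grafting keeps labels, while \<open>tree_comp\<close> renumbers them. After
  standardization both results carry numberings of the same leaves, hence differ by a permutation.
  It depends on the label sets and on \<open>a\<close> only, so one \<open>\<sigma>\<close> serves
  all terms of a formal sum.\<close>

lemma standardize_graft_leaf:
  assumes fin: "finite X" "finite Y" and a: "a \<in> X" and disj: "Y \<inter> (X - {a}) = {}"
  obtains \<sigma> where "\<sigma> permutes {1..card X + card Y - 1}"
    "\<And>V t s. t \<in> labeled_trees V X \<Longrightarrow> s \<in> labeled_trees V Y \<Longrightarrow>
      relabel (rank (X - {a} \<union> Y)) (subst (Leaf(a := s)) t) =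
      relabel \<sigma> (tree_comp (rank X a) (relabel (rank X) t) (relabel (rank Y) s))"
proof -
  let ?m = "card X" and ?n = "card Y" and ?Z = "X - {a} \<union> Y" and ?i = "rank X a"
  \<comment> \<open>The numbering of \<open>?Z\<close> that \<open>tree_comp\<close> produces: the
    leaves of \<open>s\<close> fill the \<open>?n\<close> places from \<open>?i\<close> on, and
    later leaves move up by \<open>?n - 1\<close>. Membership in \<open>Y\<close> is tested first
    because \<open>a\<close> itself may lie in \<open>Y\<close>.\<close>
  define \<rho> where "\<rho> z = (if z \<in> Y then rank Y z + ?i - 1
      else if rank X z < ?i then rank X z else rank X z + ?n - 1)" for z
  have X: "inj_on (rank X) X" "\<And>x. x \<in> X \<Longrightarrow> 1 \<le> rank X x \<and> rank X x \<le> ?m"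
    using bij_betw_rank[OF fin(1)] by (auto simp: bij_betw_def)
  have Y: "inj_on (rank Y) Y" "\<And>x. x \<in> Y \<Longrightarrow> 1 \<le> rank Y x \<and> rank Y x \<le> ?n"
    using bij_betw_rank[OF fin(2)] by (auto simp: bij_betw_def)
  have ne: "rank X z \<noteq> ?i" if "z \<in> X - {a}" for z
    using that a X(1) by (auto simp: inj_on_def)
  have \<rho>Y: "?i \<le> \<rho> z \<and> \<rho> z < ?i + ?n" if "z \<in> Y" for z
    using Y(2)[OF that] X(2)[OF a] that by (auto simp: \<rho>_def)
  have \<rho>X: "\<rho> z = (if rank X z < ?i then rank X z else rank X z + ?n - 1)" if "z \<in> X - {a}" for z
    using that disj by (auto simp: \<rho>_def)
  have cardZ: "card ?Z = ?m + ?n - 1"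
    using fin a disj card_Un_disjoint[of "X - {a}" Y] X(2)[OF a] by (auto simp: Int_commute)
  have "inj_on \<rho> ?Z"
  proof (rule inj_onI)
    fix z z' assume z: "z \<in> ?Z" "z' \<in> ?Z" "\<rho> z = \<rho> z'"
    have XY: "\<rho> x \<noteq> \<rho> y" if "x \<in> X - {a}" "y \<in> Y" for x y
      using \<rho>X[OF that(1)] \<rho>Y[OF that(2)] ne[OF that(1)] by (auto split: if_splits)
    consider "z \<in> X - {a}" "z' \<in> X - {a}" | "z \<in> Y" "z' \<in> Y"
      using z XY by (metis Un_iff)
    then show "z = z'"
    proof cases
      case 1
      then have "rank X z = rank X z'"
        using z(3) \<rho>X[OF 1(1)] \<rho>X[OF 1(2)] ne[OF 1(1)] ne[OF 1(2)] by (auto split: if_splits)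
      then show ?thesis using 1 X(1) by (auto simp: inj_on_def)
    next
      case 2
      then have "rank Y z = rank Y z'"
        using z(3) Y(2)[OF 2(1)] Y(2)[OF 2(2)] by (auto simp: \<rho>_def)
      then show ?thesis using 2 Y(1) by (auto simp: inj_on_def)
    qed
  qed
  moreover have "\<rho> ` ?Z \<subseteq> {1..?m + ?n - 1}"
  proof (rule image_subsetI)
    fix z assume "z \<in> ?Z"
    then show "\<rho> z \<in> {1..?m + ?n - 1}"
      using \<rho>X[of z] \<rho>Y[of z] X(2)[of z] X(2)[OF a] ne[of z] by (auto split: if_splits)
  qed
  ultimately have "bij_betw \<rho> ?Z {1..?m + ?n - 1}"
    unfolding bij_betw_def by (intro conjI card_subset_eq) (simp_all add: card_image cardZ)
  moreover have "bij_betw (rank ?Z) ?Z {1..?m + ?n - 1}"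
    using bij_betw_rank[of ?Z] fin cardZ by simp
  ultimately obtain \<sigma> where \<sigma>: "\<sigma> permutes {1..?m + ?n - 1}" "\<And>z. z \<in> ?Z \<Longrightarrow> \<sigma> (\<rho> z) = rank ?Z z"
    using ex_permutation_between by metis
  have "relabel (rank ?Z) (subst (Leaf(a := s)) t) =
      relabel \<sigma> (tree_comp ?i (relabel (rank X) t) (relabel (rank Y) s))"
    if t: "t \<in> labeled_trees V X" and s: "s \<in> labeled_trees V Y" for V :: "'v smodule" and t s
  proof -
    define u where "u = relabel (rank Y) s"
    have len: "length (leaves u) = ?n"
      using length_leaves[OF s] by (simp add: u_def relabel_def leaves_subst)
    let ?E = "\<lambda>j. if j < ?i then Leaf j else if j = ?i then relabel (\<lambda>k. k + ?i - 1) u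
      else Leaf (j + ?n - 1)"
    have "tree_comp ?i (relabel (rank X) t) u = subst (\<lambda>z. ?E (rank X z)) t"
      unfolding tree_comp_def len relabel_def[of "rank X"] subst_subst by simp
    moreover have "subst (\<lambda>z. relabel (rank ?Z) ((Leaf(a := s)) z)) t =
        subst (\<lambda>z. relabel \<sigma> (?E (rank X z))) t"
    proof (rule subst_cong)
      fix z assume "z \<in> Lin t"
      then have zX: "z \<in> X" using labeled_treesD[OF t] by simp
      show "relabel (rank ?Z) ((Leaf(a := s)) z) = relabel \<sigma> (?E (rank X z))"
      proof (cases "z = a")
        case True
        have "relabel (rank ?Z) s = relabel \<sigma> (relabel (\<lambda>k. k + ?i - 1) u)"
          unfolding relabel_relabel u_def
        proof (rule relabel_cong)
          fix b assume "b \<in> Lin s"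
          then have "b \<in> Y" using labeled_treesD[OF s] by simp
          then show "rank ?Z b = \<sigma> (rank Y b + ?i - 1)"
            using \<sigma>(2)[of b] by (simp add: \<rho>_def)
        qed
        then show ?thesis using True by simp
      next
        case False
        then show ?thesis
          using zX \<sigma>(2)[of z] \<rho>X[of z] ne[of z] by auto
      qed
    qed
    ultimately show ?thesis by (simp only: relabel_subst u_def)
  qed
  then show ?thesis using \<sigma>(1) that by blast
qed

section \<open>The congruence on planar sums and the operadic ideal\<close>

lemma relation_ideal_zero: "(n, 0) \<in> relation_ideal V R"
  using operadic_ideal.zero[of n "free_operad V"] by (simp add: relation_ideal_def free_operad_def)

lemma relation_ideal_add:
  "(n, x) \<in> relation_ideal V R \<Longrightarrow> (n, y) \<in> relation_ideal V R \<Longrightarrow> (n, x + y) \<in> relation_ideal V R"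
  using operadic_ideal.add[of n x "free_operad V" _ y] by (simp add: relation_ideal_def free_operad_def)

lemma relation_ideal_scale:
  "(n, x) \<in> relation_ideal V R \<Longrightarrow> (n, pscale c x) \<in> relation_ideal V R"
  using operadic_ideal.smul[of n x "free_operad V" _ c] by (simp add: relation_ideal_def free_operad_def)

lemma lin_closed_relation_ideal: "lin_closed {x. (n, x) \<in> relation_ideal V R}"
  by (simp add: lin_closed_def relation_ideal_zero relation_ideal_add relation_ideal_scale)

lemma relation_ideal_diff:
  "(n, x) \<in> relation_ideal V R \<Longrightarrow> (n, y) \<in> relation_ideal V R \<Longrightarrow> (n, x - y) \<in> relation_ideal V R"
  using lin_closed_diff[OF lin_closed_relation_ideal] by auto

lemma to_free_zero [simp]: "to_free V 0 = 0"
  by (simp add: to_free_def)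

text \<open>After standardization, relabeling becomes the action of a permutation, and grafting
  becomes a partial composition followed by a permutation; an operadic ideal is closed under
  both.\<close>

lemma null_in_relation_ideal:
  assumes V: "is_smodule V"
  shows "null V R X f \<Longrightarrow> (card X, to_free V f) \<in> relation_ideal V R"
proof (induction rule: null.induct)
  case (zero X)
  then show ?case by (simp add: relation_ideal_zero)
next
  case (add X f g)
  then show ?case by (simp add: to_free_def linext_add relation_ideal_add)
next
  case (scale X f c)
  then show ?case by (simp add: to_free_def linext_pscale relation_ideal_scale)
next
  case (iso t X u)
  have "iso_class V (standardize t) = iso_class V (standardize u)"
    using iso by (simp add: iso_class_eq_iff standardize_eq relabel_def tree_iso_subst)
  then show ?case by (simp add: to_free_def linext_diff relation_ideal_zero)
next
  case (rel r X)
  show ?case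
  proof (cases "r = 0")
    \<comment> \<open>A nonzero relation determines its label set, so it counts among the generators
      of arity \<open>card X\<close>; zero is homogeneous for every label set.\<close>
    case False
    then obtain t where "t \<in> Poly_Mapping.keys r" by (metis ex_in_conv keys_eq_empty)
    then have "rel_Lin r = X"
      using tree_spaceD[OF rel(2)] by (auto simp: rel_Lin_def dest: labeled_treesD)
    then show ?thesis
      using rel(1) unfolding relation_ideal_def by (intro operadic_ideal.gen) auto
  qed (simp add: relation_ideal_zero)
next
  case (relabel X f \<rho>)
  note f = null_in_tree_space[OF relabel.hyps(1)]
  show ?case
  proof (cases "finite X")
    case True
    have "bij_betw (rank (\<rho> ` X) \<circ> \<rho>) X {1..card X}"
      using bij_betw_trans[OF _ bij_betw_rank, of \<rho> X "\<rho> ` X"] relabel.hyps(2) True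
      by (simp add: bij_betw_def card_image)
    then obtain \<sigma> where \<sigma>: "\<sigma> permutes {1..card X}"
      "\<And>z. z \<in> X \<Longrightarrow> \<sigma> (rank X z) = (rank (\<rho> ` X) \<circ> \<rho>) z"
      using ex_permutation_between[OF _ bij_betw_rank[OF True]] by metis
    have "to_free V (linext (\<lambda>t. basis (relabel \<rho> t)) f) =
        iso_sum V (linext (\<lambda>t. basis (relabel (rank (\<rho> ` X)) (relabel \<rho> t))) f)"
      by (simp add: to_free_eq[OF relabel_sum_in_tree_space[OF f relabel.hyps(2,3)]] linext_linext)
    also have "\<dots> = iso_sum V (linext (\<lambda>t. basis (relabel \<sigma> (relabel (rank X) t))) f)"
      using labeled_treesD(3)[OF tree_spaceD[OF f]] \<sigma>(2)
      by (intro arg_cong[of _ _ "iso_sum V"] linext_cong arg_cong[of _ _ basis])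
        (auto simp: relabel_relabel intro!: relabel_cong)
    also have "\<dots> = pact (free_operad V) (card X) \<sigma> (to_free V f)"
      by (simp add: to_free_eq[OF f] pact_iso_sum linext_linext)
    finally show ?thesis
      using relabel.IH \<sigma>(1) card_image[OF relabel.hyps(2)]
      by (simp add: relation_ideal_def operadic_ideal.act)
  qed (simp add: tree_space_infinite[OF f] relation_ideal_zero)
next
  case (comp_left X f s Y a)
  note f = null_in_tree_space[OF comp_left.hyps(1)]
  show ?case
  proof (cases "finite X")
    case True
    let ?Z = "X - {a} \<union> Y" and ?s = "relabel (rank Y) s" and ?i = "rank X a"
    have Y: "finite Y" using labeled_treesD[OF comp_left.hyps(2)] by simp
    obtain \<sigma> where \<sigma>: "\<sigma> permutes {1..card X + card Y - 1}"
      "\<And>t. t \<in> labeled_trees V X \<Longrightarrow> relabel (rank ?Z) (subst (Leaf(a := s)) t) =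
        relabel \<sigma> (tree_comp ?i (relabel (rank X) t) ?s)"
      using standardize_graft_leaf[OF True Y comp_left.hyps(3,4)] comp_left.hyps(2) by metis
    have Z: "card ?Z = card X + card Y - 1"
      using card_Un_disjoint[of "X - {a}" Y] True Y comp_left.hyps(3,4) card_gt_0_iff[of X]
      by (auto simp: Int_commute)
    have i: "?i \<in> {1..card X}"
      using bij_betw_rank[OF True] comp_left.hyps(3) by (auto simp: bij_betw_def)
    have "linext (\<lambda>t. basis (subst (Leaf(a := s)) t)) f \<in> tree_space V ?Z"
      using comp_left.hyps tree_spaceD[OF f] by (auto intro!: tree_space_linext labeled_trees_graft_leaf)
    then have "to_free V (linext (\<lambda>t. basis (subst (Leaf(a := s)) t)) f) =
        iso_sum V (linext (\<lambda>t. basis (relabel (rank ?Z) (subst (Leaf(a := s)) t))) f)"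
      by (simp add: to_free_eq linext_linext)
    also have "\<dots> = iso_sum V (linext (\<lambda>t. basis (relabel \<sigma> (tree_comp ?i (relabel (rank X) t) ?s))) f)"
      using tree_spaceD[OF f] \<sigma>(2)
      by (intro arg_cong[of _ _ "iso_sum V"] linext_cong arg_cong[of _ _ basis]) auto
    also have "\<dots> = pact (free_operad V) (card X + card Y - 1) \<sigma>
        (pcomp (free_operad V) (card X) ?i (card Y) (to_free V f) (iso_sum V (basis ?s)))"
      by (simp add: to_free_eq[OF f] pact_iso_sum pcomp_iso_sum[OF V] comp_sum_def linext_linext)
    also have "(card X + card Y - 1, \<dots>) \<in> relation_ideal V R"
      using comp_left.IH i \<sigma>(1) labeled_trees_rank[OF comp_left.hyps(2)] unfolding relation_ideal_def
      by (intro operadic_ideal.act operadic_ideal.comp_left iso_sum_in_comps) auto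
    finally show ?thesis using Z by simp
  qed (simp add: tree_space_infinite[OF f] relation_ideal_zero)
next
  case (comp_right t X Y f a)
  note f = null_in_tree_space[OF comp_right.hyps(2)]
  show ?case
  proof (cases "finite Y")
    case True
    let ?Z = "X - {a} \<union> Y" and ?t = "relabel (rank X) t" and ?i = "rank X a"
    have X: "finite X" using labeled_treesD[OF comp_right.hyps(1)] by simp
    obtain \<sigma> where \<sigma>: "\<sigma> permutes {1..card X + card Y - 1}"
      "\<And>s. s \<in> labeled_trees V Y \<Longrightarrow> relabel (rank ?Z) (subst (Leaf(a := s)) t) =
        relabel \<sigma> (tree_comp ?i ?t (relabel (rank Y) s))"
      using standardize_graft_leaf[OF X True comp_right.hyps(3,4)] comp_right.hyps(1) by metis
    have Z: "card ?Z = card X + card Y - 1"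
      using card_Un_disjoint[of "X - {a}" Y] X True comp_right.hyps(3,4) card_gt_0_iff[of X]
      by (auto simp: Int_commute)
    have i: "?i \<in> {1..card X}"
      using bij_betw_rank[OF X] comp_right.hyps(3) by (auto simp: bij_betw_def)
    have "linext (\<lambda>s. basis (subst (Leaf(a := s)) t)) f \<in> tree_space V ?Z"
      using comp_right.hyps tree_spaceD[OF f] by (auto intro!: tree_space_linext labeled_trees_graft_leaf)
    then have "to_free V (linext (\<lambda>s. basis (subst (Leaf(a := s)) t)) f) =
        iso_sum V (linext (\<lambda>s. basis (relabel (rank ?Z) (subst (Leaf(a := s)) t))) f)"
      by (simp add: to_free_eq linext_linext)
    also have "\<dots> = iso_sum V (linext (\<lambda>s. basis (relabel \<sigma> (tree_comp ?i ?t (relabel (rank Y) s)))) f)"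
      using tree_spaceD[OF f] \<sigma>(2)
      by (intro arg_cong[of _ _ "iso_sum V"] linext_cong arg_cong[of _ _ basis]) auto
    also have "\<dots> = pact (free_operad V) (card X + card Y - 1) \<sigma>
        (pcomp (free_operad V) (card X) ?i (card Y) (iso_sum V (basis ?t)) (to_free V f))"
      by (simp add: to_free_eq[OF f] pact_iso_sum pcomp_iso_sum[OF V] comp_sum_def linext_linext)
    also have "(card X + card Y - 1, \<dots>) \<in> relation_ideal V R"
      using comp_right.IH i \<sigma>(1) labeled_trees_rank[OF comp_right.hyps(1)] unfolding relation_ideal_def
      by (intro operadic_ideal.act operadic_ideal.comp_right iso_sum_in_comps) auto
    finally show ?thesis using Z by simp
  qed (simp add: tree_space_infinite[OF f] relation_ideal_zero)
qed

section \<open>Partial composition as substitution\<close>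

definition comp_env :: "nat \<Rightarrow> nat \<Rightarrow> ('v tree \<Rightarrow>\<^sub>0 'k::field) \<Rightarrow> nat \<Rightarrow> ('v tree \<Rightarrow>\<^sub>0 'k)" where
  "comp_env i n g j = (if j < i then basis (Leaf j)
     else if j = i then linext (\<lambda>s. basis (relabel (\<lambda>k. k + i - 1) s)) g
     else basis (Leaf (j + n - 1)))"

definition comp_labels :: "nat \<Rightarrow> nat \<Rightarrow> nat \<Rightarrow> nat set" where
  "comp_labels i n j = (if j < i then {j} else if j = i then {i..<i + n} else {j + n - 1})"

text \<open>The family \<open>comp_env\<close> carries out the renumbering of
  \<open>tree_comp\<close>, which makes the properties of \<open>msubst\<close> available for
  partial compositions.\<close>

lemma comp_sum_eq_msubst:
  assumes f: "f \<in> tree_space V {1..m}" and g: "g \<in> tree_space V {1..n}" and i: "i \<in> {1..m}"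
  shows "comp_sum i f g = msubst (comp_env i n g) f"
  unfolding comp_sum_def msubst_def
proof (rule linext_cong)
  fix t assume "t \<in> Poly_Mapping.keys f"
  then have t: "t \<in> labeled_trees V {1..m}" by (rule tree_spaceD[OF f])
  \<comment> \<open>The value 0 at place \<open>i\<close> is a dummy, overwritten by the shifted
    \<open>g\<close> or by one of its terms.\<close>
  let ?e = "comp_env i n (0 :: 'a tree \<Rightarrow>\<^sub>0 'b)" and ?\<rho> = "\<lambda>k. k + i - 1"
  have e: "comp_env i n g = ?e(i := linext (\<lambda>s. basis (relabel ?\<rho> s)) g)"
    by (auto simp: comp_env_def)
  have "msubst_tree (comp_env i n g) t =
      linext (\<lambda>s. msubst_tree (?e(i := basis (relabel ?\<rho> s))) t) g"
    unfolding e msubst_tree_update'[OF t i, of ?e "linext _ g"] by (simp add: linext_linext)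
  also have "\<dots> = linext (\<lambda>s. basis (tree_comp i t s)) g"
  proof (rule linext_cong)
    fix s assume "s \<in> Poly_Mapping.keys g"
    then have "length (leaves s) = n"
      using length_leaves[OF tree_spaceD[OF g]] by simp
    then show "msubst_tree (?e(i := basis (relabel ?\<rho> s))) t = basis (tree_comp i t s)"
      unfolding tree_comp_def msubst_tree_basis[symmetric]
      by (intro msubst_tree_cong) (auto simp: comp_env_def)
  qed
  finally show "linext (\<lambda>s. basis (tree_comp i t s)) g = msubst_tree (comp_env i n g) t" ..
qed

lemma disjoint_comp_labels: "disjoint_family_on (comp_labels i n) {1..m}"
  by (auto simp: disjoint_family_on_def comp_labels_def)

lemma Union_comp_labels:
  assumes "i \<in> {1..m}"
  shows "(\<Union>j\<in>{1..m}. comp_labels i n j) = {1..m + n - 1}"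
proof
  show "(\<Union>j\<in>{1..m}. comp_labels i n j) \<subseteq> {1..m + n - 1}"
    using assms by (auto simp: comp_labels_def split: if_splits)
  show "{1..m + n - 1} \<subseteq> (\<Union>j\<in>{1..m}. comp_labels i n j)"
  proof
    fix k assume k: "k \<in> {1..m + n - 1}"
    consider "k < i" | "i \<le> k" "k < i + n" | "i + n \<le> k" by linarith
    then show "k \<in> (\<Union>j\<in>{1..m}. comp_labels i n j)"
    proof cases
      case 1
      then show ?thesis using k assms by (intro UN_I[of k]) (auto simp: comp_labels_def)
    next
      case 2
      then show ?thesis using assms by (intro UN_I[of i]) (auto simp: comp_labels_def)
    next
      case 3
      then show ?thesis using k assms by (intro UN_I[of "k + 1 - n"]) (auto simp: comp_labels_def)
    qed
  qed
qed

lemma image_shift_labels: "1 \<le> (i::nat) \<Longrightarrow> (\<lambda>k. k + i - 1) ` {1..n} = {i..<i + n}"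
proof
  assume "1 \<le> i"
  show "{i..<i + n} \<subseteq> (\<lambda>k. k + i - 1) ` {1..n}"
  proof
    fix x assume "x \<in> {i..<i + n}"
    then show "x \<in> (\<lambda>k. k + i - 1) ` {1..n}"
      using \<open>1 \<le> i\<close> by (intro image_eqI[of _ _ "x + 1 - i"]) auto
  qed
qed auto

lemma comp_env_in_tree_space:
  assumes g: "g \<in> tree_space V {1..n}" and i: "i \<in> {1..m}" and j: "j \<in> {1..m}"
  shows "comp_env i n g j \<in> tree_space V (comp_labels i n j)"
proof -
  have "linext (\<lambda>s. basis (relabel (\<lambda>k. k + i - 1) s)) g \<in> tree_space V ((\<lambda>k. k + i - 1) ` {1..n})"
    by (rule relabel_sum_in_tree_space[OF g]) (use i in \<open>auto simp: inj_on_def\<close>)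
  then show ?thesis
    using i j image_shift_labels[of i n] by (auto simp: comp_env_def comp_labels_def labeled_trees_Leaf)
qed

lemma comp_sum_in_tree_space:
  assumes f: "f \<in> tree_space V {1..m}" and g: "g \<in> tree_space V {1..n}" and i: "i \<in> {1..m}"
  shows "comp_sum i f g \<in> tree_space V {1..m + n - 1}"
  using msubst_in_tree_space[OF f comp_env_in_tree_space[OF g i] disjoint_comp_labels]
  unfolding comp_sum_eq_msubst[OF assms] Union_comp_labels[OF i] .

lemma null_comp_sum_left:
  assumes f: "null V R {1..m} f" and g: "g \<in> tree_space V {1..n}" and i: "i \<in> {1..m}"
  shows "null V R {1..m + n - 1} (comp_sum i f g)"
  using null_msubst_left[OF f comp_env_in_tree_space[OF g i] disjoint_comp_labels]
  unfolding comp_sum_eq_msubst[OF null_in_tree_space[OF f] g i] Union_comp_labels[OF i] .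

lemma null_comp_sum_right:
  assumes f: "f \<in> tree_space V {1..m}" and g: "null V R {1..n} g" and i: "i \<in> {1..m}"
  shows "null V R {1..m + n - 1} (comp_sum i f g)"
proof -
  note g' = null_in_tree_space[OF g]
  have "null V R ((\<lambda>k. k + i - 1) ` {1..n}) (linext (\<lambda>s. basis (relabel (\<lambda>k. k + i - 1) s)) g)"
    by (rule null.relabel[OF g]) (use i in \<open>auto simp: inj_on_def\<close>)
  then have "null V R (comp_labels i n i) (comp_env i n g i)"
    using i image_shift_labels[of i n] by (simp add: comp_env_def comp_labels_def)
  from null_msubst_right[OF f comp_env_in_tree_space[OF g' i] disjoint_comp_labels i this]
  show ?thesis
    unfolding comp_sum_eq_msubst[OF f g' i] Union_comp_labels[OF i] .
qed

lemma extend_comp_sum: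
  assumes L: "gen_map V W L" and f: "f \<in> tree_space V {1..m}" and g: "g \<in> tree_space V {1..n}"
    and i: "i \<in> {1..m}"
  shows "extend L (comp_sum i f g) = comp_sum i (extend L f) (extend L g)"
proof -
  have "(\<lambda>j. extend L (comp_env i n g j)) = comp_env i n (extend L g)"
    by (auto simp: comp_env_def extend_relabel[OF L g])
  then show ?thesis
    using comp_sum_eq_msubst[OF extend_in_tree_space[OF L f] extend_in_tree_space[OF L g] i]
    by (simp add: comp_sum_eq_msubst[OF f g i] extend_msubst[OF L f])
qed

lemma permutes_relabel:
  assumes "\<sigma> permutes {1..n::nat}"
  shows "inj_on \<sigma> {1..n}" "0 \<notin> \<sigma> ` {1..n}" "\<sigma> ` {1..n} = {1..n}"
  using permutes_inj_on[OF assms] permutes_image[OF assms] by auto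

text \<open>Every operation that generates the ideal lifts to planar sums. Local homogeneity
  provides a relation with one label set, along which all its terms are renumbered
  simultaneously.\<close>

lemma null_lift:
  assumes V: "is_smodule V" and R: "\<forall>r\<in>R. locally_homogeneous V r"
    and "(n, x) \<in> relation_ideal V R"
  shows "\<exists>f. null V R {1..n} f \<and> iso_sum V f = x"
  using assms(3) unfolding relation_ideal_def
proof (induction rule: operadic_ideal.induct)
  case (gen x n)
  then obtain r where r: "r \<in> R" "card (rel_Lin r) = n" "x = to_free V r" by auto
  show ?case
  proof (cases "r = 0")
    case True
    then show ?thesis using r by (intro exI[of _ 0]) (simp add: null.zero iso_sum_def)
  next
    case False
    obtain X where X: "r \<in> tree_space V X"
      using R r(1) by (auto simp: locally_homogeneous_def tree_space_def)
    obtain t where "t \<in> Poly_Mapping.keys r" using False by (metis ex_in_conv keys_eq_empty)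
    then have "rel_Lin r = X" "finite X"
      using tree_spaceD[OF X] by (auto simp: rel_Lin_def dest: labeled_treesD)
    moreover from this have "null V R (rank X ` X) (linext (\<lambda>t. basis (relabel (rank X) t)) r)"
      using r(1) X rank_pos bij_betw_rank[of X]
      by (intro null.relabel null.rel) (auto simp: bij_betw_def)
    ultimately show ?thesis
      using r(2,3) to_free_eq[OF X] bij_betw_rank[of X] by (auto simp: bij_betw_def)
  qed
next
  case (zero n)
  then show ?case by (intro exI[of _ 0]) (simp add: null.zero iso_sum_def free_operad_def)
next
  case (add n x y)
  then obtain f g where "null V R {1..n} f" "iso_sum V f = x" "null V R {1..n} g" "iso_sum V g = y"
    by blast
  then show ?case
    by (intro exI[of _ "f + g"]) (auto simp: null.add iso_sum_def linext_add free_operad_def)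
next
  case (smul n x c)
  then obtain f where "null V R {1..n} f" "iso_sum V f = x" by blast
  then show ?case
    by (intro exI[of _ "pscale c f"]) (auto simp: null.scale iso_sum_def linext_pscale free_operad_def)
next
  case (act n x \<sigma>)
  then obtain f where f: "null V R {1..n} f" "iso_sum V f = x" by blast
  then show ?case
    using null.relabel[OF f(1) permutes_relabel(1,2)[OF act.hyps(2)]] permutes_relabel(3)[OF act.hyps(2)]
    by (auto simp: pact_iso_sum[symmetric])
next
  case (comp_left m x y n i)
  then obtain f g where "null V R {1..m} f" "iso_sum V f = x"
    "g \<in> tree_space V {1..n}" "iso_sum V g = y"
    by (auto simp: comps_free_operad)
  then show ?case
    using null_comp_sum_left[of V R m f g n i] comp_left.hyps(3) by (auto simp: pcomp_iso_sum[OF V, symmetric])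
next
  case (comp_right x m n y i)
  then obtain f g where "f \<in> tree_space V {1..m}" "iso_sum V f = x"
    "null V R {1..n} g" "iso_sum V g = y"
    by (auto simp: comps_free_operad)
  then show ?case
    using null_comp_sum_right[of f V m R n g i] comp_right.hyps(3) by (auto simp: pcomp_iso_sum[OF V, symmetric])
qed

lemma iso_sum_diff: "iso_sum V (f - g) = iso_sum V f - iso_sum V g"
  by (simp add: iso_sum_def linext_diff)

text \<open>For the converse, a null lift of \<open>iso_sum V f\<close> differs from
  \<open>f\<close> by an element of the kernel of \<open>iso_sum\<close>, which is null as
  well.\<close>

lemma null_iff:
  assumes V: "is_smodule V" and R: "\<forall>r\<in>R. locally_homogeneous V r"
    and f: "f \<in> tree_space V {1..n}"
  shows "null V R {1..n} f \<longleftrightarrow> (n, iso_sum V f) \<in> relation_ideal V R"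
proof
  assume "null V R {1..n} f"
  then show "(n, iso_sum V f) \<in> relation_ideal V R"
    using null_in_relation_ideal[OF V] to_free_atLeastAtMost[OF f] by fastforce
next
  assume "(n, iso_sum V f) \<in> relation_ideal V R"
  then obtain g where g: "null V R {1..n} g" "iso_sum V g = iso_sum V f"
    using null_lift[OF V R] by blast
  have "null V R {1..n} (f - g)"
    using g f null_in_tree_space[OF g(1)]
    by (intro iso_sum_eq_zero_null[OF V]) (auto intro: tree_space_diff simp: iso_sum_diff)
  from null.add[OF this g(1)] show "null V R {1..n} f" by simp
qed

section \<open>Operations on classes of planar sums\<close>

definition cls :: "'v smodule \<Rightarrow> ('v tree \<Rightarrow>\<^sub>0 'k::field) set \<Rightarrow> nat \<Rightarrow> ('v tree \<Rightarrow>\<^sub>0 'k) \<Rightarrow> ('v tree set \<Rightarrow>\<^sub>0 'k) set"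
  where "cls V R n f = class_of V R n (iso_sum V f)"

lemma class_of_eq_iff:
  "class_of V R n x = class_of V R n y \<longleftrightarrow> (n, x - y) \<in> relation_ideal V R"
proof
  assume "class_of V R n x = class_of V R n y"
  moreover have "x \<in> class_of V R n x"
    unfolding class_of_def coset_def free_operad_def using relation_ideal_zero[of n V R]
    by (auto intro!: exI[of _ "0 :: _ \<Rightarrow>\<^sub>0 _"])
  ultimately obtain j where "x = y + j" "(n, j) \<in> relation_ideal V R"
    by (auto simp: class_of_def coset_def free_operad_def)
  then show "(n, x - y) \<in> relation_ideal V R" by simp
next
  assume d: "(n, x - y) \<in> relation_ideal V R"
  have "z \<in> class_of V R n x \<longleftrightarrow> (n, z - x) \<in> relation_ideal V R" for x z
    unfolding class_of_def coset_def free_operad_def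
    by (auto intro!: exI[of _ "z - x"])
  moreover have "(n, z - x) \<in> relation_ideal V R \<longleftrightarrow> (n, z - y) \<in> relation_ideal V R" for z
    using relation_ideal_add[OF _ d, of "z - x"] relation_ideal_diff[OF _ d, of "z - y"] by auto
  ultimately show "class_of V R n x = class_of V R n y" by auto
qed

lemma cls_eq_iff:
  assumes "is_smodule V" "\<forall>r\<in>R. locally_homogeneous V r"
    and "f \<in> tree_space V {1..n}" "g \<in> tree_space V {1..n}"
  shows "cls V R n f = cls V R n g \<longleftrightarrow> null V R {1..n} (f - g)"
  using null_iff[OF assms(1,2) tree_space_diff[OF assms(3,4)]]
  by (simp add: cls_def class_of_eq_iff iso_sum_diff)

lemma mem_class_of: "z \<in> class_of V R n x \<longleftrightarrow> (n, z - x) \<in> relation_ideal V R"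
  unfolding class_of_def coset_def free_operad_def
  by (auto intro!: exI[of _ "z - x"])

lemma class_of_self: "x \<in> class_of V R n x"
  by (simp add: mem_class_of relation_ideal_zero)

lemma comps_presented: "comps (presented_operad V R) n = cls V R n ` tree_space V {1..n}"
  by (simp add: presented_operad_def quotient_operad_def cls_def[abs_def] class_of_def comps_free_operad image_image)

text \<open>Results for different representatives differ by an element of the ideal, so the union of
  cosets is a single coset. The next three operations follow the same pattern.\<close>

lemma padd_cls: "padd (presented_operad V R) n (cls V R n f) (cls V R n g) = cls V R n (f + g)"
proof -
  have "(\<Union>a\<in>cls V R n f. \<Union>b\<in>cls V R n g. class_of V R n (a + b)) = cls V R n (f + g)"
    unfolding cls_def
  proof (intro Union_constant)
    fix a b assume "a \<in> class_of V R n (iso_sum V f)" "b \<in> class_of V R n (iso_sum V g)"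
    then have "(n, (a - iso_sum V f) + (b - iso_sum V g)) \<in> relation_ideal V R"
      by (simp add: mem_class_of relation_ideal_add)
    then show "class_of V R n (a + b) = class_of V R n (iso_sum V (f + g))"
      by (simp add: class_of_eq_iff iso_sum_def linext_add algebra_simps)
  qed (use class_of_self in blast)+
  then show ?thesis
    by (simp add: presented_operad_def quotient_operad_def class_of_def[symmetric])
      (simp add: free_operad_def)
qed

lemma psmul_cls: "psmul (presented_operad V R) n c (cls V R n f) = cls V R n (pscale c f)"
proof -
  have "(\<Union>a\<in>cls V R n f. class_of V R n (pscale c a)) = cls V R n (pscale c f)"
    unfolding cls_def
  proof (intro Union_constant)
    fix a assume "a \<in> class_of V R n (iso_sum V f)"
    then have "(n, pscale c (a - iso_sum V f)) \<in> relation_ideal V R"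
      by (simp add: mem_class_of relation_ideal_scale)
    moreover have "pscale c (a - iso_sum V f) = pscale c a - iso_sum V (pscale c f)"
      by (rule poly_mapping_eqI) (simp add: iso_sum_def linext_pscale lookup_minus algebra_simps)
    ultimately show "class_of V R n (pscale c a) = class_of V R n (iso_sum V (pscale c f))"
      by (simp add: class_of_eq_iff)
  qed (use class_of_self in blast)+
  then show ?thesis
    by (simp add: presented_operad_def quotient_operad_def class_of_def[symmetric])
      (simp add: free_operad_def)
qed

lemma pact_cls:
  assumes "\<sigma> permutes {1..n}"
  shows "pact (presented_operad V R) n \<sigma> (cls V R n f) =
    cls V R n (linext (\<lambda>t. basis (relabel \<sigma> t)) f)"
proof -
  have "(\<Union>a\<in>cls V R n f. class_of V R n (pact (free_operad V) n \<sigma> a)) =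
      cls V R n (linext (\<lambda>t. basis (relabel \<sigma> t)) f)"
    unfolding cls_def
  proof (intro Union_constant)
    fix a assume "a \<in> class_of V R n (iso_sum V f)"
    then have "(n, pact (free_operad V) n \<sigma> (a - iso_sum V f)) \<in> relation_ideal V R"
      using assms by (simp add: mem_class_of relation_ideal_def operadic_ideal.act)
    moreover have "pact (free_operad V) n \<sigma> (a - iso_sum V f) =
        pact (free_operad V) n \<sigma> a - pact (free_operad V) n \<sigma> (iso_sum V f)"
      by (simp add: free_operad_def linext_diff)
    ultimately show "class_of V R n (pact (free_operad V) n \<sigma> a) =
        class_of V R n (iso_sum V (linext (\<lambda>t. basis (relabel \<sigma> t)) f))"
      by (simp add: class_of_eq_iff pact_iso_sum)
  qed (use class_of_self in blast)+
  then show ?thesis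
    by (simp add: presented_operad_def quotient_operad_def class_of_def[symmetric])
qed

lemma pcomp_cls:
  assumes V: "is_smodule V" and R: "\<forall>r\<in>R. locally_homogeneous V r"
    and f: "f \<in> tree_space V {1..m}" and g: "g \<in> tree_space V {1..n}" and i: "i \<in> {1..m}"
  shows "pcomp (presented_operad V R) m i n (cls V R m f) (cls V R n g) =
    cls V R (m + n - 1) (comp_sum i f g)"
proof -
  let ?c = "pcomp (free_operad V) m i n" and ?I = "relation_ideal V R"
  have "(\<Union>a\<in>cls V R m f. \<Union>b\<in>cls V R n g. class_of V R (m + n - 1) (?c a b)) =
      cls V R (m + n - 1) (comp_sum i f g)"
    unfolding cls_def
  proof (intro Union_constant)
    fix a b assume a: "a \<in> class_of V R m (iso_sum V f)" and b: "b \<in> class_of V R n (iso_sum V g)"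
    obtain g' where g': "null V R {1..n} g'" "iso_sum V g' = b - iso_sum V g"
      using null_lift[OF V R] b by (auto simp: mem_class_of)
    \<comment> \<open>Left composition with the ideal asks for \<open>b\<close> to lie in the free
      operad; the null lift \<open>g'\<close> shows that the coset does not leave it.\<close>
    have "b = iso_sum V (g + g')" using g' by (simp add: iso_sum_def linext_add)
    then have "b \<in> comps (free_operad V) n"
      using g null_in_tree_space[OF g'(1)] by (auto intro!: iso_sum_in_comps tree_space_add)
    then have "(m + n - 1, ?c (a - iso_sum V f) b) \<in> ?I"
      using a i unfolding mem_class_of relation_ideal_def by (intro operadic_ideal.comp_left)
    moreover have "(m + n - 1, ?c (iso_sum V f) (b - iso_sum V g)) \<in> ?I"
      using b i iso_sum_in_comps[OF f] unfolding mem_class_of relation_ideal_def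
      by (intro operadic_ideal.comp_right)
    ultimately have "(m + n - 1, ?c (a - iso_sum V f) b + ?c (iso_sum V f) (b - iso_sum V g)) \<in> ?I"
      by (rule relation_ideal_add)
    \<comment> \<open>Bilinearity splits the error into a change of the left factor and a change of
      the right one, each covered by its own closure rule of the ideal.\<close>
    moreover have "?c (a - iso_sum V f) b + ?c (iso_sum V f) (b - iso_sum V g) =
        ?c a b - ?c (iso_sum V f) (iso_sum V g)"
      by (simp add: free_operad_def linext_diff linext_fun_diff)
    ultimately show "class_of V R (m + n - 1) (?c a b) =
        class_of V R (m + n - 1) (iso_sum V (comp_sum i f g))"
      by (simp add: class_of_eq_iff pcomp_iso_sum[OF V])
  qed (use class_of_self in blast)+
  then show ?thesis
    by (simp add: presented_operad_def quotient_operad_def class_of_def[symmetric])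
qed

lemma punit_cls: "punit (presented_operad V R) = cls V R 1 (basis (Leaf 1))"
  by (simp add: presented_operad_def quotient_operad_def class_of_def[symmetric])
    (simp add: free_operad_def cls_def iso_sum_def)

abbreviation corolla :: "nat \<Rightarrow> 'v \<Rightarrow> 'v tree" where
  "corolla n \<omega> \<equiv> Node \<omega> (map Leaf [1..<Suc n])"

lemma generator_eq: "generator V n \<omega> = iso_sum V (basis (corolla n \<omega>))"
  by (simp add: generator_def iso_sum_def)

section \<open>Morphisms out of a presented operad\<close>

lemma comp_sum_basis: "comp_sum i (basis t) (basis s) = basis (tree_comp i t s)"
  by (simp add: comp_sum_def)

lemma tree_comp_in_labeled_trees:
  assumes "t \<in> labeled_trees V {1..m}" "s \<in> labeled_trees V {1..n}" "i \<in> {1..m}"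
  shows "tree_comp i t s \<in> labeled_trees V {1..m + n - 1}"
  using comp_sum_in_tree_space[of "basis t" V m "basis s" n i] assms
  by (simp only: comp_sum_basis basis_in_tree_space)

lemma gen_pos: "is_smodule V \<Longrightarrow> \<omega> \<in> gens V n \<Longrightarrow> n \<noteq> 0"
  unfolding is_smodule_def by (metis empty_iff)

lemma concat_map_leaves_Leaf: "concat (map leaves (map Leaf xs)) = xs"
  by (induction xs) simp_all

lemma labeled_trees_Node_Leaf:
  "Node \<omega> (map Leaf xs) \<in> labeled_trees V X \<longleftrightarrow>
    xs \<noteq> [] \<and> \<omega> \<in> gens V (length xs) \<and> distinct xs \<and> set xs = X \<and> 0 \<notin> X"
  unfolding labeled_trees_def mem_Collect_eq Lin_def decorated.simps leaves.simps concat_map_leaves_Leaf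
  by (auto simp: list_all_iff)

lemma corolla_labeled:
  assumes "is_smodule V" "\<omega> \<in> gens V n"
  shows "corolla n \<omega> \<in> labeled_trees V {1..n}"
  using gen_pos[OF assms] assms(2) unfolding labeled_trees_Node_Leaf by auto

lemma relabel_corolla: "relabel \<sigma> (corolla n \<omega>) = Node \<omega> (map (\<lambda>i. Leaf (\<sigma> i)) [1..<Suc n])"
  by (simp add: relabel_def)

lemma extend_tree_corolla:
  assumes L: "gen_map V W L" and \<omega>: "\<omega> \<in> gens V n"
  shows "extend_tree L (corolla n \<omega>) = L n \<omega>"
proof -
  have "extend_tree L (corolla n \<omega>) = msubst (\<lambda>a. basis (Leaf a)) (L n \<omega>)"
    unfolding extend_tree.simps by (auto intro!: msubst_cong_space[OF gen_mapD[OF L \<omega>]] simp del: upt_Suc)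
  then show ?thesis by (simp add: msubst_basis)
qed

text \<open>The reordering rule with leaves as children: permuting the inputs of
  \<open>\<omega>\<close> only permutes leaf labels.\<close>

lemma null_corolla:
  assumes V: "is_smodule V" and \<omega>: "\<omega> \<in> gens V n" and \<sigma>: "\<sigma> permutes {1..n}"
  shows "null V R {1..n} (basis (corolla n (gact V n \<sigma> \<omega>)) - basis (relabel \<sigma> (corolla n \<omega>)))"
proof (rule null.iso)
  have "gact V n \<sigma> \<omega> \<in> gens V n" using V \<omega> \<sigma> unfolding is_smodule_def by blast
  then show "corolla n (gact V n \<sigma> \<omega>) \<in> labeled_trees V {1..n}" by (rule corolla_labeled[OF V])
  show "relabel \<sigma> (corolla n \<omega>) \<in> labeled_trees V {1..n}"
    using labeled_trees_relabel[OF corolla_labeled[OF V \<omega>]] permutes_relabel[OF \<sigma>] by metis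
  have "Node \<omega> (map (\<lambda>i. map Leaf [1..<Suc n] ! (\<sigma> i - 1)) [1..<Suc n]) = relabel \<sigma> (corolla n \<omega>)"
    unfolding relabel_corolla
  proof (rule arg_cong[of _ _ "Node \<omega>"], rule map_cong[OF HOL.refl])
    fix i assume "i \<in> set [1..<Suc n]"
    then have "i \<in> {1..n}" by auto
    then have "\<sigma> i \<in> {1..n}" using permutes_in_image[OF \<sigma>] by blast
    then show "map Leaf [1..<Suc n] ! (\<sigma> i - 1) = Leaf (\<sigma> i)" by (auto simp del: upt_Suc)
  qed
  moreover have "tree_iso V (corolla n (gact V n \<sigma> \<omega>))
      (Node \<omega> (map (\<lambda>i. map Leaf [1..<Suc n] ! (\<sigma> i - 1)) [1..<Suc n]))"
    by (rule tree_iso.reorder[OF _ \<omega> \<sigma>]) simp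
  ultimately show "tree_iso V (corolla n (gact V n \<sigma> \<omega>)) (relabel \<sigma> (corolla n \<omega>))"
    by (simp only:)
qed

text \<open>Measure for \<open>morphism_on_tree\<close>. The trivial tree counts 0, so cutting off a
  nontrivial subtree below the root leaves two strictly smaller pieces.\<close>

primrec nodes :: "'v tree \<Rightarrow> nat" where
  "nodes (Leaf a) = 0"
| "nodes (Node \<omega> ts) = Suc (sum_list (map nodes ts))"

lemma nodes_relabel [simp]: "nodes (relabel \<rho> t) = nodes t"
  by (induction t) (simp_all add: relabel_def comp_def cong: map_cong)

lemma nonleaf_nodes_pos: "(\<nexists>a. s = Leaf a) \<Longrightarrow> 0 < nodes s"
  by (cases s) auto

lemma operad_morphismD:
  assumes "operad_morphism P Q f"
  shows "x \<in> comps P n \<Longrightarrow> f n x \<in> comps Q n"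
    and "x \<in> comps P n \<Longrightarrow> y \<in> comps P n \<Longrightarrow> f n (padd P n x y) = padd Q n (f n x) (f n y)"
    and "x \<in> comps P n \<Longrightarrow> f n (psmul P n c x) = psmul Q n c (f n x)"
    and "\<sigma> permutes {1..n} \<Longrightarrow> x \<in> comps P n \<Longrightarrow> f n (pact P n \<sigma> x) = pact Q n \<sigma> (f n x)"
    and "i \<in> {1..m} \<Longrightarrow> x \<in> comps P m \<Longrightarrow> y \<in> comps P n \<Longrightarrow>
      f (m + n - 1) (pcomp P m i n x y) = pcomp Q m i n (f m x) (f n y)"
    and "f 1 (punit P) = punit Q"
  using assms unfolding operad_morphism_def by blast+

text \<open>Two presentations and planar images of the generators, without any compatibility with
  the relations. The same context thus serves to compute a given morphism from its values on
  generators and to construct one; it is used for \<eta>, for \<alpha> and for the induced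
  morphism.\<close>

locale presented_pair =
  fixes V :: "'v smodule" and W :: "'w smodule"
    and R :: "('v tree \<Rightarrow>\<^sub>0 'k::field) set" and R' :: "('w tree \<Rightarrow>\<^sub>0 'k) set"
    and L :: "nat \<Rightarrow> 'v \<Rightarrow> ('w tree \<Rightarrow>\<^sub>0 'k)"
  assumes V: "is_smodule V" and W: "is_smodule W"
    and R: "\<forall>r\<in>R. locally_homogeneous V r" and R': "\<forall>r\<in>R'. locally_homogeneous W r"
    and L: "gen_map V W L"
begin

abbreviation "P \<equiv> presented_operad V R"
abbreviation "Q \<equiv> presented_operad W R'"

lemma cls_in_comps: "f \<in> tree_space V {1..n} \<Longrightarrow> cls V R n f \<in> comps P n"
  by (simp add: comps_presented)

lemma morphism_on_relabel:
  assumes \<phi>: "operad_morphism P Q \<phi>" and \<sigma>: "\<sigma> permutes {1..n}" and t: "t \<in> labeled_trees V {1..n}"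
    and eq: "\<phi> n (cls V R n (basis t)) = cls W R' n (extend_tree L t)"
  shows "\<phi> n (cls V R n (basis (relabel \<sigma> t))) = cls W R' n (extend_tree L (relabel \<sigma> t))"
proof -
  have "cls V R n (basis (relabel \<sigma> t)) = pact P n \<sigma> (cls V R n (basis t))"
    using pact_cls[OF \<sigma>, of V R "basis t"] by simp
  then have "\<phi> n (cls V R n (basis (relabel \<sigma> t))) = pact Q n \<sigma> (cls W R' n (extend_tree L t))"
    using operad_morphismD(4)[OF \<phi> \<sigma>] cls_in_comps[of "basis t"] t eq by simp
  then show ?thesis
    using extend_relabel[OF L, of "basis t" "{1..n}" \<sigma>] t by (simp add: pact_cls[OF \<sigma>])
qed

text \<open>Trees are built from the unit and the corollas by partial compositions and permutations,
  all of which \<open>\<phi>\<close> preserves. A tree with a nontrivial child is, up to a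
  permutation, the composite of the tree with that child cut off and the child itself.\<close>

lemma morphism_on_tree:
  assumes \<phi>: "operad_morphism P Q \<phi>"
    and gen: "\<And>n \<omega>. \<omega> \<in> gens V n \<Longrightarrow> \<phi> n (class_of V R n (generator V n \<omega>)) = cls W R' n (L n \<omega>)"
  shows "t \<in> labeled_trees V {1..n} \<Longrightarrow> \<phi> n (cls V R n (basis t)) = cls W R' n (extend_tree L t)"
proof (induction t arbitrary: n rule: measure_induct_rule[where f = nodes])
  case (less t)
  show ?case
  proof (cases t)
    case (Leaf a)
    then have "{a} = {1..n}" using labeled_treesD(3)[OF less.prems] by simp
    then have "a = 1" "n = 1" by (metis atLeastAtMost_singleton_iff atLeastatMost_empty_iff2 atLeastAtMost_iff insert_not_empty singleton_iff order_refl)+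
    then show ?thesis
      using operad_morphismD(6)[OF \<phi>] Leaf by (simp add: punit_cls)
  next
    case (Node \<omega> ts)
    note ts = labeled_trees_NodeD[OF less.prems[unfolded Node]]
    show ?thesis
    proof (cases "\<forall>u\<in>set ts. \<exists>a. u = Leaf a")
      case True
      then obtain h where "\<forall>u\<in>set ts. u = Leaf (h u)" by metis
      then have "ts = map Leaf (map h ts)" by (auto simp: map_idI comp_def)
      then obtain xs where xs: "ts = map Leaf xs" by blast
      then have *: "xs \<noteq> []" "\<omega> \<in> gens V (length xs)" "distinct xs" "set xs = {1..n}"
        using less.prems by (simp_all add: Node labeled_trees_Node_Leaf)
      then have len: "length xs = n" using distinct_card[of xs] by simp
      \<comment> \<open>All children are leaves, so \<open>t\<close> is a standard corolla acted
        upon by the permutation that reads off its labels.\<close>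
      let ?\<sigma> = "\<lambda>i. if i \<in> {1..n} then xs ! (i - 1) else i"
      have "inj_on ?\<sigma> {1..n}"
        using *(3) len by (auto simp: inj_on_def nth_eq_iff_index_eq)
      moreover have "?\<sigma> ` {1..n} \<subseteq> {1..n}"
      proof (rule image_subsetI)
        fix i assume i: "i \<in> {1..n}"
        then have "xs ! (i - 1) \<in> set xs" using len by (intro nth_mem) auto
        then show "?\<sigma> i \<in> {1..n}" using i *(4) by simp
      qed
      ultimately have "bij_betw ?\<sigma> {1..n} {1..n}"
        unfolding bij_betw_def by (intro conjI endo_inj_surj) simp_all
      then have \<sigma>: "?\<sigma> permutes {1..n}"
        by (rule bij_imp_permutes) auto
      have "map (\<lambda>i. Leaf (?\<sigma> i)) [1..<Suc n] = ts"
        unfolding xs by (rule nth_equalityI) (auto simp: len simp del: upt_Suc)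
      then have t: "t = relabel ?\<sigma> (corolla n \<omega>)"
        by (simp only: relabel_corolla Node)
      have \<omega>: "\<omega> \<in> gens V n" using * len by simp
      show ?thesis
        unfolding t
      proof (rule morphism_on_relabel[OF \<phi> \<sigma> corolla_labeled[OF V \<omega>]])
        show "\<phi> n (cls V R n (basis (corolla n \<omega>))) = cls W R' n (extend_tree L (corolla n \<omega>))"
          using gen[OF \<omega>] unfolding extend_tree_corolla[OF L \<omega>] generator_eq cls_def .
      qed
    next
      case False
      then obtain j where j: "j < length ts" "\<nexists>a. ts ! j = Leaf a"
        by (metis in_set_conv_nth)
      let ?s = "ts ! j"
      have s: "?s \<in> labeled_trees V (Lin ?s)" using ts(2)[OF j(1)] .
      \<comment> \<open>A label of the subtree also serves as label of the cut edge: it occurs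
        nowhere else in \<open>t\<close>, so no fresh label is needed and regrafting restores
        \<open>t\<close> literally.\<close>
      obtain a where a: "a \<in> Lin ?s"
        using s by (metis equals0D ex_in_conv labeled_trees_empty)
      let ?t = "Node \<omega> (ts[j := Leaf a])"
      let ?X = "{1..n} - Lin ?s \<union> {a}"
      have sub: "Lin ?s \<subseteq> {1..n}"
        using labeled_treesD(3)[OF less.prems] j(1) by (auto simp: Node)
      have other: "Lin (ts ! i) \<inter> Lin ?s = {}" if "i < length ts" "i \<noteq> j" for i
        using distinct_concat_map_disjoint[of leaves ts i j] labeled_treesD(2)[OF less.prems] that j(1)
        by (simp add: Node Lin_def)
      have sub_t: "subst (Leaf(a := ?s)) ?t = t"
      proof -
        have "map (subst (Leaf(a := ?s))) (ts[j := Leaf a]) = ts"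
        proof (rule nth_equalityI)
          fix i assume i: "i < length (map (subst (Leaf(a := ?s))) (ts[j := Leaf a]))"
          show "map (subst (Leaf(a := ?s))) (ts[j := Leaf a]) ! i = ts ! i"
          proof (cases "i = j")
            case False
            then have "a \<notin> Lin (ts ! i)" using other[of i] a i by auto
            then have "subst (Leaf(a := ?s)) (ts ! i) = subst Leaf (ts ! i)"
              by (intro subst_cong) auto
            then show ?thesis using False i by simp
          qed (use j in simp)
        qed simp
        then show ?thesis by (simp add: Node)
      qed
      have t': "?t \<in> labeled_trees V ?X"
      proof -
        have "Lin ?t = ?X"
        proof
          show "Lin ?t \<subseteq> ?X"
          proof
            fix x assume "x \<in> Lin ?t"
            then obtain i where i: "i < length ts" "x \<in> Lin (ts[j := Leaf a] ! i)"
              by (auto simp: in_set_conv_nth)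
            then show "x \<in> ?X"
              using other[of i] labeled_treesD(3)[OF less.prems] by (cases "i = j") (auto simp: Node)
          qed
          have "Lin t \<subseteq> Lin ?t \<union> Lin ?s"
            by (subst sub_t[symmetric]) (auto simp: Lin_subst split: if_splits)
          moreover have "a \<in> Lin ?t" using j(1) by (auto intro!: bexI[of _ "Leaf a"] set_update_memI)
          ultimately show "?X \<subseteq> Lin ?t"
            using labeled_treesD(3)[OF less.prems] by auto
        qed
        moreover have "distinct (leaves ?t)"
          unfolding leaves.simps
        proof -
          let ?us = "ts[j := Leaf a]"
          have "distinct (concat (map (\<lambda>i. leaves (?us ! i)) [0..<length ?us]))"
          proof (rule distinct_concat_mapI)
            fix i assume "i \<in> set [0..<length ?us]"
            then show "distinct (leaves (?us ! i))"
              using labeled_treesD(2)[OF ts(2), of i] by (cases "i = j") simp_all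
          next
            show "disjoint_family_on (\<lambda>i. set (leaves (?us ! i))) (set [0..<length ?us])"
              unfolding disjoint_family_on_def Lin_def[symmetric]
            proof (intro ballI impI)
              fix i k assume ik: "i \<in> set [0..<length ?us]" "k \<in> set [0..<length ?us]" "i \<noteq> k"
              show "Lin (?us ! i) \<inter> Lin (?us ! k) = {}"
                using ik a j(1) other[of i] other[of k]
                  distinct_concat_map_disjoint[of leaves ts i k] labeled_treesD(2)[OF less.prems]
                by (cases "i = j"; cases "k = j") (auto simp: Node Lin_def)
            qed
          qed simp
          moreover have "map (\<lambda>i. leaves (?us ! i)) [0..<length ?us] = map leaves ?us"
            by (rule nth_equalityI) simp_all
          ultimately show "distinct (concat (map leaves ?us))" by (simp only:)
        qed
        moreover have "decorated V ?t"
          using labeled_treesD(1)[OF less.prems] by (simp add: Node list_all_iff) (auto dest!: set_update_subset_insert[THEN subsetD])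
        ultimately show ?thesis
          using sub labeled_treesD(4)[OF less.prems] a by (auto simp: labeled_trees_def)
      qed
      have less_nodes: "nodes ?s < nodes t" "nodes ?t < nodes t"
      proof -
        have le: "nodes ?s \<le> sum_list (map nodes ts)"
          using elem_le_sum_list[of j "map nodes ts"] j(1) by simp
        then show "nodes ?s < nodes t" by (simp add: Node)
        show "nodes ?t < nodes t"
          using j le nonleaf_nodes_pos[OF j(2)] by (simp add: Node map_update sum_list_update)
      qed
      have fin: "finite ?X" "finite (Lin ?s)" by auto
      have aX: "a \<in> ?X" by simp
      have disj: "Lin ?s \<inter> (?X - {a}) = {}" by auto
      have union: "?X - {a} \<union> Lin ?s = {1..n}" using a sub by auto
      let ?m = "card ?X" and ?k = "card (Lin ?s)" and ?i = "rank ?X a"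
      let ?std_t = "relabel (rank ?X) ?t" and ?std_s = "relabel (rank (Lin ?s)) ?s"
      obtain \<sigma> where \<sigma>: "\<sigma> permutes {1..?m + ?k - 1}"
        "relabel (rank {1..n}) t = relabel \<sigma> (tree_comp ?i ?std_t ?std_s)"
        using standardize_graft_leaf[OF fin aX disj] t' s unfolding union by (metis sub_t)
      have n: "?m + ?k - 1 = n"
      proof -
        have "card (?X - {a} \<union> Lin ?s) = card (?X - {a}) + ?k"
          by (rule card_Un_disjoint) auto
        moreover have "card (?X - {a}) = ?m - 1" using aX by (rule card_Diff_singleton)
        moreover have "0 < ?m" using fin(1) aX by (auto simp: card_gt_0_iff)
        ultimately show ?thesis unfolding union by simp
      qed
      have i: "?i \<in> {1..?m}"
        using bij_betw_rank[OF fin(1)] aX by (auto simp: bij_betw_def)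
      have t0: "?std_t \<in> labeled_trees V {1..?m}" and s0: "?std_s \<in> labeled_trees V {1..?k}"
        using labeled_trees_rank t' s by blast+
      note t0' = basis_in_tree_space[THEN iffD2, OF t0] and s0' = basis_in_tree_space[THEN iffD2, OF s0]
      have IH: "\<phi> ?m (cls V R ?m (basis ?std_t)) = cls W R' ?m (extend_tree L ?std_t)"
        "\<phi> ?k (cls V R ?k (basis ?std_s)) = cls W R' ?k (extend_tree L ?std_s)"
        using less.IH[OF _ t0] less.IH[OF _ s0] less_nodes by simp_all
      have "\<phi> n (cls V R n (basis (tree_comp ?i ?std_t ?std_s))) =
          \<phi> (?m + ?k - 1) (pcomp P ?m ?i ?k (cls V R ?m (basis ?std_t)) (cls V R ?k (basis ?std_s)))"
        unfolding n pcomp_cls[OF V R t0' s0' i]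
          comp_sum_basis ..
      also have "\<dots> = pcomp Q ?m ?i ?k (cls W R' ?m (extend_tree L ?std_t)) (cls W R' ?k (extend_tree L ?std_s))"
        using operad_morphismD(5)[OF \<phi> i cls_in_comps[OF t0'] cls_in_comps[OF s0']]
        unfolding IH .
      also have "\<dots> = cls W R' n (comp_sum ?i (extend_tree L ?std_t) (extend_tree L ?std_s))"
        using pcomp_cls[OF W R' extend_tree_in_tree_space[OF L t0] extend_tree_in_tree_space[OF L s0] i] n
        by simp
      also have "\<dots> = cls W R' n (extend_tree L (tree_comp ?i ?std_t ?std_s))"
        using extend_comp_sum[OF L, of "basis ?std_t" ?m "basis ?std_s" ?k ?i] t0 s0 i
        by (simp add: comp_sum_basis)
      finally have "\<phi> n (cls V R n (basis (relabel \<sigma> (tree_comp ?i ?std_t ?std_s)))) =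
          cls W R' n (extend_tree L (relabel \<sigma> (tree_comp ?i ?std_t ?std_s)))"
        using tree_comp_in_labeled_trees[OF t0 s0 i] \<sigma>(1) n
        by (intro morphism_on_relabel[OF \<phi>]) simp_all
      \<comment> \<open>The leaves of \<open>t\<close> are numbered 1 to \<open>n\<close>, so
        standardizing does not change it.\<close>
      moreover have "t = relabel \<sigma> (tree_comp ?i ?std_t ?std_s)"
        using \<sigma>(2) labeled_trees_rank_id[OF less.prems] by simp
      ultimately show ?thesis by simp
    qed
  qed
qed

lemma morphism_on_tree_space:
  assumes \<phi>: "operad_morphism P Q \<phi>"
    and gen: "\<And>n \<omega>. \<omega> \<in> gens V n \<Longrightarrow> \<phi> n (class_of V R n (generator V n \<omega>)) = cls W R' n (L n \<omega>)"
    and f: "f \<in> tree_space V {1..n}"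
  shows "\<phi> n (cls V R n f) = cls W R' n (extend L f)"
proof -
  let ?S = "{f \<in> tree_space V {1..n}. \<phi> n (cls V R n f) = cls W R' n (extend L f)}"
  \<comment> \<open>The class of 0 is written as a scalar multiple by 0, since preservation of
    \<open>pzero\<close> is not a clause of \<open>operad_morphism\<close>.\<close>
  have "\<phi> n (cls V R n 0) = cls W R' n 0"
    using operad_morphismD(3)[OF \<phi> cls_in_comps[OF tree_space_zero], of n 0]
      operad_morphismD(1)[OF \<phi> cls_in_comps[OF tree_space_zero], of n]
    by (auto simp: psmul_cls comps_presented)
  moreover have "\<phi> n (cls V R n (f + g)) = cls W R' n (extend L (f + g))" if "f \<in> ?S" "g \<in> ?S" for f g
    using that operad_morphismD(2)[OF \<phi>, of "cls V R n f" n "cls V R n g"] cls_in_comps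
    by (simp add: padd_cls extend_def linext_add)
  moreover have "\<phi> n (cls V R n (pscale c f)) = cls W R' n (extend L (pscale c f))" if "f \<in> ?S" for c f
    using that operad_morphismD(3)[OF \<phi>, of "cls V R n f" n c] cls_in_comps
    by (simp add: psmul_cls extend_def linext_pscale)
  ultimately have "lin_closed ?S"
    by (simp add: lin_closed_def tree_space_zero tree_space_add tree_space_pscale extend_def)
  then have "linext basis f \<in> ?S"
  proof (rule lin_closed_linext)
    fix t assume "t \<in> Poly_Mapping.keys f"
    then show "basis t \<in> ?S"
      using morphism_on_tree[OF \<phi> gen] tree_spaceD[OF f] by simp
  qed
  then show ?thesis by simp
qed

text \<open>\<open>\<phi>\<close> takes one value on each class, so sums in the class of 0 must have
  images in the class of 0. Morphisms only see the labels 1 to n; the label set \<open>X\<close> is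
  therefore renumbered and, at the end, restored.\<close>

lemma extend_null_if_morphism:
  assumes \<phi>: "operad_morphism P Q \<phi>"
    and gen: "\<And>n \<omega>. \<omega> \<in> gens V n \<Longrightarrow> \<phi> n (class_of V R n (generator V n \<omega>)) = cls W R' n (L n \<omega>)"
    and f: "null V R X f"
  shows "null W R' X (extend L f)"
proof (cases "f = 0")
  case True
  then show ?thesis by (simp add: extend_def null.zero)
next
  case False
  note f' = null_in_tree_space[OF f]
  obtain t where t: "t \<in> labeled_trees V X"
    using False tree_spaceD[OF f'] by (metis ex_in_conv keys_eq_empty)
  note X = labeled_treesD(4,5)[OF t]
  let ?n = "card X" and ?r = "rank X"
  have r: "inj_on ?r X" "?r ` X = {1..?n}" "0 \<notin> ?r ` X"
    using bij_betw_rank[OF X(2)] by (auto simp: bij_betw_def)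
  let ?f = "linext (\<lambda>t. basis (relabel ?r t)) f"
  have rf: "null V R {1..?n} ?f"
    using null.relabel[OF f r(1,3)] r(2) by simp
  note rf' = null_in_tree_space[OF rf]
  have "cls V R ?n ?f = cls V R ?n 0"
    using cls_eq_iff[OF V R rf' tree_space_zero] rf by simp
  then have "cls W R' ?n (extend L ?f) = cls W R' ?n (extend L 0)"
    using morphism_on_tree_space[OF \<phi> gen rf'] morphism_on_tree_space[OF \<phi> gen tree_space_zero, of ?n]
    by simp
  then have "null W R' {1..?n} (extend L ?f)"
    using cls_eq_iff[OF W R' extend_in_tree_space[OF L rf'] extend_in_tree_space[OF L tree_space_zero]]
    by (simp add: extend_def)
  then have *: "null W R' {1..?n} (linext (\<lambda>t. basis (relabel ?r t)) (extend L f))"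
    by (simp only: extend_relabel[OF L f'])
  have inv: "inj_on (inv_into X ?r) {1..?n}" "inv_into X ?r ` {1..?n} = X"
    using bij_betw_inv_into[OF bij_betw_rank[OF X(2)]] by (auto simp: bij_betw_def)
  have "relabel (inv_into X ?r) (relabel ?r t) = t" if "t \<in> Poly_Mapping.keys (extend L f)" for t
    unfolding relabel_relabel
    using labeled_treesD(3)[OF tree_spaceD[OF extend_in_tree_space[OF L f'] that]] r(1)
    by (intro relabel_idI) simp
  then have "linext (\<lambda>t. basis (relabel (inv_into X ?r) (relabel ?r t))) (extend L f) = linext basis (extend L f)"
    by (intro linext_cong) simp
  then show ?thesis
    using null.relabel[OF * inv(1)] inv(2) X(1) by (simp add: linext_linext)
qed

lemma ex_morphism:
  assumes equiv: "\<And>n \<sigma> \<omega>. \<omega> \<in> gens V n \<Longrightarrow> \<sigma> permutes {1..n} \<Longrightarrow>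
      null W R' {1..n} (L n (gact V n \<sigma> \<omega>) - linext (\<lambda>t. basis (relabel \<sigma> t)) (L n \<omega>))"
    and rels: "\<And>r X. r \<in> R \<Longrightarrow> r \<in> tree_space V X \<Longrightarrow> null W R' X (extend L r)"
  obtains \<Phi> where "operad_morphism P Q \<Phi>" "\<And>n. \<Phi> n \<in> extensional (comps P n)"
    "\<And>n f. f \<in> tree_space V {1..n} \<Longrightarrow> \<Phi> n (cls V R n f) = cls W R' n (extend L f)"
proof -
  \<comment> \<open>The value is computed from an arbitrary planar representative;
    \<open>null_extend\<close> makes it independent of the choice.\<close>
  define \<Phi> where "\<Phi> n = (\<lambda>A\<in>comps P n.
      cls W R' n (extend L (inv_into (tree_space V {1..n}) (cls V R n) A)))" for n
  have \<Phi>: "\<Phi> n (cls V R n f) = cls W R' n (extend L f)" if f: "f \<in> tree_space V {1..n}" for n f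
  proof -
    let ?g = "inv_into (tree_space V {1..n}) (cls V R n) (cls V R n f)"
    have g: "?g \<in> tree_space V {1..n}" "cls V R n ?g = cls V R n f"
      using inv_into_into[OF imageI[OF f]] f_inv_into_f[OF imageI[OF f]] by blast+
    then have "null V R {1..n} (?g - f)"
      using cls_eq_iff[OF V R g(1) f] by simp
    from null_extend[OF V L equiv rels this]
    have "null W R' {1..n} (extend L ?g - extend L f)"
      by (simp add: extend_def linext_diff)
    then have "cls W R' n (extend L ?g) = cls W R' n (extend L f)"
      using cls_eq_iff[OF W R' extend_in_tree_space[OF L g(1)] extend_in_tree_space[OF L f]] by simp
    then show ?thesis using f by (simp add: \<Phi>_def comps_presented)
  qed
  have "operad_morphism P Q \<Phi>"
    unfolding operad_morphism_def
  proof (intro conjI allI ballI impI)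
    fix n
    show "\<Phi> n \<in> comps P n \<rightarrow> comps Q n"
      by (auto simp: comps_presented \<Phi> intro: extend_in_tree_space[OF L])
    fix x y assume x: "x \<in> comps P n" "y \<in> comps P n"
    then show "\<Phi> n (padd P n x y) = padd Q n (\<Phi> n x) (\<Phi> n y)"
      by (auto simp: comps_presented \<Phi> padd_cls tree_space_add extend_def linext_add)
  next
    fix n c x assume "x \<in> comps P n"
    then show "\<Phi> n (psmul P n c x) = psmul Q n c (\<Phi> n x)"
      by (auto simp: comps_presented \<Phi> psmul_cls tree_space_pscale extend_def linext_pscale)
  next
    fix n \<sigma> x assume \<sigma>: "\<sigma> permutes {1..n}" and "x \<in> comps P n"
    then obtain f where f: "f \<in> tree_space V {1..n}" "x = cls V R n f"
      by (auto simp: comps_presented)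
    have rf: "linext (\<lambda>t. basis (relabel \<sigma> t)) f \<in> tree_space V {1..n}"
      using relabel_sum_in_tree_space[OF f(1) permutes_relabel(1,2)[OF \<sigma>]]
      by (simp only: permutes_relabel(3)[OF \<sigma>])
    show "\<Phi> n (pact P n \<sigma> x) = pact Q n \<sigma> (\<Phi> n x)"
      unfolding f(2) pact_cls[OF \<sigma>] \<Phi>[OF rf] \<Phi>[OF f(1)] extend_relabel[OF L f(1)] ..
  next
    fix m n i x y assume i: "i \<in> {1..m}" and "x \<in> comps P m" "y \<in> comps P n"
    then obtain f g where f: "f \<in> tree_space V {1..m}" "x = cls V R m f"
      and g: "g \<in> tree_space V {1..n}" "y = cls V R n g"
      by (auto simp: comps_presented)
    show "\<Phi> (m + n - 1) (pcomp P m i n x y) = pcomp Q m i n (\<Phi> m x) (\<Phi> n y)"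
      unfolding f(2) g(2) pcomp_cls[OF V R f(1) g(1) i] \<Phi>[OF f(1)] \<Phi>[OF g(1)]
        \<Phi>[OF comp_sum_in_tree_space[OF f(1) g(1) i]] extend_comp_sum[OF L f(1) g(1) i]
        pcomp_cls[OF W R' extend_in_tree_space[OF L f(1)] extend_in_tree_space[OF L g(1)] i] ..
  next
    have "Leaf 1 \<in> labeled_trees V {1..1}" by (simp add: labeled_trees_Leaf)
    then show "\<Phi> 1 (punit P) = punit Q"
      unfolding punit_cls by (subst \<Phi>) simp_all
  qed
  moreover have "\<Phi> n \<in> extensional (comps P n)" for n
    by (simp add: \<Phi>_def)
  ultimately show ?thesis using \<Phi> that by blast
qed

end

section \<open>Arity-splitting\<close>

primrec pointer :: "('v \<times> nat) tree \<Rightarrow> nat" where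
  "pointer (Leaf a) = a"
| "pointer (Node \<omega> ts) = map pointer ts ! (snd \<omega> - 1)"

text \<open>Sets of end points are used instead of single ones because relabeling and grafting pull
  \<open>S\<close> back to a preimage, which need not be a singleton.\<close>

definition project :: "nat set \<Rightarrow> (('v \<times> nat) tree \<Rightarrow>\<^sub>0 'k::field) \<Rightarrow> (('v \<times> nat) tree \<Rightarrow>\<^sub>0 'k)" where
  "project S = linext (\<lambda>t. if pointer t \<in> S then basis t else 0)"

lemma project_zero [simp]: "project S 0 = 0"
  and project_add: "project S (f + g) = project S f + project S g"
  and project_diff: "project S (f - g) = project S f - project S g"
  and project_pscale: "project S (pscale c f) = pscale c (project S f)"
  and project_basis [simp]: "project S (basis t) = (if pointer t \<in> S then basis t else 0)"
  and project_linext: "project S (linext h u) = linext (\<lambda>b. project S (h b)) u"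
  and project_sum: "project S (\<Sum>a\<in>A. k a) = (\<Sum>a\<in>A. project S (k a))"
  by (simp_all add: project_def linext_add linext_diff linext_pscale linext_linext linext_sum)

lemma keys_project: "Poly_Mapping.keys (project S f) \<subseteq> Poly_Mapping.keys f \<inter> {t. pointer t \<in> S}"
  using keys_linext[of "\<lambda>t. if pointer t \<in> S then basis t else 0" f]
  by (auto simp: project_def split: if_splits)

lemma project_homogeneous:
  assumes "\<And>t. t \<in> Poly_Mapping.keys f \<Longrightarrow> pointer t = x"
  shows "project S f = (if x \<in> S then f else 0)"
proof -
  have "project S f = linext (\<lambda>t. if x \<in> S then basis t else 0) f"
    unfolding project_def by (intro linext_cong) (simp add: assms)
  then show ?thesis by simp
qed

lemma project_eq_zero:
  assumes "\<And>t. t \<in> Poly_Mapping.keys f \<Longrightarrow> pointer t \<notin> S"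
  shows "project S f = 0"
proof -
  have "project S f = linext (\<lambda>t. 0) f"
    unfolding project_def by (intro linext_cong) (simp add: assms)
  then show ?thesis by simp
qed

lemma project_in_tree_space: "f \<in> tree_space V X \<Longrightarrow> project S f \<in> tree_space V X"
  using keys_project[of S f] by (auto simp: tree_space_def)

lemma gens_ASp: "\<omega> \<in> gens (ASp_smodule V) n \<longleftrightarrow> fst \<omega> \<in> gens V n \<and> snd \<omega> \<in> {1..n}"
  by (simp add: ASp_smodule_def mem_Times_iff)

lemma gact_ASp: "gact (ASp_smodule V) n \<sigma> \<omega> = (gact V n \<sigma> (fst \<omega>), \<sigma> (snd \<omega>))"
  by (simp add: ASp_smodule_def case_prod_unfold)

lemma decorated_ASp_NodeD:
  assumes "decorated (ASp_smodule V) (Node \<omega> ts)"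
  shows "snd \<omega> - 1 < length ts" "decorated (ASp_smodule V) (ts ! (snd \<omega> - 1))"
    "ts ! (snd \<omega> - 1) \<in> set ts"
proof -
  show "snd \<omega> - 1 < length ts" using assms by (auto simp: gens_ASp)
  then show "ts ! (snd \<omega> - 1) \<in> set ts" by simp
  then show "decorated (ASp_smodule V) (ts ! (snd \<omega> - 1))" using assms by (simp add: list_all_iff)
qed

lemma pointer_in_Lin: "decorated (ASp_smodule V) t \<Longrightarrow> pointer t \<in> Lin t"
proof (induction t)
  case (Node \<omega> ts)
  note D = decorated_ASp_NodeD[OF Node.prems]
  then show ?case using Node.IH[OF D(3,2)] D by auto
qed simp

lemma pointer_subst:
  "decorated (ASp_smodule V) t \<Longrightarrow> pointer (subst h t) = pointer (h (pointer t))"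
proof (induction t)
  case (Node \<omega> ts)
  note D = decorated_ASp_NodeD[OF Node.prems]
  then show ?case using Node.IH[OF D(3,2)] D by simp
qed simp

text \<open>The action moves the mark along with the input it marks, so a reordered vertex still
  points to the same child.\<close>

lemma pointer_iso: "tree_iso (ASp_smodule V) t u \<Longrightarrow> pointer t = pointer u"
proof (induction rule: tree_iso.induct)
  case (cong ts us \<omega>)
  then have "map pointer ts = map pointer us"
    by (auto simp: list_all2_conv_all_nth intro!: nth_equalityI)
  then show ?case by (simp only: pointer.simps)
next
  case (reorder n ts \<omega> \<sigma>)
  let ?i = "snd \<omega>"
  have i: "?i \<in> {1..n}" using reorder(2) by (simp add: gens_ASp)
  then have "\<sigma> ?i \<in> {1..n}" using permutes_in_image[OF reorder(3)] by blast
  then have "\<sigma> ?i - 1 < length ts" "?i - 1 < length [1..<Suc n]" "[1..<Suc n] ! (?i - 1) = ?i"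
    using i reorder(1) by (auto simp del: upt_Suc)
  then show ?case
    by (simp only: pointer.simps gact_ASp snd_conv nth_map length_map)
qed auto

lemma project_relabel:
  assumes "f \<in> tree_space (ASp_smodule V) X"
  shows "project S (linext (\<lambda>t. basis (relabel \<rho> t)) f) = linext (\<lambda>t. basis (relabel \<rho> t)) (project (\<rho> -` S) f)"
proof -
  have "pointer (relabel \<rho> t) = \<rho> (pointer t)" if "t \<in> Poly_Mapping.keys f" for t
    using labeled_treesD(1)[OF tree_spaceD[OF assms that]]
    by (simp add: relabel_def pointer_subst)
  then show ?thesis
    unfolding project_linext project_def[of "\<rho> -` S"] linext_linext
    by (intro linext_cong) simp
qed

text \<open>The congruence of an arity-splitting is graded by the leaf that the root vertices point to.\<close>

lemma null_project:
  assumes hom: "\<And>r. r \<in> R \<Longrightarrow> \<exists>x. \<forall>t\<in>Poly_Mapping.keys r. pointer t = x"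
  shows "null (ASp_smodule V) R X f \<Longrightarrow> null (ASp_smodule V) R X (project S f)"
proof (induction arbitrary: S rule: null.induct)
  case (zero X)
  then show ?case by (simp add: null.zero)
next
  case (add X f g)
  then show ?case by (simp add: project_add null.add)
next
  case (scale X f c)
  then show ?case by (simp add: project_pscale null.scale)
next
  case (iso t X u)
  then show ?case
    using pointer_iso[OF iso(3)] by (simp add: project_diff null.zero null.iso[OF iso])
next
  case (rel r X)
  then obtain x where "\<forall>t\<in>Poly_Mapping.keys r. pointer t = x" using hom by blast
  then show ?case
    using project_homogeneous[of r x S] rel by (auto simp: null.zero null.rel)
next
  case (relabel X f \<rho>)
  then show ?case
    by (simp add: project_relabel[OF null_in_tree_space[OF relabel.hyps(1)]] null.relabel)
next
  case (comp_left X f s Y a)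
  note f = null_in_tree_space[OF comp_left.hyps(1)]
  \<comment> \<open>End points before the grafting: a path that used to reach \<open>a\<close> now
    continues through \<open>s\<close>.\<close>
  let ?S = "{y. (if y = a then pointer s else y) \<in> S}"
  have "pointer (subst (Leaf(a := s)) t) = (if pointer t = a then pointer s else pointer t)"
    if "t \<in> Poly_Mapping.keys f" for t
    using labeled_treesD(1)[OF tree_spaceD[OF f that]] by (simp add: pointer_subst)
  then have "project S (linext (\<lambda>t. basis (subst (Leaf(a := s)) t)) f) =
      linext (\<lambda>t. basis (subst (Leaf(a := s)) t)) (project ?S f)"
    unfolding project_linext project_def[of ?S] linext_linext
    by (intro linext_cong) simp
  then show ?case
    using null.comp_left[OF comp_left.IH comp_left.hyps(2-4)] by simp
next
  case (comp_right t X Y f a)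
  note t = labeled_treesD(1)[OF comp_right.hyps(1)]
  show ?case
  \<comment> \<open>Only a path that reaches \<open>a\<close> feels the inserted sum; otherwise the
    projection keeps or kills all terms alike.\<close>
  proof (cases "pointer t = a")
    case True
    have "project S (linext (\<lambda>s. basis (subst (Leaf(a := s)) t)) f) =
        linext (\<lambda>s. basis (subst (Leaf(a := s)) t)) (project S f)"
      unfolding project_linext project_def[of S] linext_linext
      by (intro linext_cong) (simp add: pointer_subst[OF t] True)
    then show ?thesis
      using null.comp_right[OF comp_right.hyps(1) comp_right.IH comp_right.hyps(3,4)] by simp
  next
    case False
    have "project S (linext (\<lambda>s. basis (subst (Leaf(a := s)) t)) f) =
        linext (\<lambda>s. if pointer t \<in> S then basis (subst (Leaf(a := s)) t) else 0) f"
      unfolding project_linext by (intro linext_cong) (simp add: pointer_subst[OF t] False)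
    then show ?thesis
      using null.comp_right[OF comp_right.hyps] by (cases "pointer t \<in> S") (simp_all add: null.zero)
  qed
qed

section \<open>Components of arity-split trees\<close>

lemma keys_tensor:
  "ts \<in> Poly_Mapping.keys (tensor fs) \<Longrightarrow>
    length ts = length fs \<and> (\<forall>j<length fs. ts ! j \<in> Poly_Mapping.keys (fs ! j))"
proof (induction fs arbitrary: ts)
  case (Cons f fs)
  from subsetD[OF keys_linext Cons.prems[unfolded tensor.simps]]
  obtain b where b: "b \<in> Poly_Mapping.keys f"
    "ts \<in> Poly_Mapping.keys (linext (\<lambda>bs. basis (b # bs)) (tensor fs))"
    by blast
  from subsetD[OF keys_linext b(2)]
  obtain bs where "bs \<in> Poly_Mapping.keys (tensor fs)" "ts = b # bs" by auto
  then show ?case using Cons.IH b(1) by (auto simp: nth_Cons split: nat.split)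
qed simp

lemma keys_graft:
  assumes "t \<in> Poly_Mapping.keys (graft \<omega> fs)"
  obtains ts where "t = Node \<omega> ts" "length ts = length fs"
    "\<And>j. j < length fs \<Longrightarrow> ts ! j \<in> Poly_Mapping.keys (fs ! j)"
proof -
  from subsetD[OF keys_linext assms[unfolded graft_eq_tensor]]
  obtain ts where "ts \<in> Poly_Mapping.keys (tensor fs)" "t = Node \<omega> ts" by auto
  then show ?thesis using keys_tensor[of ts fs] that by blast
qed

text \<open>The mark at the root sends the path into child \<open>i\<close>, so the end point is
  that of this child and the other factors are unrestricted.\<close>

lemma project_graft:
  assumes "i \<in> {1..length fs}"
  shows "project S (graft (\<omega>, i) fs) = graft (\<omega>, i) (fs[i - 1 := project S (fs ! (i - 1))])"
proof -
  let ?j = "i - 1" and ?g = "\<lambda>b. graft (\<omega>, i) (fs[i - 1 := basis b])"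
  have j: "?j < length fs" using assms by auto
  have "project S (graft (\<omega>, i) fs) = project S (graft (\<omega>, i) (fs[?j := fs ! ?j]))" by simp
  also have "\<dots> = linext (\<lambda>b. project S (?g b)) (fs ! ?j)"
    unfolding graft_update[OF j, of _ "fs ! ?j"] project_linext ..
  also have "\<dots> = linext (\<lambda>b. if pointer b \<in> S then ?g b else 0) (fs ! ?j)"
  proof (rule linext_cong)
    fix b
    show "project S (?g b) = (if pointer b \<in> S then ?g b else 0)"
    proof (rule project_homogeneous)
      fix t assume "t \<in> Poly_Mapping.keys (?g b)"
      then obtain ts where "t = Node (\<omega>, i) ts" "length ts = length fs"
        "ts ! ?j \<in> Poly_Mapping.keys ((fs[?j := basis b :: _ \<Rightarrow>\<^sub>0 'b]) ! ?j)"
        using j by (metis keys_graft length_list_update)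
      then show "pointer t = pointer b" using j by simp
    qed
  qed
  also have "\<dots> = linext ?g (project S (fs ! ?j))"
    unfolding project_def linext_linext by (intro linext_cong) simp
  also have "\<dots> = graft (\<omega>, i) (fs[?j := project S (fs ! ?j)])"
    unfolding graft_update[OF j, of _ "project S (fs ! ?j)"] ..
  finally show ?thesis .
qed

text \<open>The corolla of \<open>(\<omega>, *)\<close>.\<close>

definition ASp_gen :: "nat \<Rightarrow> 'v \<Rightarrow> (('v \<times> nat) tree \<Rightarrow>\<^sub>0 'k::field)" where
  "ASp_gen n \<omega> = (\<Sum>i=1..n. basis (corolla n (\<omega>, i)))"

lemma gen_map_ASp_gen: "is_smodule V \<Longrightarrow> gen_map V (ASp_smodule V) ASp_gen"
  unfolding gen_map_def ASp_gen_def
  by (intro allI ballI lin_closed_sum[OF lin_closed_tree_space])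
    (simp only: basis_in_tree_space, rule corolla_labeled[OF is_smodule_ASp], auto simp: gens_ASp)

lemma msubst_tree_corolla:
  "msubst_tree (\<lambda>j. fs ! (j - 1)) (corolla (length fs) \<omega>) = graft \<omega> fs"
proof -
  have "map (msubst_tree (\<lambda>j. fs ! (j - 1))) (map Leaf [1..<Suc (length fs)]) = fs"
    by (rule nth_equalityI) (simp_all del: upt_Suc)
  then show ?thesis by (simp only: msubst_tree.simps)
qed

text \<open>Substituting the children into the sum of marked corollas is grafting them in each
  summand, by \<open>msubst_tree_corolla\<close>.\<close>

lemma ASp_tree_eq_extend:
  fixes t :: "'v tree"
  shows "(ASp_tree t :: ('v \<times> nat) tree \<Rightarrow>\<^sub>0 'k::field) = extend_tree ASp_gen t"
proof (induction t)
  case (Node \<omega> ts)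
  have "extend_tree ASp_gen (Node \<omega> ts) =
      (\<Sum>i=1..length ts. graft (\<omega>, i) (map (extend_tree ASp_gen) ts) :: _ \<Rightarrow>\<^sub>0 'k)"
    by (simp only: extend_tree.simps ASp_gen_def[of "length ts"] msubst_def linext_sum linext_single
        one_pscale msubst_tree_corolla[of "map f ts" for f, unfolded length_map])
  also have "map (extend_tree ASp_gen) ts = map (ASp_tree :: _ \<Rightarrow> _ \<Rightarrow>\<^sub>0 'k) ts"
    using Node by simp
  finally show ?case by simp
qed simp

lemma keys_ASp_tree_pointer:
  assumes "is_smodule V" "t \<in> labeled_trees V X" "u \<in> Poly_Mapping.keys (ASp_tree t)"
  shows "pointer u \<in> X"
proof -
  have "u \<in> labeled_trees (ASp_smodule V) X"
    using tree_spaceD[OF extend_tree_in_tree_space[OF gen_map_ASp_gen[OF assms(1)] assms(2)]] assms(3)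
    unfolding ASp_tree_eq_extend .
  then show ?thesis using pointer_in_Lin labeled_treesD(1,3) by blast
qed

text \<open>In the summand with root mark \<open>i\<close> the path ends inside child
  \<open>i\<close>. So only the child that contains \<open>x\<close> contributes, and there the
  projection passes to the child, as in the recursion of \<open>ASp_tree_at\<close>.\<close>

lemma ASp_tree_at_eq_project:
  fixes t :: "'v tree"
  assumes V: "is_smodule V"
  shows "t \<in> labeled_trees V X \<Longrightarrow> x \<in> X \<Longrightarrow>
    (ASp_tree_at x t :: ('v \<times> nat) tree \<Rightarrow>\<^sub>0 'k::field) = project {x} (ASp_tree t)"
proof (induction t arbitrary: X)
  case (Leaf a)
  then show ?case by (auto simp: labeled_trees_def)
next
  case (Node \<omega> ts)
  note ts = labeled_trees_NodeD[OF Node.prems(1)]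
  let ?I = "{i \<in> {1..length ts}. x \<in> Lin (ts ! (i - 1))}"
  let ?g = "\<lambda>i. graft (\<omega>, i) ((map ASp_tree ts)[i - 1 := project {x} (ASp_tree (ts ! (i - 1)))])
    :: ('v \<times> nat) tree \<Rightarrow>\<^sub>0 'k"
  have "project {x} (ASp_tree (Node \<omega> ts)) = (\<Sum>i=1..length ts. ?g i)"
    unfolding ASp_tree.simps project_sum
    by (intro sum.cong HOL.refl) (auto simp: project_graft)
  also have "\<dots> = (\<Sum>i\<in>?I. ?g i)"
  proof (rule sum.mono_neutral_right)
    show "\<forall>i\<in>{1..length ts} - ?I. ?g i = 0"
    proof
      fix i assume "i \<in> {1..length ts} - ?I"
      then have i: "i - 1 < length ts" "x \<notin> Lin (ts ! (i - 1))" by auto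
      have "project {x} (ASp_tree (ts ! (i - 1)) :: _ \<Rightarrow>\<^sub>0 'k) = 0"
        using keys_ASp_tree_pointer[OF V ts(2)[OF i(1)]] i(2) by (intro project_eq_zero) auto
      then show "?g i = 0"
        using graft_update[of "i - 1" "map ASp_tree ts" "(\<omega>, i)" 0] i(1) by simp
    qed
  qed auto
  also have "\<dots> = ASp_tree_at x (Node \<omega> ts)"
    unfolding ASp_tree_at.simps
  proof (rule sum.cong[OF HOL.refl])
    fix i assume "i \<in> ?I"
    then have i: "i - 1 < length ts" "x \<in> Lin (ts ! (i - 1))" by auto
    then show "?g i = graft (\<omega>, i) ((map ASp_tree ts)[i - 1 := map (ASp_tree_at x) ts ! (i - 1)])"
      using Node.IH[OF nth_mem[OF i(1)] ts(2)[OF i(1)] i(2)] by simp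
  qed
  finally show ?case ..
qed

lemma linext_ASp_tree_at:
  assumes V: "is_smodule V" and r: "r \<in> tree_space V X" and x: "x \<in> X"
  shows "linext (ASp_tree_at x) r = project {x} (extend ASp_gen r)"
  unfolding extend_def project_linext
  by (intro linext_cong)
    (simp only: ASp_tree_at_eq_project[OF V tree_spaceD[OF r] x] ASp_tree_eq_extend)

section \<open>Relations of an arity-splitting and the canonical morphism\<close>

lemma rel_Lin_eq:
  assumes "r \<in> tree_space V X" "r \<noteq> 0"
  shows "rel_Lin r = X" "finite X"
proof -
  obtain t where t: "t \<in> Poly_Mapping.keys r" using assms(2) by (metis ex_in_conv keys_eq_empty)
  have "Lin u = X" if "u \<in> Poly_Mapping.keys r" for u
    using labeled_treesD(3)[OF tree_spaceD[OF assms(1) that]] .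
  then show "rel_Lin r = X" using t by (auto simp: rel_Lin_def)
  show "finite X" using labeled_treesD(5)[OF tree_spaceD[OF assms(1) t]] .
qed

lemma ASp_relationsE:
  assumes V: "is_smodule V" and R: "\<forall>r\<in>R. locally_homogeneous V r" and "r' \<in> ASp_relations R"
  obtains r x X where "r \<in> R" "r \<in> tree_space V X" "x \<in> X" "finite X"
    "r' = project {x} (extend ASp_gen r)" "r' \<in> tree_space (ASp_smodule V) X"
proof -
  obtain r x where r: "r \<in> R" "x \<in> rel_Lin r" "r' = linext (ASp_tree_at x) r"
    using assms(3) by (auto simp: ASp_relations_def)
  obtain X where X: "r \<in> tree_space V X"
    using R r(1) by (auto simp: locally_homogeneous_def tree_space_def)
  have "r \<noteq> 0" using r(2) by (auto simp: rel_Lin_def)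
  then have "x \<in> X" "finite X" using rel_Lin_eq[OF X] r(2) by auto
  moreover from this have "r' = project {x} (extend ASp_gen r)"
    using linext_ASp_tree_at[OF V X] r(3) by simp
  moreover from this have "r' \<in> tree_space (ASp_smodule V) X"
    using project_in_tree_space[OF extend_in_tree_space[OF gen_map_ASp_gen[OF V] X]] by simp
  ultimately show ?thesis using that r(1) X by blast
qed

lemma locally_homogeneous_ASp:
  assumes "is_smodule V" "\<forall>r\<in>R. locally_homogeneous V r"
  shows "\<forall>r\<in>ASp_relations R. locally_homogeneous (ASp_smodule V) r"
  using ASp_relationsE[OF assms] by (metis locally_homogeneous_def mem_Collect_eq tree_space_def)

lemma ASp_relations_pointer:
  assumes "is_smodule V" "\<forall>r\<in>R. locally_homogeneous V r" "r' \<in> ASp_relations R"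
  shows "\<exists>x. \<forall>t\<in>Poly_Mapping.keys r'. pointer t = x"
proof -
  obtain r x where "r' = project {x} (extend ASp_gen r)"
    using ASp_relationsE[OF assms] by metis
  then show ?thesis using keys_project[of "{x}" "extend ASp_gen r"] by (intro exI[of _ x]) auto
qed

text \<open>By \<open>pointer_in_Lin\<close> every path ends in a leaf of its tree, so the
  components exhaust \<open>f\<close>.\<close>

lemma sum_project:
  assumes f: "f \<in> tree_space (ASp_smodule V) X" and "finite X"
  shows "(\<Sum>x\<in>X. project {x} f) = f"
proof -
  have "(\<Sum>x\<in>X. project {x} f) = linext (\<lambda>t. \<Sum>x\<in>X. if pointer t \<in> {x} then basis t else 0) f"
    by (simp add: project_def linext_fun_sum)
  also have "\<dots> = linext basis f"
  proof (rule linext_cong)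
    fix t assume "t \<in> Poly_Mapping.keys f"
    then have "pointer t \<in> X"
      using labeled_treesD(1,3)[OF tree_spaceD[OF f]] pointer_in_Lin by blast
    then show "(\<Sum>x\<in>X. if pointer t \<in> {x} then basis t else 0) = basis t"
      using assms(2) by simp
  qed
  finally show ?thesis by simp
qed

lemma null_ASp_gen:
  fixes R :: "(('v \<times> nat) tree \<Rightarrow>\<^sub>0 'k::field) set"
  assumes V: "is_smodule V" and \<omega>: "\<omega> \<in> gens V n" and \<sigma>: "\<sigma> permutes {1..n}"
  shows "null (ASp_smodule V) R {1..n}
    (ASp_gen n (gact V n \<sigma> \<omega>) - linext (\<lambda>t. basis (relabel \<sigma> t)) (ASp_gen n \<omega>))"
proof -
  \<comment> \<open>Reindexing the marks by \<open>\<sigma>\<close> makes each mark follow its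
    input, as the action on split generators requires.\<close>
  have "ASp_gen n (gact V n \<sigma> \<omega>) = (\<Sum>i=1..n. basis (corolla n (gact V n \<sigma> \<omega>, \<sigma> i)) :: _ \<Rightarrow>\<^sub>0 'k)"
    unfolding ASp_gen_def by (subst sum.permute[OF \<sigma>]) (simp add: comp_def)
  then have "ASp_gen n (gact V n \<sigma> \<omega>) - linext (\<lambda>t. basis (relabel \<sigma> t)) (ASp_gen n \<omega>) =
    (\<Sum>i=1..n. basis (corolla n (gact (ASp_smodule V) n \<sigma> (\<omega>, i))) - basis (relabel \<sigma> (corolla n (\<omega>, i))) :: _ \<Rightarrow>\<^sub>0 'k)"
    by (simp add: ASp_gen_def linext_sum sum_subtractf gact_ASp del: upt_Suc)
  moreover have "null (ASp_smodule V) R {1..n} \<dots>"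
    by (intro null_sum null_corolla[OF is_smodule_ASp[OF V] _ \<sigma>]) (use \<omega> in \<open>simp add: gens_ASp\<close>)
  ultimately show ?thesis by (simp only:)
qed

text \<open>The component at each leaf is itself a split relation, and the components add up to the
  whole.\<close>

lemma null_extend_ASp_gen_rel:
  assumes V: "is_smodule V" and R: "\<forall>r\<in>R. locally_homogeneous V r"
    and r: "r \<in> R" "r \<in> tree_space V X"
  shows "null (ASp_smodule V) (ASp_relations R) X (extend ASp_gen r)"
proof (cases "r = 0")
  case True
  then show ?thesis by (simp add: extend_def null.zero)
next
  case False
  note X = rel_Lin_eq[OF r(2) False]
  note E = extend_in_tree_space[OF gen_map_ASp_gen[OF V] r(2)]
  have "null (ASp_smodule V) (ASp_relations R) X (\<Sum>x\<in>X. project {x} (extend ASp_gen r))"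
  proof (intro null_sum null.rel)
    fix x assume "x \<in> X"
    then show "project {x} (extend ASp_gen r) \<in> ASp_relations R"
      using linext_ASp_tree_at[OF V r(2), of x] r(1) X(1) unfolding ASp_relations_def by force
  qed (rule project_in_tree_space[OF E])
  then show ?thesis by (simp add: sum_project[OF E X(2)])
qed

lemma null_extend_ASp_gen:
  assumes V: "is_smodule V" and R: "\<forall>r\<in>R. locally_homogeneous V r" and "null V R X f"
  shows "null (ASp_smodule V) (ASp_relations R) X (extend ASp_gen f)"
  by (rule null_extend[OF V gen_map_ASp_gen[OF V] null_ASp_gen[OF V] null_extend_ASp_gen_rel[OF V R] assms(3)])

lemma class_of_ASp_gen:
  "class_of (ASp_smodule V) R n (\<Sum>i=1..n. generator (ASp_smodule V) n (\<omega>, i)) =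
    cls (ASp_smodule V) R n (ASp_gen n \<omega>)"
  by (simp add: cls_def generator_eq ASp_gen_def iso_sum_def linext_sum del: upt_Suc)

text \<open>\<open>alpha\<close> is a definite description and can be evaluated only when both
  halves are known: existence comes from \<open>ex_morphism\<close>, uniqueness from
  \<open>morphism_on_tree_space\<close> together with extensionality.\<close>

lemma alpha_cls:
  assumes V: "is_smodule V" and R: "\<forall>r\<in>R. locally_homogeneous V r"
    and f: "f \<in> tree_space V {1..n}"
  shows "alpha V R n (cls V R n f) = cls (ASp_smodule V) (ASp_relations R) n (extend ASp_gen f)"
proof -
  interpret presented_pair V "ASp_smodule V" R "ASp_relations R" ASp_gen
    using V R locally_homogeneous_ASp[OF V R] by unfold_locales (auto intro: is_smodule_ASp gen_map_ASp_gen)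
  let ?cond = "\<lambda>\<alpha>. operad_morphism P Q \<alpha> \<and> (\<forall>n. \<alpha> n \<in> extensional (comps P n)) \<and>
    (\<forall>n. \<forall>\<omega>\<in>gens V n. \<alpha> n (class_of V R n (generator V n \<omega>)) =
        class_of (ASp_smodule V) (ASp_relations R) n
          (\<Sum>i=1..n. generator (ASp_smodule V) n (\<omega>, i)))"
  obtain \<Phi> where \<Phi>: "operad_morphism P Q \<Phi>" "\<And>n. \<Phi> n \<in> extensional (comps P n)"
    "\<And>n f. f \<in> tree_space V {1..n} \<Longrightarrow>
      \<Phi> n (cls V R n f) = cls (ASp_smodule V) (ASp_relations R) n (extend ASp_gen f)"
    using ex_morphism[OF null_ASp_gen[OF V] null_extend_ASp_gen_rel[OF V R]] by metis
  have "\<Phi> n (class_of V R n (generator V n \<omega>)) =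
      class_of (ASp_smodule V) (ASp_relations R) n (\<Sum>i=1..n. generator (ASp_smodule V) n (\<omega>, i))"
    if "\<omega> \<in> gens V n" for n \<omega>
    unfolding class_of_ASp_gen
    using \<Phi>(3)[of "basis (corolla n \<omega>)" n] corolla_labeled[OF V that] extend_tree_corolla[OF L that]
    by (simp add: cls_def generator_eq del: upt_Suc)
  then have "?cond \<Phi>" using \<Phi>(1,2) by blast
  moreover have "\<alpha> = \<Phi>" if \<alpha>: "?cond \<alpha>" for \<alpha>
  proof
    fix n
    show "\<alpha> n = \<Phi> n"
    proof (rule extensionalityI[of _ "comps P n"])
      fix x assume "x \<in> comps P n"
      then obtain f where f: "f \<in> tree_space V {1..n}" "x = cls V R n f" by (auto simp: comps_presented)
      have "\<alpha> n (cls V R n f) = cls (ASp_smodule V) (ASp_relations R) n (extend ASp_gen f)"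
        using \<alpha> unfolding class_of_ASp_gen by (intro morphism_on_tree_space f(1)) blast+
      then show "\<alpha> n x = \<Phi> n x" using \<Phi>(3) f by simp
    qed (use \<alpha> \<Phi> in auto)
  qed
  ultimately have "alpha V R = \<Phi>"
    unfolding alpha_def ASp_operad_def by (rule the_equality)
  then show ?thesis using \<Phi>(3)[OF f] by simp
qed

section \<open>Extensions that preserve end points\<close>

lemma keys_msubst_tree_pointer:
  "decorated (ASp_smodule V) s \<Longrightarrow> u \<in> Poly_Mapping.keys (msubst_tree g s) \<Longrightarrow>
    \<exists>v\<in>Poly_Mapping.keys (g (pointer s)). pointer u = pointer v"
proof (induction s arbitrary: u)
  case (Node \<omega> ts)
  note D = decorated_ASp_NodeD[OF Node.prems(1)]
  obtain us where us: "u = Node \<omega> us" "length us = length ts"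
    "us ! (snd \<omega> - 1) \<in> Poly_Mapping.keys (msubst_tree g (ts ! (snd \<omega> - 1)))"
    using Node.prems(2) D(1) by (auto elim!: keys_graft)
  then show ?case using Node.IH[OF D(3,2) us(3)] D(1) by simp
qed auto

text \<open>The image of a vertex leads the path to the leaf numbered by the mark, where the image
  of exactly the marked child has been inserted; the path continues there by induction.\<close>

lemma keys_extend_tree_pointer:
  assumes L: "gen_map (ASp_smodule V) (ASp_smodule W) L"
    and ptr: "\<And>n \<omega> s. \<omega> \<in> gens (ASp_smodule V) n \<Longrightarrow> s \<in> Poly_Mapping.keys (L n \<omega>) \<Longrightarrow> pointer s = snd \<omega>"
  shows "decorated (ASp_smodule V) t \<Longrightarrow> u \<in> Poly_Mapping.keys (extend_tree L t) \<Longrightarrow> pointer u = pointer t"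
proof (induction t arbitrary: u)
  case (Node \<omega> ts)
  note D = decorated_ASp_NodeD[OF Node.prems(1)]
  let ?g = "\<lambda>j. map (extend_tree L) ts ! (j - 1)"
  have \<omega>: "\<omega> \<in> gens (ASp_smodule V) (length ts)" using Node.prems(1) by simp
  obtain s where s: "s \<in> Poly_Mapping.keys (L (length ts) \<omega>)" "u \<in> Poly_Mapping.keys (msubst_tree ?g s)"
    using Node.prems(2) keys_linext[of "msubst_tree ?g" "L (length ts) \<omega>"] by (auto simp: msubst_def)
  have "decorated (ASp_smodule W) s"
    using labeled_treesD(1)[OF tree_spaceD[OF gen_mapD[OF L \<omega>] s(1)]] .
  from keys_msubst_tree_pointer[OF this s(2)] ptr[OF \<omega> s(1)]
  obtain v where "v \<in> Poly_Mapping.keys (?g (snd \<omega>))" "pointer u = pointer v" by auto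
  then show ?case using Node.IH[OF D(3,2)] D(1) by simp
qed simp

lemma extend_project:
  assumes L: "gen_map (ASp_smodule V) (ASp_smodule W) L"
    and ptr: "\<And>n \<omega> s. \<omega> \<in> gens (ASp_smodule V) n \<Longrightarrow> s \<in> Poly_Mapping.keys (L n \<omega>) \<Longrightarrow> pointer s = snd \<omega>"
    and f: "f \<in> tree_space (ASp_smodule V) X"
  shows "extend L (project S f) = project S (extend L f)"
proof -
  have *: "project S (extend_tree L t) = extend L (project S (basis t))" if "t \<in> Poly_Mapping.keys f" for t
  proof -
    have "decorated (ASp_smodule V) t" using labeled_treesD(1)[OF tree_spaceD[OF f that]] .
    then have "project S (extend_tree L t) = (if pointer t \<in> S then extend_tree L t else 0)"
      by (intro project_homogeneous keys_extend_tree_pointer[OF L ptr])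
    then show ?thesis by (simp add: extend_def)
  qed
  have "project S (extend L f) = linext (\<lambda>t. project S (extend_tree L t)) f"
    by (simp add: extend_def project_linext)
  also have "\<dots> = linext (\<lambda>t. extend L (project S (basis t))) f"
    by (rule linext_cong) (rule *)
  also have "\<dots> = extend L (project S f)"
    by (simp add: project_def extend_linext)
  finally show ?thesis ..
qed

theorem theorem4p8:
  fixes V :: "'v smodule" and W :: "'w smodule"
    and R\<^sub>P :: "('v tree \<Rightarrow>\<^sub>0 'k::field) set" and R\<^sub>Q :: "('w tree \<Rightarrow>\<^sub>0 'k) set"
    and \<eta> :: "nat \<Rightarrow> ('v tree set \<Rightarrow>\<^sub>0 'k) set \<Rightarrow> ('w tree set \<Rightarrow>\<^sub>0 'k) set"
  assumes "is_smodule V" and "\<forall>r\<in>R\<^sub>P. locally_homogeneous V r"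
    and "is_smodule W" and "\<forall>r\<in>R\<^sub>Q. locally_homogeneous W r"
    and "operad_morphism (presented_operad V R\<^sub>P) (presented_operad W R\<^sub>Q) \<eta>"
  shows "\<exists>ASp_\<eta>. operad_morphism (ASp_operad V R\<^sub>P) (ASp_operad W R\<^sub>Q) ASp_\<eta> \<and>
    (\<forall>n. \<forall>x\<in>comps (presented_operad V R\<^sub>P) n.
       ASp_\<eta> n (alpha V R\<^sub>P n x) = alpha W R\<^sub>Q n (\<eta> n x))"
proof -
  note V = assms(1) and RP = assms(2) and W = assms(3) and RQ = assms(4) and \<eta> = assms(5)
  let ?AV = "ASp_smodule V" and ?AW = "ASp_smodule W"
  let ?AP = "ASp_relations R\<^sub>P" and ?AQ = "ASp_relations R\<^sub>Q"
  have gen_cls: "class_of V R\<^sub>P n (generator V n \<omega>) = cls V R\<^sub>P n (basis (corolla n \<omega>))" for n \<omega>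
    by (simp add: cls_def generator_eq)
  \<comment> \<open>Any planar representative of the image will do; nothing relates the choices made
    for \<open>\<omega>\<close> and for its translates under the action.\<close>
  define H where "H n \<omega> = (SOME h. h \<in> tree_space W {1..n} \<and>
      cls W R\<^sub>Q n h = \<eta> n (class_of V R\<^sub>P n (generator V n \<omega>)))" for n \<omega>
  have H: "H n \<omega> \<in> tree_space W {1..n}"
    "cls W R\<^sub>Q n (H n \<omega>) = \<eta> n (class_of V R\<^sub>P n (generator V n \<omega>))" if "\<omega> \<in> gens V n" for n \<omega>
  proof -
    have "class_of V R\<^sub>P n (generator V n \<omega>) \<in> comps (presented_operad V R\<^sub>P) n"
      unfolding gen_cls comps_presented
      by (rule imageI) (simp only: basis_in_tree_space corolla_labeled[OF V that])
    from operad_morphismD(1)[OF \<eta> this]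
    have "\<exists>h. h \<in> tree_space W {1..n} \<and> cls W R\<^sub>Q n h = \<eta> n (class_of V R\<^sub>P n (generator V n \<omega>))"
      unfolding comps_presented by (metis imageE)
    from someI_ex[OF this] show "H n \<omega> \<in> tree_space W {1..n}"
      "cls W R\<^sub>Q n (H n \<omega>) = \<eta> n (class_of V R\<^sub>P n (generator V n \<omega>))"
      unfolding H_def by blast+
  qed
  interpret H: presented_pair V W R\<^sub>P R\<^sub>Q H
    using V W RP RQ H(1) by unfold_locales (auto simp: gen_map_def)
  \<comment> \<open>\<open>H\<close> was chosen on generators only; uniqueness of morphisms makes
    its extension compute \<open>\<eta>\<close> on all classes.\<close>
  have \<eta>_cls: "\<eta> n (cls V R\<^sub>P n f) = cls W R\<^sub>Q n (extend H f)"
    if "f \<in> tree_space V {1..n}" for n f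
    by (rule H.morphism_on_tree_space[OF \<eta> _ that]) (rule H(2)[symmetric])
  have null_H: "null W R\<^sub>Q X (extend H f)" if "null V R\<^sub>P X f" for X f
    by (rule H.extend_null_if_morphism[OF \<eta> _ that]) (rule H(2)[symmetric])
  have AV: "gen_map V ?AV ASp_gen" and AW: "gen_map W ?AW ASp_gen"
    using gen_map_ASp_gen V W by blast+
  \<comment> \<open>By \<open>linext_ASp_tree_at\<close> this is the arity-splitting of
    \<open>H n (fst \<omega>)\<close> at the leaf given by the mark.\<close>
  define L where "L n \<omega> = project {snd \<omega>} (extend ASp_gen (H n (fst \<omega>)))" for n and \<omega> :: "'v \<times> nat"
  have L: "gen_map ?AV ?AW L"
    unfolding gen_map_def L_def
    by (intro allI ballI project_in_tree_space extend_in_tree_space[OF AW] H(1)) (simp add: gens_ASp)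
  have ptr: "pointer s = snd \<omega>" if "\<omega> \<in> gens ?AV n" "s \<in> Poly_Mapping.keys (L n \<omega>)" for n \<omega> s
    using subsetD[OF keys_project that(2)[unfolded L_def]] by simp
  have null_project_Q: "null ?AW ?AQ X (project S f)" if "null ?AW ?AQ X f" for X S f
    by (rule null_project[OF ASp_relations_pointer[OF W RQ] that])
  have equiv: "null ?AW ?AQ {1..n} (L n (gact ?AV n \<sigma> \<omega>) - linext (\<lambda>t. basis (relabel \<sigma> t)) (L n \<omega>))"
    if \<omega>: "\<omega> \<in> gens ?AV n" and \<sigma>: "\<sigma> permutes {1..n}" for n \<sigma> \<omega>
  proof -
    let ?o = "fst \<omega>" and ?i = "snd \<omega>" and ?rel = "\<lambda>f. linext (\<lambda>t. basis (relabel \<sigma> t)) f"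
    have o: "?o \<in> gens V n" using \<omega> by (simp add: gens_ASp)
    have o': "gact V n \<sigma> ?o \<in> gens V n" using V o \<sigma> unfolding is_smodule_def by blast
    note perm = permutes_relabel[OF \<sigma>]
    have c: "corolla n ?o \<in> labeled_trees V {1..n}" "corolla n (gact V n \<sigma> ?o) \<in> labeled_trees V {1..n}"
      using corolla_labeled[OF V] o o' by blast+
    have c': "relabel \<sigma> (corolla n ?o) \<in> labeled_trees V {1..n}"
      using labeled_trees_relabel[OF c(1) perm(1,2)] by (simp only: perm(3))
    have rH: "?rel (H n ?o) \<in> tree_space W {1..n}"
      using relabel_sum_in_tree_space[OF H(1)[OF o] perm(1,2)] by (simp only: perm(3))
    have "cls V R\<^sub>P n (basis (corolla n (gact V n \<sigma> ?o))) = cls V R\<^sub>P n (basis (relabel \<sigma> (corolla n ?o)))"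
      by (rule cls_eq_iff[OF V RP, THEN iffD2])
        (simp_all only: basis_in_tree_space c(2) c' null_corolla[OF V o \<sigma>])
    also have "\<dots> = pact (presented_operad V R\<^sub>P) n \<sigma> (cls V R\<^sub>P n (basis (corolla n ?o)))"
      unfolding pact_cls[OF \<sigma>] by simp
    finally have "\<eta> n (cls V R\<^sub>P n (basis (corolla n (gact V n \<sigma> ?o)))) =
        pact (presented_operad W R\<^sub>Q) n \<sigma> (\<eta> n (cls V R\<^sub>P n (basis (corolla n ?o))))"
      using operad_morphismD(4)[OF \<eta> \<sigma>] c(1) by (simp add: comps_presented)
    then have "cls W R\<^sub>Q n (H n (gact V n \<sigma> ?o)) = cls W R\<^sub>Q n (?rel (H n ?o))"
      unfolding H(2)[OF o, unfolded gen_cls, symmetric] H(2)[OF o', unfolded gen_cls, symmetric]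
        pact_cls[OF \<sigma>] .
    \<comment> \<open>Thus \<open>H\<close> is equivariant up to the relations of the target.
      Arity-splitting and projection both keep null sums null, which carries this over to
      \<open>L\<close>.\<close>
    then have "null W R\<^sub>Q {1..n} (H n (gact V n \<sigma> ?o) - ?rel (H n ?o))"
      using cls_eq_iff[OF W RQ H(1)[OF o'] rH] by simp
    from null_project_Q[OF null_extend_ASp_gen[OF W RQ this], of "{\<sigma> ?i}"]
    have "null ?AW ?AQ {1..n} (project {\<sigma> ?i} (extend ASp_gen (H n (gact V n \<sigma> ?o))) -
        project {\<sigma> ?i} (?rel (extend ASp_gen (H n ?o))))"
      unfolding extend_relabel[OF AW H(1)[OF o], symmetric] by (simp add: extend_def linext_diff project_diff)
    \<comment> \<open>Projecting to \<open>\<sigma> ?i\<close> after the relabeling is then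
      projecting to \<open>?i\<close> before it.\<close>
    moreover have "\<sigma> -` {\<sigma> ?i} = {?i}"
      using permutes_inj[OF \<sigma>] by (auto simp: inj_def)
    ultimately show ?thesis
      unfolding L_def gact_ASp fst_conv snd_conv
      by (simp add: project_relabel[OF extend_in_tree_space[OF AW H(1)[OF o]]])
  qed
  \<comment> \<open>The components at all marks add up to the whole arity-splitting.\<close>
  have L_ASp: "extend L (ASp_gen n \<omega>) = extend ASp_gen (H n \<omega>)" if "\<omega> \<in> gens V n" for n \<omega>
  proof -
    have "extend L (ASp_gen n \<omega>) = (\<Sum>i=1..n. extend_tree L (corolla n (\<omega>, i)))"
      by (simp add: ASp_gen_def extend_def linext_sum)
    also have "\<dots> = (\<Sum>i=1..n. project {i} (extend ASp_gen (H n \<omega>)))"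
      using that by (intro sum.cong HOL.refl) (subst extend_tree_corolla[OF L], auto simp: gens_ASp L_def)
    finally show ?thesis
      using sum_project[OF extend_in_tree_space[OF AW H(1)[OF that]]] by simp
  qed
  \<comment> \<open>The commuting square on planar sums: two composites of extensions that agree on
    generators.\<close>
  have L_extend: "extend L (extend ASp_gen f) = extend ASp_gen (extend H f)"
    if f: "f \<in> tree_space V X" for f X
    unfolding extend_extend[OF AV L f] extend_extend[OF H.L AW f]
    by (rule extend_cong[OF L_ASp f])
  \<comment> \<open>A split relation is a component of the splitting of some \<open>r\<close>. By
    the square and \<open>extend_project\<close>, its image is the corresponding component of the
    splitting of \<open>extend H r\<close>, and the latter sum is null because \<open>\<eta>\<close>
    is defined on the quotient.\<close>
  have rels: "null ?AW ?AQ X (extend L r')" if r': "r' \<in> ?AP" "r' \<in> tree_space ?AV X" for r' X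
  proof (cases "r' = 0")
    case True
    then show ?thesis by (simp add: extend_def null.zero)
  next
    case False
    obtain r x Y where r: "r \<in> R\<^sub>P" "r \<in> tree_space V Y" "r' = project {x} (extend ASp_gen r)"
      "r' \<in> tree_space ?AV Y"
      using ASp_relationsE[OF V RP r'(1)] by metis
    \<comment> \<open>A nonzero sum determines its label set; \<open>X\<close> comes from the
      hypothesis on \<open>r'\<close>, \<open>Y\<close> from \<open>r\<close>.\<close>
    have "X = Y" using rel_Lin_eq(1)[OF _ False] r'(2) r(4) by metis
    moreover have "extend L r' = project {x} (extend ASp_gen (extend H r))"
      unfolding r(3) L_extend[OF r(2), symmetric]
      by (rule extend_project[OF L _ extend_in_tree_space[OF AV r(2)]]) (rule ptr)
    moreover have "null W R\<^sub>Q Y (extend H r)"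
      by (rule null_H[OF null.rel[OF r(1,2)]])
    ultimately show ?thesis
      using null_project_Q[OF null_extend_ASp_gen[OF W RQ]] by simp
  qed
  interpret L: presented_pair ?AV ?AW ?AP ?AQ L
    using is_smodule_ASp[OF V] is_smodule_ASp[OF W] locally_homogeneous_ASp[OF V RP]
      locally_homogeneous_ASp[OF W RQ] L
    by unfold_locales
  obtain \<Psi> where \<Psi>: "operad_morphism L.P L.Q \<Psi>"
    "\<And>n f. f \<in> tree_space ?AV {1..n} \<Longrightarrow> \<Psi> n (cls ?AV ?AP n f) = cls ?AW ?AQ n (extend L f)"
    using L.ex_morphism[OF equiv rels] by metis
  have "\<Psi> n (alpha V R\<^sub>P n x) = alpha W R\<^sub>Q n (\<eta> n x)"
    if "x \<in> comps (presented_operad V R\<^sub>P) n" for n x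
  proof -
    obtain f where f: "f \<in> tree_space V {1..n}" "x = cls V R\<^sub>P n f"
      using \<open>x \<in> comps (presented_operad V R\<^sub>P) n\<close> by (auto simp: comps_presented)
    have "\<Psi> n (alpha V R\<^sub>P n x) = cls ?AW ?AQ n (extend L (extend ASp_gen f))"
      unfolding f(2) alpha_cls[OF V RP f(1)] by (rule \<Psi>(2)[OF extend_in_tree_space[OF AV f(1)]])
    also have "\<dots> = alpha W R\<^sub>Q n (cls W R\<^sub>Q n (extend H f))"
      unfolding alpha_cls[OF W RQ extend_in_tree_space[OF H.L f(1)]] L_extend[OF f(1)] ..
    also have "\<dots> = alpha W R\<^sub>Q n (\<eta> n x)"
      unfolding f(2) \<eta>_cls[OF f(1)] ..
    finally show ?thesis .
  qed
  then show ?thesis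
    using \<Psi>(1) unfolding ASp_operad_def by blast
qed

end
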